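(* Suppose $\mathcal{R}$ expands an ordered field and satisfies $den_e(R)<|R|$. Let $(X,\tau)$ be a definable topological space with $\dim X\leq 1$. Then $(X,\tau)$ is metrizable if and only if it is definably metrizable.
   Context: $\mathcal{R}=(R,<,\dots)$ is an o-minimal structure; "definable" means definable in $\mathcal{R}$ with parameters; $\dim$ is o-minimal dimension. $den_e(R)$ is the minimum cardinality of a dense subset of $R$ in its order topology. A definable topological space is a pair $(X,\tau)$ with $X\subseteq R^n$ definable and $\tau$ a topology on $X$ with a basis which is a definable family of sets. An $\mathcal{R}$-metric on $X$ is a map $d:X\times X\to R^{\geq0}$ satisfying identity of indiscernibles, symmetry and the triangle inequality; it generates a topology via open balls. $(X,\tau)$ is metrizable if some (not necessarily definable) $\mathcal{R}$-metric on $X$ generates $\tau$, and definably metrizable if some definable $\mathcal{R}$-metric generates $\tau$. *)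

theory Defs
  imports "HOL-Analysis.Analysis"
begin

unbundle cardinal_syntax

text \<open>\<open>R\<^sup>n\<close> is the set of functions on \<open>{0, \<dots>, n - 1}\<close>, extensional as in the library's product
  topology. Appending one coordinate \<open>t\<close> to \<open>x \<in> R\<^sup>n\<close> is \<open>x(n := t) \<in> R\<^sup>n\<^sup>+\<^sup>1\<close>.\<close>

definition tuples :: "nat \<Rightarrow> (nat \<Rightarrow> 'a) set" where
  "tuples n = (\<Pi>\<^sub>E i\<in>{..<n}. UNIV)"

definition cat :: "nat \<Rightarrow> (nat \<Rightarrow> 'a) \<Rightarrow> (nat \<Rightarrow> 'a) \<Rightarrow> nat \<Rightarrow> 'a" where
  "cat n x y = (\<lambda>i. if i < n then x i else y (i - n))"

text \<open>A value of type \<open>('f, 'r, 'a) fo_structure\<close> is a structure \<open>(R, <, \<dots>)\<close> whose universe \<open>R\<close> is the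
  type \<open>'a\<close>. The symbol \<open><\<close> (constructor \<open>Less\<close>) is part of every language and is always interpreted
  by the order of \<open>'a\<close>; interpretations matter only on lists whose length is the arity.\<close>

record ('f, 'r, 'a) fo_structure =
  fun_arity :: "'f \<Rightarrow> nat"
  rel_arity :: "'r \<Rightarrow> nat"
  fun_interp :: "'f \<Rightarrow> 'a list \<Rightarrow> 'a"
  rel_interp :: "'r \<Rightarrow> 'a list \<Rightarrow> bool"

datatype 'f fo_term = Var nat | App 'f "'f fo_term list"

datatype ('f, 'r) fo_formula =
    Eq "'f fo_term" "'f fo_term"
  | Less "'f fo_term" "'f fo_term"
  | Rel 'r "'f fo_term list"
  | Neg "('f, 'r) fo_formula"
  | Conj "('f, 'r) fo_formula" "('f, 'r) fo_formula"
  | Ex nat "('f, 'r) fo_formula"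

primrec wf_term :: "('f, 'r, 'a) fo_structure \<Rightarrow> 'f fo_term \<Rightarrow> bool" where
  "wf_term M (Var i) \<longleftrightarrow> True"
| "wf_term M (App f ts) \<longleftrightarrow> length ts = fun_arity M f \<and> list_all (\<lambda>b. b) (map (wf_term M) ts)"

primrec wf_formula :: "('f, 'r, 'a) fo_structure \<Rightarrow> ('f, 'r) fo_formula \<Rightarrow> bool" where
  "wf_formula M (Eq s t) \<longleftrightarrow> wf_term M s \<and> wf_term M t"
| "wf_formula M (Less s t) \<longleftrightarrow> wf_term M s \<and> wf_term M t"
| "wf_formula M (Rel r ts) \<longleftrightarrow> length ts = rel_arity M r \<and> list_all (wf_term M) ts"
| "wf_formula M (Neg p) \<longleftrightarrow> wf_formula M p"
| "wf_formula M (Conj p q) \<longleftrightarrow> wf_formula M p \<and> wf_formula M q"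
| "wf_formula M (Ex i p) \<longleftrightarrow> wf_formula M p"

primrec val :: "('f, 'r, 'a) fo_structure \<Rightarrow> (nat \<Rightarrow> 'a) \<Rightarrow> 'f fo_term \<Rightarrow> 'a" where
  "val M e (Var i) = e i"
| "val M e (App f ts) = fun_interp M f (map (val M e) ts)"

primrec sat :: "('f, 'r, 'a::linorder) fo_structure \<Rightarrow> (nat \<Rightarrow> 'a) \<Rightarrow> ('f, 'r) fo_formula \<Rightarrow> bool" where
  "sat M e (Eq s t) \<longleftrightarrow> val M e s = val M e t"
| "sat M e (Less s t) \<longleftrightarrow> val M e s < val M e t"
| "sat M e (Rel r ts) \<longleftrightarrow> rel_interp M r (map (val M e) ts)"
| "sat M e (Neg p) \<longleftrightarrow> \<not> sat M e p"
| "sat M e (Conj p q) \<longleftrightarrow> sat M e p \<and> sat M e q"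
| "sat M e (Ex i p) \<longleftrightarrow> (\<exists>a. sat M (e(i := a)) p)"

text \<open>Definability with parameters: the variables \<open>0, \<dots>, n - 1\<close> range over \<open>R\<^sup>n\<close>, and all other free
  variables take the fixed parameter values \<open>b\<close>.\<close>

definition definable :: "('f, 'r, 'a::linorder) fo_structure \<Rightarrow> nat \<Rightarrow> (nat \<Rightarrow> 'a) set \<Rightarrow> bool" where
  "definable M n S \<longleftrightarrow>
     (\<exists>p b. wf_formula M p \<and> S = {x \<in> tuples n. sat M (cat n x b) p})"

definition definable_fun ::
    "('f, 'r, 'a::linorder) fo_structure \<Rightarrow> nat \<Rightarrow> (nat \<Rightarrow> 'a) set \<Rightarrow> ((nat \<Rightarrow> 'a) \<Rightarrow> 'a) \<Rightarrow> bool" where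
  "definable_fun M n C f \<longleftrightarrow> C \<subseteq> tuples n \<and> definable M (Suc n) {x(n := f x) | x. x \<in> C}"

text \<open>Here \<open>\<Phi> \<subseteq> R\<^sup>k\<^sup>+\<^sup>n\<close> and the members of the family are the fibres of \<open>\<Phi>\<close> over \<open>\<Omega> \<subseteq> R\<^sup>k\<close>.\<close>

definition definable_family ::
    "('f, 'r, 'a::linorder) fo_structure \<Rightarrow> nat \<Rightarrow> (nat \<Rightarrow> 'a) set set \<Rightarrow> bool" where
  "definable_family M n F \<longleftrightarrow>
     (\<exists>k \<Omega> \<Phi>. definable M k \<Omega> \<and> definable M (k + n) \<Phi> \<and>
        F = {{x \<in> tuples n. cat k u x \<in> \<Phi>} | u. u \<in> \<Omega>})"

definition point_or_open_interval :: "'a::linorder set \<Rightarrow> bool" where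
  "point_or_open_interval I \<longleftrightarrow>
     (\<exists>a. I = {a}) \<or> (\<exists>a b. I = {a<..<b}) \<or> (\<exists>a. I = {a<..}) \<or> (\<exists>b. I = {..<b}) \<or> I = UNIV"

definition ominimal :: "('f, 'r, 'a::unbounded_dense_linorder) fo_structure \<Rightarrow> bool" where
  "ominimal M \<longleftrightarrow>
     (\<forall>S. definable M 1 S \<longrightarrow>
        (\<exists>F. finite F \<and> (\<forall>I\<in>F. point_or_open_interval I) \<and> (\<lambda>x. x 0) ` S = \<Union>F))"

definition expands_ordered_field :: "('f, 'r, 'a::linordered_field) fo_structure \<Rightarrow> bool" where
  "expands_ordered_field M \<longleftrightarrow>
     (\<exists>p t. fun_arity M p = 2 \<and> (\<forall>x y. fun_interp M p [x, y] = x + y) \<and>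
            fun_arity M t = 2 \<and> (\<forall>x y. fun_interp M t [x, y] = x * y))"

definition ord_top :: "'a::linorder topology" where
  "ord_top = topology_generated_by (range lessThan \<union> range greaterThan)"

definition tuples_top :: "nat \<Rightarrow> (nat \<Rightarrow> 'a::linorder) topology" where
  "tuples_top n = product_topology (\<lambda>_. ord_top) {..<n}"

definition definable_cont ::
    "('f, 'r, 'a::linorder) fo_structure \<Rightarrow> nat \<Rightarrow> (nat \<Rightarrow> 'a) set \<Rightarrow> ((nat \<Rightarrow> 'a) \<Rightarrow> 'a) \<Rightarrow> bool" where
  "definable_cont M n C f \<longleftrightarrow>
     definable_fun M n C f \<and> continuous_map (subtopology (tuples_top n) C) ord_top f"

text \<open>\<open>cell M n d C\<close>: \<open>C \<subseteq> R\<^sup>n\<close> is an \<open>(i\<^sub>1, \<dots>, i\<^sub>n)\<close>-cell with \<open>i\<^sub>1 + \<dots> + i\<^sub>n = d\<close>. In a band,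
  \<open>lo = None\<close> stands for the lower bound \<open>-\<infinity>\<close> and \<open>hi = None\<close> for the upper bound \<open>+\<infinity>\<close>.\<close>

inductive cell ::
    "('f, 'r, 'a::unbounded_dense_linorder) fo_structure \<Rightarrow> nat \<Rightarrow> nat \<Rightarrow> (nat \<Rightarrow> 'a) set \<Rightarrow> bool"
  for M where
  point: "cell M 0 0 (tuples 0)"
| graph: "cell M n d C \<Longrightarrow> definable_cont M n C f \<Longrightarrow> cell M (Suc n) d {x(n := f x) | x. x \<in> C}"
| band: "cell M n d C \<Longrightarrow>
    (\<forall>f\<in>set_option lo. definable_cont M n C f) \<Longrightarrow>
    (\<forall>g\<in>set_option hi. definable_cont M n C g) \<Longrightarrow>
    (\<forall>f\<in>set_option lo. \<forall>g\<in>set_option hi. \<forall>x\<in>C. f x < g x) \<Longrightarrow>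
    cell M (Suc n) (Suc d)
      {x(n := t) | x t. x \<in> C \<and> (\<forall>f\<in>set_option lo. f x < t) \<and> (\<forall>g\<in>set_option hi. t < g x)}"

text \<open>The supremum is over a set of numbers bounded by \<open>n\<close>, so it is a maximum unless \<open>S\<close> is empty,
  in which case the dimension is \<open>-\<infinity>\<close>.\<close>

definition omin_dim ::
    "('f, 'r, 'a::unbounded_dense_linorder) fo_structure \<Rightarrow> nat \<Rightarrow> (nat \<Rightarrow> 'a) set \<Rightarrow> ereal" where
  "omin_dim M n S = Sup {ereal (real d) | d. \<exists>C. cell M n d C \<and> C \<subseteq> S}"

definition order_dense :: "'a::linorder set \<Rightarrow> bool" where
  "order_dense D \<longleftrightarrow> ord_top closure_of D = UNIV"

definition den_e :: "'a::linorder itself \<Rightarrow> 'a rel" where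
  "den_e _ = |SOME D::'a set. order_dense D \<and> (\<forall>E::'a set. order_dense E \<longrightarrow> |D| \<le>o |E| )|"

lemma topspace_ord_top [simp]: "topspace ord_top = (UNIV :: 'a::unbounded_dense_linorder set)"
  unfolding ord_top_def topology_generated_by_topspace using lt_ex by auto

lemma den_e_minimal:
  fixes E :: "'a::unbounded_dense_linorder set"
  shows "\<exists>D::'a set. order_dense D \<and> den_e TYPE('a) = |D|"
    and "order_dense E \<Longrightarrow> den_e TYPE('a) \<le>o |E|"
proof -
  have "order_dense (UNIV :: 'a set)"
    unfolding order_dense_def using closure_of_topspace[of "ord_top :: 'a topology"] by simp
  then have "\<exists>r \<in> card_of ` {D::'a set. order_dense D}.
      \<forall>r' \<in> card_of ` {D::'a set. order_dense D}. r \<le>o r'"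
    by (intro exists_minim_Card_order) (auto simp: card_of_Card_order)
  then have ex: "\<exists>D::'a set. order_dense D \<and> (\<forall>E::'a set. order_dense E \<longrightarrow> |D| \<le>o |E| )"
    by auto
  show "\<exists>D::'a set. order_dense D \<and> den_e TYPE('a) = |D|"
    unfolding den_e_def using someI_ex[OF ex] by blast
  show "den_e TYPE('a) \<le>o |E|" if "order_dense E"
    unfolding den_e_def using someI_ex[OF ex] that by blast
qed

text \<open>In \<open>definable_top_space M n T\<close> the underlying set \<open>X \<subseteq> R\<^sup>n\<close> of the space is \<open>topspace T\<close>.\<close>

definition definable_top_space ::
    "('f, 'r, 'a::linorder) fo_structure \<Rightarrow> nat \<Rightarrow> (nat \<Rightarrow> 'a) topology \<Rightarrow> bool" where
  "definable_top_space M n T \<longleftrightarrow> definable M n (topspace T) \<and>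
     (\<exists>B. definable_family M n B \<and> openin T = arbitrary union_of (\<lambda>S. S \<in> B))"

definition R_metric :: "'b set \<Rightarrow> ('b \<Rightarrow> 'b \<Rightarrow> 'a::linordered_field) \<Rightarrow> bool" where
  "R_metric X d \<longleftrightarrow>
     (\<forall>x\<in>X. \<forall>y\<in>X. 0 \<le> d x y \<and> (d x y = 0 \<longleftrightarrow> x = y) \<and> d x y = d y x) \<and>
     (\<forall>x\<in>X. \<forall>y\<in>X. \<forall>z\<in>X. d x z \<le> d x y + d y z)"

definition metric_generates :: "('b \<Rightarrow> 'b \<Rightarrow> 'a::linordered_field) \<Rightarrow> 'b topology \<Rightarrow> bool" where
  "metric_generates d T \<longleftrightarrow>
     openin T = arbitrary union_of
       (\<lambda>S. \<exists>x\<in>topspace T. \<exists>r>0. S = {y \<in> topspace T. d x y < r})"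

definition R_metrizable :: "(nat \<Rightarrow> 'a::linordered_field) topology \<Rightarrow> bool" where
  "R_metrizable T \<longleftrightarrow>
     (\<exists>d :: (nat \<Rightarrow> 'a) \<Rightarrow> (nat \<Rightarrow> 'a) \<Rightarrow> 'a. R_metric (topspace T) d \<and> metric_generates d T)"

definition definable_metric ::
    "('f, 'r, 'a::linordered_field) fo_structure \<Rightarrow> nat \<Rightarrow> (nat \<Rightarrow> 'a) set \<Rightarrow>
     ((nat \<Rightarrow> 'a) \<Rightarrow> (nat \<Rightarrow> 'a) \<Rightarrow> 'a) \<Rightarrow> bool" where
  "definable_metric M n X d \<longleftrightarrow> R_metric X d \<and>
     definable M (Suc (n + n)) {(cat n x y)(n + n := d x y) | x y. x \<in> X \<and> y \<in> X}"

definition definably_metrizable ::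
    "('f, 'r, 'a::linordered_field) fo_structure \<Rightarrow> nat \<Rightarrow> (nat \<Rightarrow> 'a) topology \<Rightarrow> bool" where
  "definably_metrizable M n T \<longleftrightarrow>
     (\<exists>d. definable_metric M n (topspace T) d \<and> metric_generates d T)"

end

theory Submission
  imports Defs
begin

text \<open>Let \<open>D\<close> be a dense subset of \<open>R\<close> with \<open>|D| < |R|\<close>. An infinite definable subset of \<open>R\<close>
  contains an interval, so it has more than \<open>|D|\<close> points; hence if \<open>|D|\<close> many sets cover it, one of
  them meets it infinitely often. This pigeonhole principle, and its analogue for definable covers of
  boxes in \<open>R\<^sup>2\<close>, replaces much of the usual theory of cell decomposition: it gives generic
  continuity and uniform finiteness, and it shows that a space of dimension at most one embeds
  definably, as a set, into a bounded subset of \<open>R\<close>.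

  There a point \<open>y\<close> is the limit of only finitely many one-sided germs \<open>x\<^sup>+, x\<^sup>-\<close>, and the germs
  converging to \<open>y\<close> form a neighbourhood base. As for the Sorgenfrey line, triangle inequality and
  pigeonhole principle show that for all but finitely many \<open>x\<close> either neither germ of \<open>x\<close> converges
  or both converge to \<open>x\<close>. So outside a finite set of vertices the space is made of Euclidean and
  discrete intervals, whose ends may be attached to vertices, and a definable metric can be written
  down.\<close>

section \<open>Definability\<close>

text \<open>The given metric is not assumed to be definable; only its topology has a definable
  basis. Hence o-minimality is never applied to a ball but to a definable set squeezed between two
  balls with the same centre, whereas cardinality arguments may speak of balls directly. Covers are
  indexed by finite lists over \<open>D\<close>: one list carries all constants of a local picture,
  such as two interval ends and a radius, and there are still at most |D| lists. If two points x <
  x' obey the same list, the same radius is available at both, and the triangle inequality can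
  compare the limits of their germs. Dimension enters only through the fact that a definable set
  without a definable finite-to-one map to R contains a two-dimensional cell. The embedding into R
  need not be continuous; it merely lays the points out on a line, so that neighbourhoods can be
  described by one-sided germs. The final metric is written in terms of Euclidean distances to the
  vertices. From the given metric it takes nothing but the information which germ converges to which
  point.\<close>

primrec rename_term :: "(nat \<Rightarrow> nat) \<Rightarrow> 'f fo_term \<Rightarrow> 'f fo_term" where
  "rename_term \<rho> (Var i) = Var (\<rho> i)"
| "rename_term \<rho> (App f ts) = App f (map (rename_term \<rho>) ts)"

text \<open>Bound variables are renamed too. An injective \<open>\<rho>\<close> cannot capture any
  of them, so every renaming applied to a formula below comes with a proof of injectivity.\<close>

primrec rename_formula :: "(nat \<Rightarrow> nat) \<Rightarrow> ('f, 'r) fo_formula \<Rightarrow> ('f, 'r) fo_formula" where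
  "rename_formula \<rho> (Eq s t) = Eq (rename_term \<rho> s) (rename_term \<rho> t)"
| "rename_formula \<rho> (Less s t) = Less (rename_term \<rho> s) (rename_term \<rho> t)"
| "rename_formula \<rho> (Rel r ts) = Rel r (map (rename_term \<rho>) ts)"
| "rename_formula \<rho> (Neg p) = Neg (rename_formula \<rho> p)"
| "rename_formula \<rho> (Conj p q) = Conj (rename_formula \<rho> p) (rename_formula \<rho> q)"
| "rename_formula \<rho> (Ex i p) = Ex (\<rho> i) (rename_formula \<rho> p)"

lemma wf_rename_term: "wf_term M (rename_term \<rho> t) \<longleftrightarrow> wf_term M t"
  by (induction t) (auto simp: list_all_iff)

lemma wf_rename_formula: "wf_formula M (rename_formula \<rho> p) \<longleftrightarrow> wf_formula M p"
  by (induction p) (auto simp: wf_rename_term list_all_iff)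

lemma val_rename_term: "val M e (rename_term \<rho> t) = val M (\<lambda>i. e (\<rho> i)) t"
proof (induction t)
  case (App f ts)
  then have "map (val M e \<circ> rename_term \<rho>) ts = map (val M (\<lambda>i. e (\<rho> i))) ts" by simp
  then show ?case by (simp only: val.simps rename_term.simps list.map_comp)
qed simp

lemma sat_rename_formula:
  assumes "inj \<rho>"
  shows "sat M e (rename_formula \<rho> p) \<longleftrightarrow> sat M (\<lambda>i. e (\<rho> i)) p"
proof (induction p arbitrary: e)
  case (Rel r ts)
  have "map (val M e \<circ> rename_term \<rho>) ts = map (val M (\<lambda>i. e (\<rho> i))) ts"
    by (simp add: val_rename_term)
  then show ?case by (simp only: sat.simps rename_formula.simps list.map_comp)
next
  case (Ex i p)
  have "(\<lambda>j. (e(\<rho> i := a)) (\<rho> j)) = (\<lambda>j. e (\<rho> j))(i := a)" for a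
    using assms by (auto simp: fun_eq_iff inj_eq)
  then show ?case by (simp only: sat.simps rename_formula.simps Ex)
qed (auto simp: val_rename_term)

text \<open>Environments are infinite sequences. A function h on \<open>tuples n\<close> is treated
  as a definable function by composing it with this map.\<close>

definition restr :: "nat \<Rightarrow> (nat \<Rightarrow> 'a) \<Rightarrow> nat \<Rightarrow> 'a" where
  "restr n e = (\<lambda>i. if i < n then e i else undefined)"

lemma tuples_iff: "x \<in> tuples n \<longleftrightarrow> (\<forall>i\<ge>n. x i = undefined)"
  by (auto simp: tuples_def PiE_iff extensional_def not_less)

lemma restr_in_tuples [simp]: "restr n e \<in> tuples n"
  by (simp add: tuples_iff restr_def)

lemma restr_id [simp]: "x \<in> tuples n \<Longrightarrow> restr n x = x"
  by (auto simp: tuples_iff restr_def not_less)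

lemma restr_apply [simp]: "i < n \<Longrightarrow> restr n e i = e i"
  by (simp add: restr_def)

section \<open>Closure properties of definable predicates and functions\<close>

locale fo_field =
  fixes M :: "('f, 'r, 'a::linordered_field) fo_structure"
  assumes field: "expands_ordered_field M"
begin

text \<open>Predicates on environments take the place of definable sets; a bound variable is pushed in
  front of the environment, in the manner of de Bruijn indices.\<close>

definition dpred :: "((nat \<Rightarrow> 'a) \<Rightarrow> bool) \<Rightarrow> bool" where
  "dpred P \<longleftrightarrow> (\<exists>N p b. wf_formula M p \<and> (\<forall>e. P e \<longleftrightarrow> sat M (cat N e b) p))"

text \<open>The value of the graph sits at variable 0 and pushes the arguments up by one, just as a
  quantifier does.\<close>

definition dfunc :: "((nat \<Rightarrow> 'a) \<Rightarrow> 'a) \<Rightarrow> bool" where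
  "dfunc t \<longleftrightarrow> dpred (\<lambda>e. e 0 = t (\<lambda>i. e (Suc i)))"

lemma dpredI: "wf_formula M p \<Longrightarrow> (\<And>e. P e \<longleftrightarrow> sat M (cat N e b) p) \<Longrightarrow> dpred P"
  unfolding dpred_def by blast

lemma dpred_rename:
  assumes "dpred P" "inj \<sigma>"
  shows "dpred (\<lambda>e. P (\<lambda>i. e (\<sigma> i)))"
proof -
  obtain N p b where p: "wf_formula M p" "\<And>e. P e \<longleftrightarrow> sat M (cat N e b) p"
    using assms(1) by (auto simp: dpred_def)
  obtain N' where N': "\<And>i. i < N \<Longrightarrow> \<sigma> i < N'"
  proof
    show "\<sigma> i < Suc (Max (\<sigma> ` {..<N}))" if "i < N" for i
      using that by (simp add: less_Suc_eq_le)
  qed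
  \<comment> \<open>Environment variables follow \<open>\<sigma>\<close>; the parameters, which
    start at N, are moved behind all of its values.\<close>
  define r where "r i = (if i < N then \<sigma> i else N' + (i - N))" for i
  have r: "inj r"
  proof (rule injI)
    fix i j assume "r i = r j"
    then show "i = j"
      using assms(2) N'[of i] N'[of j] by (cases "i < N"; cases "j < N") (auto simp: r_def inj_eq)
  qed
  show ?thesis
  proof (rule dpredI[of "rename_formula r p" _ N' b])
    show "P (\<lambda>i. e (\<sigma> i)) \<longleftrightarrow> sat M (cat N' e b) (rename_formula r p)" for e
    proof -
      have "cat N (\<lambda>i. e (\<sigma> i)) b = (\<lambda>i. (cat N' e b) (r i))"
        using N' by (auto simp: cat_def r_def fun_eq_iff)
      then show ?thesis by (simp add: sat_rename_formula[OF r] p)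
    qed
  qed (simp add: wf_rename_formula p)
qed

lemma dpred_not: "dpred P \<Longrightarrow> dpred (\<lambda>e. \<not> P e)"
  unfolding dpred_def
proof (elim exE conjE)
  fix N p b assume "wf_formula M p" "\<forall>e. P e \<longleftrightarrow> sat M (cat N e b) p"
  then show "\<exists>N p b. wf_formula M p \<and> (\<forall>e. (\<not> P e) \<longleftrightarrow> sat M (cat N e b) p)"
    by (intro exI[of _ N] exI[of _ "Neg p"] exI[of _ b]) simp
qed

lemma dpred_conj:
  assumes "dpred P" "dpred Q"
  shows "dpred (\<lambda>e. P e \<and> Q e)"
proof -
  obtain N p b where p: "wf_formula M p" "\<And>e. P e \<longleftrightarrow> sat M (cat N e b) p"
    using assms(1) by (auto simp: dpred_def)
  obtain N' q b' where q: "wf_formula M q" "\<And>e. Q e \<longleftrightarrow> sat M (cat N' e b') q"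
    using assms(2) by (auto simp: dpred_def)
  \<comment> \<open>Both parameter sequences are infinite, so they are interleaved: behind K, the
    even places hold b and the odd ones b'.\<close>
  define K where "K = N + N'"
  define r where "r i = (if i < N then i else K + 2 * (i - N))" for i
  define r' where "r' i = (if i < N' then i else K + Suc (2 * (i - N')))" for i
  define c where "c i = (if even i then b (i div 2) else b' (i div 2))" for i
  have r: "inj r" "inj r'"
    by (auto simp: inj_def r_def r'_def K_def split: if_splits)
  have "cat N e b = (\<lambda>i. (cat K e c) (r i))" "cat N' e b' = (\<lambda>i. (cat K e c) (r' i))" for e
    by (auto simp: cat_def r_def r'_def fun_eq_iff c_def K_def)
  then show ?thesis
    by (intro dpredI[of "Conj (rename_formula r p) (rename_formula r' q)" _ K c])
      (simp_all add: wf_rename_formula sat_rename_formula r p q)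
qed

lemma dpred_ex:
  assumes "dpred (\<lambda>e. P (e 0) (\<lambda>i. e (Suc i)))"
  shows "dpred (\<lambda>e. \<exists>x. P x e)"
proof -
  obtain N p b where p: "wf_formula M p"
    "\<And>e. P (e 0) (\<lambda>i. e (Suc i)) \<longleftrightarrow> sat M (cat N e b) p"
    using assms by (auto simp: dpred_def)
  \<comment> \<open>The quantified variable moves from 0 to N - 1, the first place after the
    remaining environment, so the parameters from N on stay where they are. The value
    \<open>c 0\<close> is shadowed by the quantifier. For N = 0 the predicate does not depend on the
    environment and no quantifier is used.\<close>
  define r where "r i = (if i = 0 \<and> N > 0 then N - 1 else if i < N then i - 1 else i)" for i
  define c where "c i = (if N = 0 then b i else if i = 0 then b 0 else b (i - 1))" for i
  have r: "inj r"
    by (auto simp: inj_def r_def split: if_splits)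
  have P: "P x e \<longleftrightarrow> sat M (cat N (case_nat x e) b) p" for x e
    using p(2)[of "case_nat x e"] by simp
  have "cat N (case_nat x e) b = (\<lambda>i. (((cat (N - 1) e c)(N - 1 := x))) (r i))" if "N > 0" for x e
  proof
    fix i
    consider "i = 0" | j where "i = Suc j" "i < N" | "N \<le> i" by (metis not_less not0_implies_Suc)
    then show "cat N (case_nat x e) b i = ((cat (N - 1) e c)(N - 1 := x)) (r i)"
      using that by cases (auto simp: cat_def r_def c_def)
  qed
  then have 1: ?thesis if "N > 0"
    using that by (intro dpredI[of "Ex (N - 1) (rename_formula r p)" _ "N - 1" c])
      (simp_all add: wf_rename_formula sat_rename_formula r p P)
  have "cat N e b = b" if "N = 0" for e using that by (auto simp: cat_def)
  then have 2: ?thesis if "N = 0"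
    using that p(1) P by (intro dpredI[of p _ N b]) auto
  show ?thesis using 1 2 by auto
qed

lemma dpred_iff_rewrite: "dpred P \<Longrightarrow> (\<And>e. P e \<longleftrightarrow> Q e) \<Longrightarrow> dpred Q"
  by (subgoal_tac "P = Q") auto

lemma dpred_disj:
  assumes "dpred P" "dpred Q" shows "dpred (\<lambda>e. P e \<or> Q e)"
  by (rule dpred_iff_rewrite[OF dpred_not[OF dpred_conj[OF dpred_not[OF assms(1)] dpred_not[OF assms(2)]]]]) simp

lemma dpred_imp:
  assumes "dpred P" "dpred Q" shows "dpred (\<lambda>e. P e \<longrightarrow> Q e)"
  by (rule dpred_iff_rewrite[OF dpred_not[OF dpred_conj[OF assms(1) dpred_not[OF assms(2)]]]]) simp

lemma dpred_all:
  assumes "dpred (\<lambda>e. P (e 0) (\<lambda>i. e (Suc i)))"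
  shows "dpred (\<lambda>e. \<forall>x. P x e)"
proof -
  have "dpred (\<lambda>e. \<exists>x. \<not> P x e)" by (rule dpred_ex) (rule dpred_not[OF assms])
  from dpred_not[OF this] show ?thesis by simp
qed

lemma dpred_const: "dpred (\<lambda>e. B)"
proof -
  have *: "dpred (\<lambda>e. e 0 = e 0)"
    by (rule dpredI[of "Eq (Var 0) (Var 0)" _ 1 undefined]) auto
  show ?thesis
    by (cases B) (use * dpred_not[OF *] in auto)
qed

lemma dpred_eq0: "dpred (\<lambda>e. e i = e j)"
  by (rule dpredI[of "Eq (Var i) (Var j)" _ "Suc (i + j)" undefined]) (auto simp: cat_def)

lemma dpred_less0: "dpred (\<lambda>e. e i < e j)"
  by (rule dpredI[of "Less (Var i) (Var j)" _ "Suc (i + j)" undefined]) (auto simp: cat_def)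

lemma dfunc_const: "dfunc (\<lambda>e. c)"
  unfolding dfunc_def
  by (rule dpredI[of "Eq (Var 0) (Var 1)" _ "Suc 0" "\<lambda>_. c"]) (auto simp: cat_def)

lemma dfunc_var: "dfunc (\<lambda>e. e k)"
  unfolding dfunc_def by (rule dpred_eq0)

lemma dfunc_add0: "dfunc (\<lambda>e. e 0 + e (Suc 0))" and dfunc_mult0: "dfunc (\<lambda>e. e 0 * e (Suc 0))"
proof -
  obtain p t where p: "fun_arity M p = 2" "\<And>x y. fun_interp M p [x, y] = x + y"
    and t: "fun_arity M t = 2" "\<And>x y. fun_interp M t [x, y] = x * y"
    using field by (auto simp: expands_ordered_field_def)
  show "dfunc (\<lambda>e. e 0 + e (Suc 0))" unfolding dfunc_def
    by (rule dpredI[of "Eq (Var 0) (App p [Var 1, Var 2])" _ 3 undefined]) (auto simp: cat_def p numeral_2_eq_2)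
  show "dfunc (\<lambda>e. e 0 * e (Suc 0))" unfolding dfunc_def
    by (rule dpredI[of "Eq (Var 0) (App t [Var 1, Var 2])" _ 3 undefined]) (auto simp: cat_def t numeral_2_eq_2)
qed

lemma dpred_ex_tuple:
  assumes "dpred (\<lambda>e. P (restr n e) (\<lambda>i. e (i + n)))"
  shows "dpred (\<lambda>e. \<exists>x\<in>tuples n. P x e)"
  using assms
proof (induction n arbitrary: P)
  case 0
  have "tuples 0 = {restr 0 e}" for e :: "nat \<Rightarrow> 'a" by (auto simp: tuples_iff restr_def)
  then show ?case using 0 by (simp add: restr_def)
next
  case (Suc n)
  have "dpred (\<lambda>e. \<exists>x\<in>tuples n. \<exists>t. P (x(n := t)) e)"
  proof (rule Suc.IH, rule dpred_ex)
    \<comment> \<open>Under the inner quantifier the last coordinate stands at 0 and the others at 1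
      to n; this rotation restores the order of an (n + 1)-tuple.\<close>
    define \<sigma> where "\<sigma> i = (if i = n then 0 else if i < n then Suc i else i)" for i
    have "inj \<sigma>" by (auto simp: inj_def \<sigma>_def split: if_splits)
    from dpred_rename[OF Suc.prems this]
    show "dpred (\<lambda>e. P ((restr n (\<lambda>i. e (Suc i)))(n := e 0)) (\<lambda>i. e (Suc (i + n))))"
    proof (rule dpred_iff_rewrite)
      fix e :: "nat \<Rightarrow> 'a"
      have "restr (Suc n) (\<lambda>i. e (\<sigma> i)) = (restr n (\<lambda>i. e (Suc i)))(n := e 0)"
        by (auto simp: restr_def \<sigma>_def fun_eq_iff)
      moreover have "(\<lambda>i. e (\<sigma> (i + Suc n))) = (\<lambda>i. e (Suc (i + n)))"
        by (auto simp: \<sigma>_def fun_eq_iff)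
      ultimately show "P (restr (Suc n) (\<lambda>i. e (\<sigma> i))) (\<lambda>i. e (\<sigma> (i + Suc n))) =
        P ((restr n (\<lambda>i. e (Suc i)))(n := e 0)) (\<lambda>i. e (Suc (i + n)))" by simp
    qed
  qed
  moreover have "(\<exists>x\<in>tuples n. \<exists>t. P (x(n := t)) e) \<longleftrightarrow> (\<exists>x\<in>tuples (Suc n). P x e)" for e
  proof
    assume "\<exists>x\<in>tuples (Suc n). P x e"
    then obtain x where x: "x \<in> tuples (Suc n)" "P x e" by blast
    have "(restr n x)(n := x n) = x" using x(1) by (auto simp: restr_def tuples_iff fun_eq_iff)
    then show "\<exists>x\<in>tuples n. \<exists>t. P (x(n := t)) e" using x(2)
      by (metis restr_in_tuples)
  qed (auto simp: tuples_iff intro!: bexI)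
  ultimately show ?case by simp
qed

lemma dpred_all_tuple:
  assumes "dpred (\<lambda>e. P (restr n e) (\<lambda>i. e (i + n)))"
  shows "dpred (\<lambda>e. \<forall>x\<in>tuples n. P x e)"
  using dpred_not[OF dpred_ex_tuple[of "\<lambda>x e. \<not> P x e", OF dpred_not[OF assms]]] by simp

lemma dpred_finite_all:
  assumes "\<And>i. i < (n::nat) \<Longrightarrow> dpred (P i)"
  shows "dpred (\<lambda>e. \<forall>i<n. P i e)"
  using assms
proof (induction n)
  case (Suc n)
  have "dpred (\<lambda>e. (\<forall>i<n. P i e) \<and> P n e)" using Suc by (intro dpred_conj) auto
  then show ?case by (rule dpred_iff_rewrite) (auto simp: less_Suc_eq)
qed (simp add: dpred_const)

text \<open>P sees only its first N variables. Substituting for them means quantifying over an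
  N-tuple whose entries equal the values of the first N functions, which is a finite
  conjunction.\<close>

lemma dpred_subst:
  assumes "dpred P" "\<And>i. dfunc (t i)"
  shows "dpred (\<lambda>e. P (\<lambda>i. t i e))"
proof -
  obtain N p b where p: "wf_formula M p" "\<And>e. P e \<longleftrightarrow> sat M (cat N e b) p"
    using assms(1) by (auto simp: dpred_def)
  have N: "P (restr N e) \<longleftrightarrow> P e" for e
  proof -
    have "cat N (restr N e) b = cat N e b" by (auto simp: cat_def fun_eq_iff)
    then show ?thesis by (simp add: p)
  qed
  have "dpred (\<lambda>e. \<exists>x\<in>tuples N. (\<forall>i<N. x i = t i e) \<and> P x)"
  proof (intro dpred_ex_tuple dpred_conj)
    have "dpred (\<lambda>e. \<forall>i<N. e i = t i (\<lambda>i. e (i + N)))"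
    proof (rule dpred_finite_all)
      fix i assume i: "i < N"
      define \<sigma> where "\<sigma> j = (if j = 0 then i else j - 1 + N)" for j
      have "inj \<sigma>" using i by (auto simp: inj_def \<sigma>_def split: if_splits)
      from dpred_rename[OF assms(2)[of i, unfolded dfunc_def] this]
      show "dpred (\<lambda>e. e i = t i (\<lambda>i. e (i + N)))" by (simp add: \<sigma>_def)
    qed
    then show "dpred (\<lambda>e. \<forall>i<N. restr N e i = t i (\<lambda>i. e (i + N)))"
      by (rule dpred_iff_rewrite) auto
    show "dpred (\<lambda>e. P (restr N e))" using assms(1) by (simp add: N)
  qed
  moreover have "(\<exists>x\<in>tuples N. (\<forall>i<N. x i = t i e) \<and> P x) \<longleftrightarrow> P (\<lambda>i. t i e)" for e
  proof
    assume "P (\<lambda>i. t i e)"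
    then show "\<exists>x\<in>tuples N. (\<forall>i<N. x i = t i e) \<and> P x"
      by (intro bexI[of _ "restr N (\<lambda>i. t i e)"]) (auto simp: N)
  next
    assume "\<exists>x\<in>tuples N. (\<forall>i<N. x i = t i e) \<and> P x"
    then obtain x where x: "x \<in> tuples N" "\<forall>i<N. x i = t i e" "P x" by blast
    have "restr N (\<lambda>i. t i e) = restr N x" using x by (auto simp: restr_def)
    then show "P (\<lambda>i. t i e)" by (metis N x(3))
  qed
  ultimately show ?thesis by simp
qed

lemma dfunc_graphI: "dpred (\<lambda>e. e 0 = t (\<lambda>i. e (Suc i))) \<Longrightarrow> dfunc t"
  by (simp add: dfunc_def)

lemma dfunc_shift: "dfunc t \<Longrightarrow> dfunc (\<lambda>e. t (\<lambda>i. e (i + k)))"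
  unfolding dfunc_def
  by (drule dpred_rename[where \<sigma> = "\<lambda>i. if i = 0 then 0 else i + k"]) (auto simp: inj_def)

lemma dfunc_subst:
  assumes "dfunc f" "\<And>i. dfunc (t i)"
  shows "dfunc (\<lambda>e. f (\<lambda>i. t i e))"
proof -
  define u where "u i = (case i of 0 \<Rightarrow> (\<lambda>e. e 0) | Suc j \<Rightarrow> (\<lambda>e. t j (\<lambda>i. e (Suc i))))" for i
  have "dfunc (u i)" for i
    using dfunc_shift[OF assms(2), of _ 1] by (cases i) (auto simp: dfunc_var u_def)
  from dpred_subst[OF assms(1)[unfolded dfunc_def], of u, OF this]
  show ?thesis unfolding dfunc_def by (simp add: u_def)
qed

text \<open>Relations are shown definable once, in the variables \<open>e 0\<close>,
  \<open>e (Suc 0)\<close> and so on; these rules then insert arbitrary definable terms.\<close>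

lemma dpred1: "dpred (\<lambda>e. R (e 0)) \<Longrightarrow> dfunc s \<Longrightarrow> dpred (\<lambda>e. R (s e))"
  by (rule dpred_subst[of _ "\<lambda>i. s"])

lemma dpred2:
  assumes "dpred (\<lambda>e. R (e 0) (e (Suc 0)))" "dfunc s" "dfunc t"
  shows "dpred (\<lambda>e. R (s e) (t e))"
  using dpred_subst[OF assms(1), of "\<lambda>i. if i = 0 then s else t"] assms by simp

lemma dpred3:
  assumes "dpred (\<lambda>e. R (e 0) (e (Suc 0)) (e (Suc (Suc 0))))" "dfunc s" "dfunc t" "dfunc u"
  shows "dpred (\<lambda>e. R (s e) (t e) (u e))"
  using dpred_subst[OF assms(1), of "\<lambda>i. if i = 0 then s else if i = 1 then t else u"] assms by simp

lemma dfunc1: "dfunc (\<lambda>e. f (e 0)) \<Longrightarrow> dfunc s \<Longrightarrow> dfunc (\<lambda>e. f (s e))"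
  by (rule dfunc_subst[of _ "\<lambda>i. s"])

lemma dfunc2:
  assumes "dfunc (\<lambda>e. f (e 0) (e (Suc 0)))" "dfunc s" "dfunc t"
  shows "dfunc (\<lambda>e. f (s e) (t e))"
  using dfunc_subst[OF assms(1), of "\<lambda>i. if i = 0 then s else t"] assms by simp

section \<open>Order and field operations\<close>

lemma dpred_eq: "dfunc s \<Longrightarrow> dfunc t \<Longrightarrow> dpred (\<lambda>e. s e = t e)"
  by (rule dpred2[where R = "(=)", OF dpred_eq0])

lemma dpred_less: "dfunc s \<Longrightarrow> dfunc t \<Longrightarrow> dpred (\<lambda>e. s e < t e)"
  by (rule dpred2[where R = "(<)", OF dpred_less0])

lemma dpred_le: "dfunc s \<Longrightarrow> dfunc t \<Longrightarrow> dpred (\<lambda>e. s e \<le> t e)"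
  using dpred_not[OF dpred_less, of t s] by (simp add: not_less)

lemma dfunc_add: "dfunc s \<Longrightarrow> dfunc t \<Longrightarrow> dfunc (\<lambda>e. s e + t e)"
  by (rule dfunc2[OF dfunc_add0])

lemma dfunc_mult: "dfunc s \<Longrightarrow> dfunc t \<Longrightarrow> dfunc (\<lambda>e. s e * t e)"
  by (rule dfunc2[OF dfunc_mult0])

lemma dfunc_shift1: "dfunc t \<Longrightarrow> dfunc (\<lambda>e. t (\<lambda>i. e (Suc i)))"
  using dfunc_shift[of t 1] by simp

lemma dpred_shift1: "dpred P \<Longrightarrow> dpred (\<lambda>e. P (\<lambda>i. e (Suc i)))"
  by (rule dpred_rename) simp_all

lemma dfunc_diff:
  assumes "dfunc s" "dfunc t" shows "dfunc (\<lambda>e. s e - t e)"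
proof (rule dfunc_graphI)
  have "dpred (\<lambda>e. e 0 + t (\<lambda>i. e (Suc i)) = s (\<lambda>i. e (Suc i)))"
    by (intro dpred_eq dfunc_add dfunc_var dfunc_shift1 assms)
  then show "dpred (\<lambda>e. e 0 = s (\<lambda>i. e (Suc i)) - t (\<lambda>i. e (Suc i)))"
    by (rule dpred_iff_rewrite) (auto simp: algebra_simps)
qed

lemma dfunc_if:
  assumes "dpred P" "dfunc s" "dfunc t" shows "dfunc (\<lambda>e. if P e then s e else t e)"
proof (rule dfunc_graphI)
  have "dpred (\<lambda>e. (P (\<lambda>i. e (Suc i)) \<and> e 0 = s (\<lambda>i. e (Suc i))) \<or>
      (\<not> P (\<lambda>i. e (Suc i)) \<and> e 0 = t (\<lambda>i. e (Suc i))))"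
    by (intro dpred_disj dpred_conj dpred_not dpred_eq dfunc_var dfunc_shift1 dpred_shift1 assms)
  then show "dpred (\<lambda>e. e 0 = (if P (\<lambda>i. e (Suc i)) then s (\<lambda>i. e (Suc i)) else t (\<lambda>i. e (Suc i))))"
    by (rule dpred_iff_rewrite) auto
qed

lemma dfunc_abs:
  assumes "dfunc s" shows "dfunc (\<lambda>e. \<bar>s e\<bar>)"
proof -
  have "dfunc (\<lambda>e. if s e < 0 then 0 - s e else s e)"
    by (intro dfunc_if dpred_less dfunc_diff dfunc_const assms)
  then show ?thesis by (simp add: abs_if cong: if_cong)
qed

lemma dfunc_divide:
  assumes "dfunc s" "dfunc t" shows "dfunc (\<lambda>e. s e / t e)"
proof (rule dfunc_graphI)
  \<comment> \<open>The first disjunct is the convention that division by 0 gives 0.\<close>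
  have "dpred (\<lambda>e. (t (\<lambda>i. e (Suc i)) = 0 \<and> e 0 = 0) \<or>
      (\<not> t (\<lambda>i. e (Suc i)) = 0 \<and> e 0 * t (\<lambda>i. e (Suc i)) = s (\<lambda>i. e (Suc i))))"
    by (intro dpred_disj dpred_conj dpred_not dpred_eq dfunc_mult dfunc_const dfunc_var dfunc_shift1 assms)
  then show "dpred (\<lambda>e. e 0 = s (\<lambda>i. e (Suc i)) / t (\<lambda>i. e (Suc i)))"
    by (rule dpred_iff_rewrite) (auto simp: eq_divide_eq)
qed

lemma dfunc_sum:
  assumes "\<And>i. i \<in> I \<Longrightarrow> dfunc (f i)" shows "dfunc (\<lambda>e. \<Sum>i\<in>I. f i e)"
  using assms by (induction I rule: infinite_finite_induct) (auto intro: dfunc_const dfunc_add)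

lemma dpred_finite_Bex:
  assumes "finite I" "\<And>i. i \<in> I \<Longrightarrow> dpred (P i)" shows "dpred (\<lambda>e. \<exists>i\<in>I. P i e)"
  using assms by (induction I) (auto intro: dpred_const dpred_disj)

lemma dpred_finite_Ball:
  assumes "finite I" "\<And>i. i \<in> I \<Longrightarrow> dpred (P i)" shows "dpred (\<lambda>e. \<forall>i\<in>I. P i e)"
  using assms by (induction I) (auto intro: dpred_const dpred_conj)

lemmas dpred_intros = dpred_not dpred_conj dpred_disj dpred_imp dpred_ex dpred_all
  dpred_eq dpred_less dpred_le dpred_const
  dfunc_const dfunc_var dfunc_add dfunc_mult dfunc_diff dfunc_abs dfunc_divide dfunc_if

section \<open>Passage between definable sets of tuples and predicates on environments\<close>

lemma dpred_restr_mem: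
  assumes "definable M n S" shows "dpred (\<lambda>e. restr n e \<in> S)"
proof -
  obtain p b where p: "wf_formula M p" "S = {x \<in> tuples n. sat M (cat n x b) p}"
    using assms by (auto simp: definable_def)
  have "cat n (restr n e) b = cat n e b" for e by (auto simp: cat_def fun_eq_iff)
  then show ?thesis by (intro dpredI[of p _ n b]) (auto simp: p)
qed

lemma dpred_mem:
  assumes "definable M n S" "\<And>i. i < n \<Longrightarrow> dfunc (\<lambda>e. x e i)" "\<And>e. x e \<in> tuples n"
  shows "dpred (\<lambda>e. x e \<in> S)"
proof -
  have "dpred (\<lambda>e. restr n (\<lambda>i. if i < n then x e i else 0) \<in> S)"
    by (rule dpred_subst[OF dpred_restr_mem[OF assms(1)]])
      (use assms(2) dfunc_const in \<open>case_tac "i < n"; simp\<close>)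
  moreover have "restr n (\<lambda>i. if i < n then x e i else 0) = x e" for e
    using assms(3)[of e] by (auto simp: restr_def tuples_iff fun_eq_iff)
  ultimately show ?thesis by simp
qed

lemma definableI:
  assumes "dpred P" shows "definable M n {x \<in> tuples n. P x}"
proof -
  obtain N p b where p: "wf_formula M p" "\<And>e. P e \<longleftrightarrow> sat M (cat N e b) p"
    using assms(1) by (auto simp: dpred_def)
  show ?thesis
  proof (cases "N \<le> n")
    case True
    define r where "r i = (if i < N then i else i - N + n)" for i
    have r: "inj r" using True by (auto simp: inj_def r_def split: if_splits)
    have "cat N x b = (\<lambda>i. (cat n x b) (r i))" for x
      using True by (auto simp: cat_def r_def fun_eq_iff)
    then show ?thesis unfolding definable_def
      by (intro exI[of _ "rename_formula r p"] exI[of _ b])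
        (auto simp: wf_rename_formula sat_rename_formula[OF r] p)
  next
    case False
    \<comment> \<open>On an n-tuple the variables n to N - 1 evaluate to \<open>undefined\<close>;
      they are turned into parameters with that value.\<close>
    define c where "c i = (if i + n < N then undefined else b (i + n - N))" for i
    have "cat N x b = cat n x c" if "x \<in> tuples n" for x
      using False that by (auto simp: cat_def fun_eq_iff c_def tuples_iff intro!: arg_cong[of _ _ b])
    then show ?thesis unfolding definable_def
      by (intro exI[of _ p] exI[of _ c]) (auto simp: p)
  qed
qed

lemma definable_eqI:
  "dpred P \<Longrightarrow> S \<subseteq> tuples n \<Longrightarrow> (\<And>x. x \<in> tuples n \<Longrightarrow> x \<in> S \<longleftrightarrow> P x) \<Longrightarrow> definable M n S"
  using definableI[of P n] by (auto intro: back_subst[of "definable M n"])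

end

section \<open>O-minimality with a small dense set\<close>

definition oint :: "'a::linorder set \<Rightarrow> bool" where
  "oint I \<longleftrightarrow> (\<exists>a b. a < b \<and> I = {a<..<b})"

lemma ointI: "a < b \<Longrightarrow> oint {a<..<b}"
  by (auto simp: oint_def)

lemma oint_infinite: "oint (I :: 'a::unbounded_dense_linorder set) \<Longrightarrow> infinite I"
  by (auto simp: oint_def infinite_Ioo)

lemma oint_nonempty: "oint (I :: 'a::unbounded_dense_linorder set) \<Longrightarrow> \<exists>x. x \<in> I"
  using oint_infinite[of I] infinite_imp_nonempty by auto

lemma infinite_two: "infinite A \<Longrightarrow> \<exists>x\<in>A. \<exists>y\<in>A. x < (y::'a::linorder)"
  by (metis finite.emptyI finite.insertI finite_subset insertCI linorder_neqE subsetI)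

text \<open>A definable injection of R into (-1, 1). It shows that intervals are as large as R, and
  it frees the even integers for encoding a second value.\<close>

definition squash :: "'a::linordered_field \<Rightarrow> 'a" where
  "squash x = x / (1 + \<bar>x\<bar>)"

lemma abs_squash_less: "\<bar>squash x\<bar> < 1"
proof -
  have "0 < 1 + \<bar>x\<bar>" by (simp add: add_pos_nonneg)
  then show ?thesis by (simp add: squash_def abs_divide)
qed

lemma squash_inj: "squash x = squash y \<longleftrightarrow> x = y"
proof
  have pos: "0 < 1 + \<bar>x\<bar>" "0 < 1 + \<bar>y\<bar>" by (simp_all add: add_pos_nonneg)
  assume "squash x = squash y"
  then have *: "x * (1 + \<bar>y\<bar>) = y * (1 + \<bar>x\<bar>)"
    using pos by (simp add: squash_def frac_eq_eq)
  have "x < 0 \<longleftrightarrow> x * (1 + \<bar>y\<bar>) < 0" "y < 0 \<longleftrightarrow> y * (1 + \<bar>x\<bar>) < 0"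
    using pos by (auto simp: mult_less_0_iff)
  then have "x < 0 \<longleftrightarrow> y < 0" using * by simp
  then show "x = y" using * by (auto simp: algebra_simps abs_if split: if_splits)
qed simp

lemma finite_ordLeq_infinite: "finite A \<Longrightarrow> infinite B \<Longrightarrow> |A| \<le>o |B|"
  using ordLeq_total[OF card_of_Well_order card_of_Well_order, of A B] card_of_ordLeq_infinite by blast

text \<open>Allows a cover to be indexed by several elements of \<open>D\<close> at once, or by a
  natural number, without exceeding |D| sets.\<close>

lemma card_of_lists_le:
  assumes "infinite D" shows "|lists D| \<le>o |D|"
proof -
  have L: "|{l. set l \<subseteq> D \<and> length l = n}| \<le>o |D|" for n
  proof (induction n)
    case 0
    have "finite {l. set l \<subseteq> D \<and> length l = 0}" by (simp add: conj_commute)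
    then show ?case using assms finite_ordLeq_infinite by blast
  next
    case (Suc n)
    have "{l. set l \<subseteq> D \<and> length l = Suc n} =
        (\<lambda>(x, l). x # l) ` (D \<times> {l. set l \<subseteq> D \<and> length l = n})"
      by (auto simp: length_Suc_conv image_iff)
    moreover have "|D \<times> {l. set l \<subseteq> D \<and> length l = n}| \<le>o |D|"
      using Suc by (intro card_of_Sigma_ordLeq_infinite assms) (auto intro: card_of_mono1)
    ultimately show ?case by (simp only: ordLeq_transitive[OF card_of_image])
  qed
  have "lists D = (\<Union>n. {l. set l \<subseteq> D \<and> length l = n})" by (auto simp: lists_eq_set)
  moreover have "|UNIV :: nat set| \<le>o |D|" using assms infinite_iff_card_of_nat by blast
  ultimately show ?thesis
    using card_of_UNION_ordLeq_infinite[OF assms, of UNIV "\<lambda>n. {l. set l \<subseteq> D \<and> length l = n}"] L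
    by (simp only: ball_simps HOL.simp_thms)
qed

locale omin_field = fo_field M for M :: "('f, 'r, 'a::linordered_field) fo_structure" +
  fixes D :: "'a set"
  assumes omin: "ominimal M"
    and dense: "a < b \<Longrightarrow> \<exists>q\<in>D. a < q \<and> q < b"
    and small: "|D| <o |UNIV :: 'a set|"
begin

lemma dpred_oint: "oint I \<Longrightarrow> dfunc t \<Longrightarrow> dpred (\<lambda>e. t e \<in> I)"
  by (auto simp: oint_def intro!: dpred_intros)

section \<open>Intervals, germs and infima from o-minimality\<close>

lemma finite_union_intervals:
  assumes "dpred (\<lambda>e. P (e 0))"
  obtains F where "finite F" "\<And>I. I \<in> F \<Longrightarrow> point_or_open_interval I" "Collect P = \<Union>F"
proof -
  have d: "definable M 1 {x \<in> tuples 1. P (x 0)}" by (rule definableI[OF assms])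
  obtain F where F: "finite F \<and> (\<forall>I\<in>F. point_or_open_interval I) \<and>
      (\<lambda>x. x 0) ` {x \<in> tuples 1. P (x 0)} = \<Union>F"
    using omin[unfolded ominimal_def, rule_format, OF d] by (rule exE)
  have "x \<in> (\<lambda>x. x 0) ` {x \<in> tuples 1. P (x 0)}" if "P x" for x
    using that by (intro image_eqI[of _ _ "\<lambda>i. if i = 0 then x else undefined"]) (auto simp: tuples_iff)
  then have "(\<lambda>x. x 0) ` {x \<in> tuples 1. P (x 0)} = Collect P" by auto
  with F show ?thesis by (intro that) auto
qed

text \<open>A finite union of points and intervals that is infinite must have an infinite member.
  Together with the one-sided germs and the infima below, this is the form in which o-minimality is
  used from here on.\<close>

lemma infinite_oint:
  assumes "dpred (\<lambda>e. P (e 0))" "infinite {x. P x}"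
  obtains I where "oint I" "\<And>x. x \<in> I \<Longrightarrow> P x"
proof -
  obtain F where F: "finite F" "\<And>I. I \<in> F \<Longrightarrow> point_or_open_interval I" "Collect P = \<Union>F"
    using finite_union_intervals[OF assms(1)] by blast
  have "\<exists>A\<in>F. infinite A"
  proof (rule ccontr)
    assume "\<not> (\<exists>A\<in>F. infinite A)"
    then have "finite (\<Union>F)" using F(1) by blast
    then show False using assms(2) F(3) by simp
  qed
  then obtain A where A: "A \<in> F" "infinite A" by blast
  have "\<exists>a b. a < b \<and> {a<..<b} \<subseteq> A"
    using F(2)[OF A(1)] unfolding point_or_open_interval_def
  proof (elim disjE exE)
    fix a b assume "A = {a<..<b}" then show ?thesis using A(2) by (cases "a < b") auto
  next
    fix a assume "A = {a<..}" then show ?thesis by (intro exI[of _ a] exI[of _ "a + 1"]) auto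
  next
    fix a assume "A = {..<a}" then show ?thesis by (intro exI[of _ "a - 1"] exI[of _ a]) auto
  next
    assume "A = UNIV" then show ?thesis by (intro exI[of _ 0] exI[of _ 1]) auto
  qed (use A in auto)
  then obtain a b where "a < b" "{a<..<b} \<subseteq> A" by blast
  moreover have "P x" if "x \<in> A" for x using F(3) A(1) that by (metis UnionI mem_Collect_eq)
  ultimately show ?thesis using ointI that[of "{a<..<b}"] by blast
qed

lemma oint_infinite_sub:
  assumes "dpred (\<lambda>e. P (e 0))" "oint I" "infinite {x\<in>I. P x}"
  obtains I' where "oint I'" "I' \<subseteq> I" "\<And>x. x \<in> I' \<Longrightarrow> P x"
proof -
  have "dpred (\<lambda>e. e 0 \<in> I \<and> P (e 0))"
    by (intro dpred_conj dpred_oint assms dfunc_var)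
  from infinite_oint[OF this assms(3)] obtain I' where "oint I'" "\<And>x. x \<in> I' \<Longrightarrow> x \<in> I \<and> P x"
    by blast
  then show ?thesis by (intro that[of I']) auto
qed

lemma right_germ:
  assumes "dpred (\<lambda>e. P (e 0))"
  shows "\<exists>b>x. (\<forall>z. x < z \<and> z < b \<longrightarrow> P z) \<or> (\<forall>z. x < z \<and> z < b \<longrightarrow> \<not> P z)"
proof -
  obtain F where F: "finite F" "\<And>I. I \<in> F \<Longrightarrow> point_or_open_interval I" "Collect P = \<Union>F"
    using finite_union_intervals[OF assms(1)] by blast
  have 1: "\<exists>b>x. {x<..<b} \<subseteq> I \<or> {x<..<b} \<inter> I = {}" if "point_or_open_interval I" for I
    using that unfolding point_or_open_interval_def
  proof (elim disjE exE)
    fix a assume "I = {a}"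
    \<comment> \<open>In every case the witness is the next end of I to the right of x, or
      \<open>x + 1\<close> if there is none.\<close>
    then show ?thesis by (intro exI[of _ "if a \<le> x then x + 1 else a"]) auto
  next
    fix a b assume "I = {a<..<b}"
    then show ?thesis by (intro exI[of _ "if b \<le> x then x + 1 else if a \<le> x then b else a"]) auto
  next
    fix a assume "I = {a<..}"
    then show ?thesis by (intro exI[of _ "if a \<le> x then x + 1 else a"]) auto
  next
    fix b assume "I = {..<b}"
    then show ?thesis by (intro exI[of _ "if b \<le> x then x + 1 else b"]) auto
  next
    assume "I = UNIV"
    then show ?thesis by (intro exI[of _ "x + 1"]) simp
  qed
  have "\<exists>b>x. {x<..<b} \<subseteq> \<Union>F \<or> {x<..<b} \<inter> \<Union>F = {}" using F(1,2)
  proof (induction F)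
    case empty
    show ?case by (intro exI[of _ "x + 1"]) simp
  next
    case (insert I F)
    obtain b where b: "b > x" "{x<..<b} \<subseteq> I \<or> {x<..<b} \<inter> I = {}" using 1 insert.prems by blast
    obtain c where c: "c > x" "{x<..<c} \<subseteq> \<Union>F \<or> {x<..<c} \<inter> \<Union>F = {}"
      using insert.IH insert.prems by blast
    have "{x<..<min b c} \<subseteq> {x<..<b}" "{x<..<min b c} \<subseteq> {x<..<c}" by auto
    then show ?case using b c by (intro exI[of _ "min b c"]) (simp, blast)
  qed
  then show ?thesis unfolding F(3)[symmetric] by (auto simp: subset_iff disjoint_iff)
qed

text \<open>The reflection \<open>0 - z\<close> is definable and exchanges right and left
  germs.\<close>

lemma left_germ:
  assumes "dpred (\<lambda>e. P (e 0))"
  shows "\<exists>b<x. (\<forall>z. b < z \<and> z < x \<longrightarrow> P z) \<or> (\<forall>z. b < z \<and> z < x \<longrightarrow> \<not> P z)"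
proof -
  have "dpred (\<lambda>e. P (0 - e 0))" by (rule dpred1[OF assms]) (intro dpred_intros)
  from right_germ[OF this, of "- x"] obtain b where b: "b > - x"
    "(\<forall>z. - x < z \<and> z < b \<longrightarrow> P (- z)) \<or> (\<forall>z. - x < z \<and> z < b \<longrightarrow> \<not> P (- z))" by auto
  have "(\<forall>z. - b < z \<and> z < x \<longrightarrow> P z) \<or> (\<forall>z. - b < z \<and> z < x \<longrightarrow> \<not> P z)"
    using b(2) by (metis add.inverse_inverse neg_less_iff_less)
  then show ?thesis using b(1) by (intro exI[of _ "- b"]) (simp add: minus_less_iff)
qed

lemma inf_exists:
  assumes "dpred (\<lambda>e. P (e 0))" "P x0" "\<And>x. P x \<Longrightarrow> c \<le> x"
  obtains m where "\<And>x. P x \<Longrightarrow> m \<le> x" "\<And>y. m < y \<Longrightarrow> \<exists>x. P x \<and> x < y"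
proof -
  obtain F where F: "finite F" "\<And>I. I \<in> F \<Longrightarrow> point_or_open_interval I" "Collect P = \<Union>F"
    using finite_union_intervals[OF assms(1)] by blast
  have 1: "\<exists>m. (\<forall>x\<in>I. m \<le> x) \<and> (\<forall>y>m. \<exists>x\<in>I. x < y)"
    if I: "point_or_open_interval I" "\<forall>x\<in>I. c \<le> x" "I \<noteq> {}" for I
  proof -
    \<comment> \<open>\<open>min b c - 1\<close> lies below both b and the lower bound c, which
      excludes members of the union that are unbounded below.\<close>
    have low: "min b c - 1 < c" "min b c - 1 < b" for b by (simp_all add: min_def)
    show ?thesis using I(1) unfolding point_or_open_interval_def
    proof (elim disjE exE)
      fix a assume "I = {a}" then show ?thesis by auto
    next
      fix a b assume I': "I = {a<..<b}"
      then have "a < b" using I(3) by auto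
      then have "\<exists>x. a < x \<and> x < b \<and> x < y" if "a < y" for y
        using that dense_order_class.dense[of a "min b y"] by auto
      then show ?thesis using I' by (intro exI[of _ a]) (auto simp: Bex_def)
    next
      fix a assume "I = {a<..}"
      then show ?thesis by (intro exI[of _ a]) (auto simp: Bex_def intro!: dense_order_class.dense)
    next
      fix b assume "I = {..<b}"
      then have "c \<le> min b c - 1" using I(2) low(2) by blast
      then show ?thesis using low(1)[of b] by simp
    next
      assume "I = UNIV"
      then have "c \<le> min c c - 1" using I(2) by blast
      then show ?thesis by simp
    qed
  qed
  have "\<exists>m. (\<forall>x\<in>\<Union>F. m \<le> x) \<and> (\<forall>y>m. \<exists>x\<in>\<Union>F. x < y)" if "\<forall>x\<in>\<Union>F. c \<le> x" "\<Union>F \<noteq> {}"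
    using F(1,2) that
  proof (induction F)
    case (insert I F)
    consider "I = {}" | "\<Union>F = {}" | "I \<noteq> {}" "\<Union>F \<noteq> {}" by blast
    then show ?case
    proof cases
      case 3
      obtain m where m: "\<forall>x\<in>I. m \<le> x" "\<forall>y>m. \<exists>x\<in>I. x < y"
        using 1[of I] 3 insert.prems by auto
      obtain m' where m': "\<forall>x\<in>\<Union>F. m' \<le> x" "\<forall>y>m'. \<exists>x\<in>\<Union>F. x < y"
        using insert.IH 3 insert.prems by auto
      have "\<exists>x\<in>\<Union>(insert I F). x < y" if y: "min m m' < y" for y
      proof -
        have "m < y \<or> m' < y" using y by (auto simp: min_less_iff_disj)
        then have "(\<exists>x\<in>I. x < y) \<or> (\<exists>x\<in>\<Union>F. x < y)" using m(2) m'(2) by metis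
        then show ?thesis by auto
      qed
      moreover have "\<forall>x\<in>\<Union>(insert I F). min m m' \<le> x" using m(1) m'(1) by (auto simp: min_le_iff_disj)
      ultimately show ?thesis by blast
    next
      case 1
      then show ?thesis using insert by auto
    next
      case 2
      then have "\<Union>(insert I F) = I" by auto
      then show ?thesis using 1[of I] insert.prems by (metis insertI1)
    qed
  qed simp
  moreover have "\<forall>x\<in>\<Union>F. c \<le> x" "\<Union>F \<noteq> {}" using assms(2,3) F(3) by blast+
  ultimately show ?thesis using that unfolding F(3)[symmetric] by auto
qed

section \<open>Pigeonhole principles for intervals and boxes\<close>

lemma infinite_D: "infinite D"
proof
  assume fin: "finite D"
  obtain q where "q \<in> D" "Max D < q" using dense[of "Max D" "Max D + 1"] by auto
  then show False using Max_ge[OF fin, of q] by simp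
qed

text \<open>A rescaled \<open>squash\<close> injects R into the interval. This is where the strict
  inequality between |D| and |R| is used.\<close>

lemma oint_not_small:
  fixes I :: "'a set"
  assumes "oint I" shows "\<not> |I| \<le>o |D|"
proof -
  obtain a b where ab: "a < b" "I = {a<..<b}" using assms by (auto simp: oint_def)
  define f where "f x = (a + b) / 2 + (b - a) / 2 * squash x" for x
  have "inj f" using ab by (auto simp: f_def inj_def squash_inj)
  moreover have "f x \<in> I" for x
  proof -
    have "\<bar>(b - a) / 2 * squash x\<bar> < (b - a) / 2"
      using ab(1) mult_strict_left_mono[OF abs_squash_less[of x], of "(b - a) / 2"]
      by (simp add: abs_mult)
    then have "- ((b - a) / 2) < (b - a) / 2 * squash x" "(b - a) / 2 * squash x < (b - a) / 2"
      by linarith+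
    then show ?thesis using ab(2) by (auto simp: f_def field_simps)
  qed
  ultimately have "|UNIV :: 'a set| \<le>o |I|" by (meson card_of_ordLeqI injD UNIV_I)
  then show ?thesis using small by (meson not_ordLess_ordLeq ordLeq_transitive)
qed

text \<open>Otherwise the interval would be a union of at most |D| finite sets. \<open>W l\<close>
  may be any predicate, in particular one that mentions balls of an undefinable metric.\<close>

lemma pigeonhole_infinite:
  fixes I :: "'a set"
  assumes "oint I" "\<And>x. x \<in> I \<Longrightarrow> \<exists>l\<in>lists D. W l x"
  shows "\<exists>l\<in>lists D. infinite {x\<in>I. W l x}"
proof (rule ccontr)
  assume neg: "\<not> ?thesis"
  have "finite {x\<in>I. W l x}" if "l \<in> lists D" for l
    using neg that by blast
  then have "\<forall>l\<in>lists D. |{x\<in>I. W l x}| \<le>o |D|"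
    using infinite_D finite_ordLeq_infinite by blast
  then have "|\<Union>l\<in>lists D. {x\<in>I. W l x}| \<le>o |D|"
    by (rule card_of_UNION_ordLeq_infinite[OF infinite_D card_of_lists_le[OF infinite_D]])
  moreover have "I \<subseteq> (\<Union>l\<in>lists D. {x\<in>I. W l x})" using assms(2) by blast
  ultimately show False using oint_not_small[OF assms(1)] card_of_mono1 ordLeq_transitive by blast
qed

lemma pigeonhole:
  assumes "oint I" "\<And>x. x \<in> I \<Longrightarrow> \<exists>l\<in>lists D. W l x"
    and "\<And>l. l \<in> lists D \<Longrightarrow> dpred (\<lambda>e. W l (e 0))"
  shows "\<exists>l\<in>lists D. \<exists>I'. oint I' \<and> I' \<subseteq> I \<and> (\<forall>x\<in>I'. W l x)"
proof -
  obtain l where l: "l \<in> lists D" "infinite {x\<in>I. W l x}"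
    using pigeonhole_infinite[OF assms(1), of W, OF assms(2)] by blast
  from oint_infinite_sub[OF assms(3)[OF l(1)] assms(1) l(2)] obtain I' where
    "oint I'" "I' \<subseteq> I" "\<And>x. x \<in> I' \<Longrightarrow> W l x" by blast
  with l(1) show ?thesis by blast
qed

lemma dense_interval:
  assumes "oint I" obtains p q where "p \<in> D" "q \<in> D" "p < q" "{p<..<q} \<subseteq> I"
proof -
  obtain a b where ab: "a < b" "I = {a<..<b}" using assms by (auto simp: oint_def)
  obtain p where p: "p \<in> D" "a < p" "p < b" using dense[OF ab(1)] by blast
  obtain q where q: "q \<in> D" "p < q" "q < b" using dense[OF p(3)] by blast
  show ?thesis using p q ab by (intro that[of p q]) auto
qed

text \<open>Each infinite fibre contains an interval with ends in \<open>D\<close>, and by the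
  pigeonhole principle the same two ends serve all s in some subinterval.\<close>

lemma infinite_fibres_box:
  assumes "dpred (\<lambda>e. A (e 0) (e (Suc 0)))" "oint I"
    and "\<And>s. s \<in> I \<Longrightarrow> infinite {t. A s t}"
  shows "\<exists>I' J'. oint I' \<and> oint J' \<and> I' \<subseteq> I \<and> (\<forall>s\<in>I'. \<forall>t\<in>J'. A s t)"
proof -
  define W where "W l s \<longleftrightarrow> l ! 0 < l ! 1 \<and> (\<forall>t. l ! 0 < t \<and> t < l ! 1 \<longrightarrow> A s t)" for l s
  have "\<exists>l\<in>lists D. W l s" if "s \<in> I" for s
  proof -
    have "dpred (\<lambda>e. A s (e 0))" by (intro dpred2[OF assms(1)] dpred_intros)
    from infinite_oint[OF this assms(3)[OF that]]
    obtain J' where J': "oint J'" "\<And>t. t \<in> J' \<Longrightarrow> A s t" by blast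
    from dense_interval[OF J'(1)] obtain p q where "p \<in> D" "q \<in> D" "p < q" "{p<..<q} \<subseteq> J'" by blast
    then show ?thesis using J' by (intro bexI[of _ "[p, q]"]) (auto simp: W_def subset_iff)
  qed
  moreover have "dpred (\<lambda>e. W l (e 0))" for l
    unfolding W_def by (intro dpred_intros dpred_oint assms dpred2[OF assms(1)])
  ultimately have "\<exists>l\<in>lists D. \<exists>I'. oint I' \<and> I' \<subseteq> I \<and> (\<forall>x\<in>I'. W l x)"
    by (rule pigeonhole[OF assms(2)])
  then obtain l I' where l: "oint I'" "I' \<subseteq> I" "\<forall>x\<in>I'. W l x" by blast
  obtain s where "s \<in> I'" using l(1) oint_nonempty by blast
  then show ?thesis using l
    by (intro exI[of _ I'] exI[of _ "{l!0<..<l!1}"]) (auto simp: W_def subset_iff ointI)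
qed

lemma pigeonhole2:
  assumes "oint I" "oint J" "\<And>s t. s \<in> I \<Longrightarrow> t \<in> J \<Longrightarrow> \<exists>l\<in>lists D. W l s t"
    and "\<And>l. l \<in> lists D \<Longrightarrow> dpred (\<lambda>e. W l (e 0) (e (Suc 0)))"
  shows "\<exists>l\<in>lists D. \<exists>I' J'. oint I' \<and> oint J' \<and> I' \<subseteq> I \<and> J' \<subseteq> J \<and> (\<forall>s\<in>I'. \<forall>t\<in>J'. W l s t)"
proof -
  have "\<exists>l\<in>lists D. infinite {t\<in>J. W l s t}" if "s \<in> I" for s
    using pigeonhole_infinite[OF assms(2), of "\<lambda>l t. W l s t"] assms(3)[OF that] by blast
  then obtain l where l: "l \<in> lists D" "infinite {s\<in>I. infinite {t\<in>J. W l s t}}"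
    using pigeonhole_infinite[OF assms(1), of "\<lambda>l s. infinite {t\<in>J. W l s t}"] by blast
  have "\<exists>I' J'. oint I' \<and> oint J' \<and> I' \<subseteq> I \<and> J' \<subseteq> J \<and> (\<forall>s\<in>I'. \<forall>t\<in>J'. W l s t)"
  proof -
    \<comment> \<open>Having infinitely many t is not a first-order condition as it stands. By
      o-minimality the fibre then contains an interval, and this is first order.\<close>
    let ?Q = "\<lambda>s. \<exists>p q. p < q \<and> (\<forall>t. p < t \<and> t < q \<longrightarrow> t \<in> J \<and> W l s t)"
    have Q: "?Q s" if inf: "infinite {t\<in>J. W l s t}" for s
    proof -
      have "dpred (\<lambda>e. W l s (e 0))" by (intro dpred2[OF assms(4)[OF l(1)]] dpred_intros)
      from oint_infinite_sub[OF this assms(2) inf] obtain J' where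
        "oint J'" "J' \<subseteq> J" "\<And>t. t \<in> J' \<Longrightarrow> W l s t" by blast
      then obtain p q where "p < q" "J' = {p<..<q}" by (auto simp: oint_def)
      then show ?thesis using \<open>J' \<subseteq> J\<close> \<open>\<And>t. t \<in> J' \<Longrightarrow> W l s t\<close>
        by (intro exI[of _ p] exI[of _ q]) auto
    qed
    have "{s\<in>I. infinite {t\<in>J. W l s t}} \<subseteq> {s\<in>I. ?Q s}" using Q by blast
    then have "infinite {s\<in>I. ?Q s}" using l(2) finite_subset by blast
    moreover have "dpred (\<lambda>e. ?Q (e 0))"
      by (intro dpred_intros dpred_oint assms dpred2[OF assms(4)[OF l(1)]])
    ultimately obtain I' where I': "oint I'" "I' \<subseteq> I" "\<And>s. s \<in> I' \<Longrightarrow> ?Q s"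
      using oint_infinite_sub[OF _ assms(1), of ?Q] by blast
    have inf: "infinite {t. t \<in> J \<and> W l s t}" if s: "s \<in> I'" for s
    proof -
      obtain p q where "p < q" "\<forall>t. p < t \<and> t < q \<longrightarrow> t \<in> J \<and> W l s t" using I'(3)[OF s] by blast
      then have "{p<..<q} \<subseteq> {t. t \<in> J \<and> W l s t}" "infinite {p<..<q}" by (auto simp: infinite_Ioo)
      then show ?thesis using finite_subset by blast
    qed
    have "dpred (\<lambda>e. e (Suc 0) \<in> J \<and> W l (e 0) (e (Suc 0)))"
      by (intro dpred_intros dpred_oint assms(2) assms(4)[OF l(1)])
    from infinite_fibres_box[of "\<lambda>s t. t \<in> J \<and> W l s t", OF this I'(1) inf] obtain I'' J' where
      box: "oint I''" "oint J'" "I'' \<subseteq> I'" "\<forall>s\<in>I''. \<forall>t\<in>J'. t \<in> J \<and> W l s t" by blast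
    obtain s where "s \<in> I''" using oint_nonempty[OF box(1)] by blast
    then have "J' \<subseteq> J" using box(4) by blast
    have "I'' \<subseteq> I" using box(3) I'(2) by (rule subset_trans)
    with box \<open>J' \<subseteq> J\<close> have "oint I'' \<and> oint J' \<and> I'' \<subseteq> I \<and> J' \<subseteq> J \<and> (\<forall>s\<in>I''. \<forall>t\<in>J'. W l s t)"
      by simp
    then show ?thesis by (intro exI)
  qed
  then show ?thesis using l(1) by blast
qed

definition pcont :: "('a \<Rightarrow> 'a \<Rightarrow> 'a) \<Rightarrow> 'a \<Rightarrow> 'a \<Rightarrow> bool" where
  "pcont f s t \<longleftrightarrow> (\<forall>l u. l < f s t \<and> f s t < u \<longrightarrow> (\<exists>a b c d. a < s \<and> s < b \<and> c < t \<and> t < d \<and>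
     (\<forall>s' t'. a < s' \<and> s' < b \<and> c < t' \<and> t' < d \<longrightarrow> l < f s' t' \<and> f s' t' < u)))"

text \<open>If \<open>f\<close> is discontinuous at \<open>(s, t)\<close>, then \<open>(s, t)\<close> lies in \<open>f\<^sup>-\<^sup>1(p, q)\<close> but not in its interior for
  some \<open>p, q \<in> D\<close>, and no such difference contains a box.\<close>

lemma pcont_on_subbox:
  assumes "dfunc (\<lambda>e. f (e 0) (e (Suc 0)))" "oint I" "oint J"
  shows "\<exists>I' J'. oint I' \<and> oint J' \<and> I' \<subseteq> I \<and> J' \<subseteq> J \<and> (\<forall>s\<in>I'. \<forall>t\<in>J'. pcont f s t)"
proof -
  note f = dfunc2[OF assms(1)]
  have d: "dpred (\<lambda>e. pcont f (e 0) (e (Suc 0)))"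
    unfolding pcont_def by (intro dpred_intros f)
  define N where "N l s t \<longleftrightarrow> (\<exists>a b c d. a < s \<and> s < b \<and> c < t \<and> t < d \<and>
    (\<forall>s' t'. a < s' \<and> s' < b \<and> c < t' \<and> t' < d \<longrightarrow> l ! 0 < f s' t' \<and> f s' t' < l ! 1))" for l s t
  \<comment> \<open>Every box contains a point of continuity.\<close>
  have bad: "\<exists>s\<in>I'. \<exists>t\<in>J'. pcont f s t" if box: "oint I'" "oint J'" for I' J'
  proof (rule ccontr)
    assume neg: "\<not> ?thesis"
    define W where "W l s t \<longleftrightarrow> l ! 0 < f s t \<and> f s t < l ! 1 \<and> \<not> N l s t" for l s t
    have "\<exists>l\<in>lists D. W l s t" if st: "s \<in> I'" "t \<in> J'" for s t
    proof -
      obtain l u where lu: "l < f s t" "f s t < u" and no: "\<not> (\<exists>a b c d. a < s \<and> s < b \<and> c < t \<and> t < d \<and>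
     (\<forall>s' t'. a < s' \<and> s' < b \<and> c < t' \<and> t' < d \<longrightarrow> l < f s' t' \<and> f s' t' < u))"
        using neg st unfolding pcont_def by blast
      obtain p q where p: "p \<in> D" "l < p" "p < f s t" and q: "q \<in> D" "f s t < q" "q < u"
        using dense[OF lu(1)] dense[OF lu(2)] by blast
      have "\<not> N [p, q] s t"
      proof
        assume "N [p, q] s t"
        then obtain a b c d where "a < s" "s < b" "c < t" "t < d"
          "\<forall>s' t'. a < s' \<and> s' < b \<and> c < t' \<and> t' < d \<longrightarrow> p < f s' t' \<and> f s' t' < q"
          unfolding N_def by auto
        then show False using no p(2) q(3) by (meson less_trans)
      qed
      then show ?thesis using p q by (intro bexI[of _ "[p, q]"]) (auto simp: W_def)
    qed
    moreover have "dpred (\<lambda>e. W l (e 0) (e (Suc 0)))" for l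
      unfolding W_def N_def by (intro dpred_intros f)
    ultimately have "\<exists>l\<in>lists D. \<exists>I'' J''. oint I'' \<and> oint J'' \<and> I'' \<subseteq> I' \<and> J'' \<subseteq> J' \<and>
        (\<forall>s\<in>I''. \<forall>t\<in>J''. W l s t)"
      by (rule pigeonhole2[OF box])
    then obtain l I'' J'' where b: "oint I''" "oint J''" "\<forall>s\<in>I''. \<forall>t\<in>J''. W l s t" by blast
    obtain a b c d where I: "I'' = {a<..<b}" "J'' = {c<..<d}" using b(1,2) by (auto simp: oint_def)
    obtain s t where st: "s \<in> I''" "t \<in> J''" using b(1,2) oint_nonempty by blast
    have "N l s t" unfolding N_def
      using st b(3) by (intro exI[of _ a] exI[of _ b] exI[of _ c] exI[of _ d]) (auto simp: I W_def)
    then show False using b(3) st by (simp add: W_def)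
  qed
  \<comment> \<open>A second use of the pigeonhole principle: discontinuity, coded by the empty
    list, and continuity, coded by all other lists, form a definable cover of the box, and by
    \<open>bad\<close> the former cannot fill a sub-box.\<close>
  define W where "W l s t \<longleftrightarrow> (if l = [] then \<not> pcont f s t else pcont f s t)" for l :: "'a list" and s t
  obtain q where q: "q \<in> D" using dense[of 0 1] by auto
  have "\<exists>l\<in>lists D. W l s t" for s t
    by (cases "pcont f s t") (auto simp: W_def q intro: bexI[of _ "[]"] bexI[of _ "[q]"])
  moreover have "dpred (\<lambda>e. W l (e 0) (e (Suc 0)))" for l
    unfolding W_def by (cases "l = []") (use d dpred_not[OF d] in auto)
  ultimately have "\<exists>l\<in>lists D. \<exists>I' J'. oint I' \<and> oint J' \<and> I' \<subseteq> I \<and> J' \<subseteq> J \<and>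
      (\<forall>s\<in>I'. \<forall>t\<in>J'. W l s t)"
    by (rule pigeonhole2[OF assms(2,3)])
  then obtain l I' J' where b: "oint I'" "oint J'" "I' \<subseteq> I" "J' \<subseteq> J"
    "\<forall>s\<in>I'. \<forall>t\<in>J'. W l s t" by blast
  then have "l \<noteq> []" using bad[OF b(1,2)] by (auto simp: W_def)
  then show ?thesis using b by (intro exI[of _ I'] exI[of _ J']) (auto simp: W_def)
qed

end

section \<open>Cells and sets of dimension at most one\<close>

lemma tuples_0: "tuples 0 = {\<lambda>_. undefined}"
  by (auto simp: tuples_iff)

lemma tuples_Suc_upd: "x \<in> tuples n \<Longrightarrow> x(n := t) \<in> tuples (Suc n)"
  by (auto simp: tuples_iff)

lemma tuples_Suc_split: "x \<in> tuples (Suc n) \<Longrightarrow> (restr n x)(n := x n) = x"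
  by (auto simp: tuples_iff restr_def fun_eq_iff)

lemma restr_upd [simp]: "x \<in> tuples n \<Longrightarrow> restr n (x(n := t)) = x"
  by (auto simp: tuples_iff restr_def fun_eq_iff)

lemma restr_restr_Suc [simp]: "restr n (restr (Suc n) e) = restr n e"
  by (auto simp: restr_def)

lemma openin_ord_top_interval: "openin ord_top {a<..<b::'a::linorder}"
proof -
  have "openin ord_top {a<..}" "openin ord_top {..<b}"
    unfolding ord_top_def by (auto intro: topology_generated_by_Basis)
  then show ?thesis using openin_Int by (fastforce simp: greaterThanLessThan_def)
qed

section \<open>Cells parametrised by intervals and boxes\<close>

context omin_field
begin

text \<open>These functions recover the parameters of a point. They are continuous on R^n whatever
  the cell, and do not notice an appended coordinate.\<close>

definition coord_fun :: "nat \<Rightarrow> ((nat \<Rightarrow> 'a) \<Rightarrow> 'a) \<Rightarrow> bool" where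
  "coord_fun n p \<longleftrightarrow> (\<exists>i<n. p = (\<lambda>x. x i)) \<or> (\<exists>c. p = (\<lambda>x. c))"

text \<open>The pair (p, q) inverts G only up to the value of G. So a parameter on which G does not
  depend may be recovered as an arbitrary constant from its interval.\<close>

definition param_cell :: "nat \<Rightarrow> nat \<Rightarrow> ('a \<Rightarrow> 'a \<Rightarrow> nat \<Rightarrow> 'a) \<Rightarrow> 'a set \<Rightarrow> 'a set \<Rightarrow> bool" where
  "param_cell n d G I J \<longleftrightarrow> cell M n d {G s t |s t. s \<in> I \<and> t \<in> J} \<and>
     (\<exists>p q. coord_fun n p \<and> coord_fun n q \<and>
        (\<forall>s\<in>I. \<forall>t\<in>J. p (G s t) \<in> I \<and> q (G s t) \<in> J \<and> G (p (G s t)) (q (G s t)) = G s t))"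

text \<open>A patch of dimension \<open>d \<in> {1, 2}\<close>; in dimension 1 the second parameter is a dummy.\<close>

definition patch :: "nat \<Rightarrow> nat \<Rightarrow> ('a \<Rightarrow> 'a \<Rightarrow> nat \<Rightarrow> 'a) \<Rightarrow> 'a set \<Rightarrow> 'a set \<Rightarrow> bool" where
  "patch n d G I J \<longleftrightarrow> oint I \<and> oint J \<and> (\<forall>i<n. dfunc (\<lambda>e. G (e 0) (e (Suc 0)) i)) \<and>
     (\<forall>s t. G s t \<in> tuples n) \<and> (d = 1 \<longrightarrow> (\<forall>s t t'. G s t = G s t')) \<and>
     (\<forall>I' J'. I' \<subseteq> I \<longrightarrow> J' \<subseteq> J \<longrightarrow> oint I' \<longrightarrow> oint J' \<longrightarrow> param_cell n d G I' J')"

lemma patchI: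
  assumes "oint I" "oint J" "\<And>i. i < n \<Longrightarrow> dfunc (\<lambda>e. G (e 0) (e (Suc 0)) i)"
    and "\<And>s t. G s t \<in> tuples n" "\<And>s t t'. d = 1 \<Longrightarrow> G s t = G s t'"
    and "\<And>I' J'. I' \<subseteq> I \<Longrightarrow> J' \<subseteq> J \<Longrightarrow> oint I' \<Longrightarrow> oint J' \<Longrightarrow> param_cell n d G I' J'"
  shows "patch n d G I J"
  unfolding patch_def by (intro conjI allI impI assms)

lemma patchD:
  assumes "patch n d G I J"
  shows "oint I" "oint J" "i < n \<Longrightarrow> dfunc (\<lambda>e. G (e 0) (e (Suc 0)) i)"
    and "G s t \<in> tuples n" "d = 1 \<Longrightarrow> G s t = G s t'"
    and "I' \<subseteq> I \<Longrightarrow> J' \<subseteq> J \<Longrightarrow> oint I' \<Longrightarrow> oint J' \<Longrightarrow> param_cell n d G I' J'"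
  using assms unfolding patch_def by simp_all

text \<open>The reason why \<open>patch\<close> asks for a cell over every sub-box: each pigeonhole
  argument and each use of generic continuity shrinks the box.\<close>

lemma patch_subset:
  "patch n d G I J \<Longrightarrow> I' \<subseteq> I \<Longrightarrow> J' \<subseteq> J \<Longrightarrow> oint I' \<Longrightarrow> oint J' \<Longrightarrow> patch n d G I' J'"
  by (rule patchI) (assumption | erule patchD(3,4,5) | blast intro: patchD(6))+

lemma continuous_coord_fun:
  assumes "coord_fun n p" shows "continuous_map (subtopology (tuples_top n) C) ord_top p"
  using assms unfolding coord_fun_def tuples_top_def
  by (auto intro!: continuous_map_from_subtopology continuous_map_product_projection)

text \<open>A point x of the cell has parameters p x and q x, which depend continuously on x; thus
  continuity of \<open>F\<close> after G on the box descends to the cell with the topology of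
  R^n.\<close>

lemma continuous_on_param_cell:
  assumes "param_cell n d G I J" "\<And>s t. s \<in> I \<Longrightarrow> t \<in> J \<Longrightarrow> pcont (\<lambda>s t. F (G s t)) s t"
    and "\<And>s t. G s t \<in> tuples n"
  shows "continuous_map (subtopology (tuples_top n) {G s t |s t. s \<in> I \<and> t \<in> J}) ord_top F"
proof -
  let ?C = "{G s t |s t. s \<in> I \<and> t \<in> J}"
  let ?T = "subtopology (tuples_top n) ?C"
  obtain p q where pq: "coord_fun n p" "coord_fun n q" and
    inv: "\<And>s t. s \<in> I \<Longrightarrow> t \<in> J \<Longrightarrow> p (G s t) \<in> I \<and> q (G s t) \<in> J \<and> G (p (G s t)) (q (G s t)) = G s t"
    using assms(1) unfolding param_cell_def by blast
  have top: "topspace ?T = ?C"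
    using assms(3) by (auto simp: tuples_top_def tuples_def)
  have loc: "\<exists>S. openin ?T S \<and> x \<in> S \<and> (\<forall>y\<in>S. l < F y \<and> F y < u)"
    if x: "x \<in> ?C" and lu: "l < F x" "F x < u" for x l u
  proof -
    have px: "p x \<in> I" "q x \<in> J" "G (p x) (q x) = x" using x inv by auto
    obtain a b c d where box: "a < p x" "p x < b" "c < q x" "q x < d"
      "\<And>s t. a < s \<Longrightarrow> s < b \<Longrightarrow> c < t \<Longrightarrow> t < d \<Longrightarrow> l < F (G s t) \<and> F (G s t) < u"
      using assms(2)[OF px(1,2), unfolded pcont_def px(3), rule_format, OF conjI[OF lu]] by metis
    let ?S = "{y \<in> topspace ?T. p y \<in> {a<..<b}} \<inter> {y \<in> topspace ?T. q y \<in> {c<..<d}}"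
    have "openin ?T ?S"
      by (intro openin_Int openin_continuous_map_preimage[OF continuous_coord_fun] pq openin_ord_top_interval)
    moreover have "x \<in> ?S" unfolding top using x box by auto
    moreover have "l < F y \<and> F y < u" if "y \<in> ?S" for y
    proof -
      have "y \<in> ?C" using that unfolding top by blast
      then have "G (p y) (q y) = y" using inv by auto
      then show ?thesis using that box(5)[of "p y" "q y"] by auto
    qed
    ultimately show ?thesis by blast
  qed
  have "openin ?T (F -` U \<inter> ?C)" if U: "U \<in> range lessThan \<union> range greaterThan" for U
  proof (subst openin_subopen, rule ballI)
    fix x assume x: "x \<in> F -` U \<inter> ?C"
    obtain l u where lu: "l < F x" "F x < u" "\<And>y. l < y \<Longrightarrow> y < u \<Longrightarrow> y \<in> U"
    proof -
      from U consider v where "U = {..<v}" | v where "U = {v<..}" by blast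
      then show ?thesis
      proof cases
        case 1 then show ?thesis using x by (intro that[of "F x - 1" v]) auto
      next
        case 2 then show ?thesis using x by (intro that[of v "F x + 1"]) auto
      qed
    qed
    obtain S where S: "openin ?T S" "x \<in> S" "\<forall>y\<in>S. l < F y \<and> F y < u" using loc[OF _ lu(1,2)] x by blast
    have "S \<subseteq> ?C" using openin_subset[OF S(1)] unfolding top .
    then show "\<exists>S. openin ?T S \<and> x \<in> S \<and> S \<subseteq> F -` U \<inter> ?C"
      using S lu(3) by (intro exI[of _ S]) auto
  qed
  moreover have "F ` ?C \<subseteq> \<Union>(range lessThan \<union> range greaterThan)"
    using lt_ex by auto
  ultimately show ?thesis
    unfolding ord_top_def continuous_on_generated_topo_iff top by blast
qed

lemma definable_graph:
  assumes "\<And>i. i < n \<Longrightarrow> dfunc (\<lambda>e. G (e 0) (e (Suc 0)) i)" "\<And>s t. G s t \<in> tuples n" "oint I" "oint J"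
    and F: "dfunc (\<lambda>e. F (G (e 0) (e (Suc 0))))"
  shows "definable M (Suc n) {x(n := F x) |x. x \<in> {G s t |s t. s \<in> I \<and> t \<in> J}}"
proof (rule definable_eqI)
  show "dpred (\<lambda>e. \<exists>s t. s \<in> I \<and> t \<in> J \<and> (\<forall>i<n. e i = G s t i) \<and> e n = F (G s t))"
    by (intro dpred_ex dpred_conj dpred_finite_all dpred_oint dpred_eq dfunc_var assms
        dfunc2[where f = "\<lambda>s t. F (G s t)"] dfunc2[where f = "\<lambda>s t. G s t _"])
  show "{x(n := F x) |x. x \<in> {G s t |s t. s \<in> I \<and> t \<in> J}} \<subseteq> tuples (Suc n)"
    using tuples_Suc_upd[OF assms(2)] by auto
next
  fix x :: "nat \<Rightarrow> 'a" assume x: "x \<in> tuples (Suc n)"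
  have "x = (G s t)(n := F (G s t)) \<longleftrightarrow> (\<forall>i<n. x i = G s t i) \<and> x n = F (G s t)" for s t
  proof
    assume *: "(\<forall>i<n. x i = G s t i) \<and> x n = F (G s t)"
    show "x = (G s t)(n := F (G s t))"
    proof
      fix i
      consider "i < n" | "i = n" | "Suc n \<le> i" by linarith
      then show "x i = ((G s t)(n := F (G s t))) i"
        using * x assms(2)[of s t] by cases (auto simp: tuples_iff)
    qed
  qed auto
  then show "x \<in> {x(n := F x) |x. x \<in> {G s t |s t. s \<in> I \<and> t \<in> J}} \<longleftrightarrow>
    (\<exists>s t. s \<in> I \<and> t \<in> J \<and> (\<forall>i<n. x i = G s t i) \<and> x n = F (G s t))" by blast
qed

lemma definable_cont_param_cell:
  assumes "param_cell n d G I J" "\<And>s t. s \<in> I \<Longrightarrow> t \<in> J \<Longrightarrow> pcont (\<lambda>s t. F (G s t)) s t"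
    and "\<And>i. i < n \<Longrightarrow> dfunc (\<lambda>e. G (e 0) (e (Suc 0)) i)" "\<And>s t. G s t \<in> tuples n" "oint I" "oint J"
    and "dfunc (\<lambda>e. F (G (e 0) (e (Suc 0))))"
  shows "definable_cont M n {G s t |s t. s \<in> I \<and> t \<in> J} F"
  unfolding definable_cont_def definable_fun_def
  using continuous_on_param_cell[OF assms(1,2,4)] definable_graph[OF assms(3-7)] assms(4) by blast

lemma pcont_const: "pcont (\<lambda>s t. c) s t"
  unfolding pcont_def by (meson gt_ex lt_ex)

lemma coord_fun_Suc: "coord_fun n p \<Longrightarrow> coord_fun (Suc n) p"
  unfolding coord_fun_def by (blast intro: less_SucI)

lemma coord_fun_upd: "coord_fun n p \<Longrightarrow> p (x(n := t)) = p x"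
  unfolding coord_fun_def by auto

lemma dfunc_upd:
  assumes "\<And>i. i < n \<Longrightarrow> dfunc (\<lambda>e. x e i)" "dfunc f" "i < Suc n"
  shows "dfunc (\<lambda>e. ((x e)(n := f e)) i)"
  using assms by (cases "i = n") (auto simp: less_Suc_eq)

lemma patch_graph:
  assumes p: "patch n d G I J" and F: "dfunc (\<lambda>e. F (G (e 0) (e (Suc 0))))"
    and c: "\<And>s t. s \<in> I \<Longrightarrow> t \<in> J \<Longrightarrow> pcont (\<lambda>s t. F (G s t)) s t"
  shows "patch (Suc n) d (\<lambda>s t. (G s t)(n := F (G s t))) I J"
proof -
  let ?G = "\<lambda>s t. (G s t)(n := F (G s t))"
  have cells: "param_cell (Suc n) d ?G I' J'" if sub: "I' \<subseteq> I" "J' \<subseteq> J" "oint I'" "oint J'" for I' J'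
  proof -
    have nc: "param_cell n d G I' J'" using p sub by (simp add: patch_def)
    then obtain p q where pq: "coord_fun n p" "coord_fun n q" and
      inv: "\<And>s t. s \<in> I' \<Longrightarrow> t \<in> J' \<Longrightarrow> p (G s t) \<in> I' \<and> q (G s t) \<in> J' \<and> G (p (G s t)) (q (G s t)) = G s t"
      unfolding param_cell_def by blast
    have "definable_cont M n {G s t |s t. s \<in> I' \<and> t \<in> J'} F"
      by (rule definable_cont_param_cell[OF nc]) (use p sub c F in \<open>auto simp: patch_def\<close>)
    then have "cell M (Suc n) d {x(n := F x) |x. x \<in> {G s t |s t. s \<in> I' \<and> t \<in> J'}}"
      using nc by (intro cell.graph) (auto simp: param_cell_def)
    also have "{x(n := F x) |x. x \<in> {G s t |s t. s \<in> I' \<and> t \<in> J'}} = {?G s t |s t. s \<in> I' \<and> t \<in> J'}"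
      by blast
    finally show ?thesis unfolding param_cell_def
      using inv by (intro conjI exI[of _ p] exI[of _ q]) (auto simp: coord_fun_Suc coord_fun_upd pq)
  qed
  have "dfunc (\<lambda>e. ?G (e 0) (e (Suc 0)) i)" if "i < Suc n" for i
    by (intro dfunc_upd patchD(3)[OF p] F that)
  moreover have "?G s t = ?G s t'" if "d = 1" for s t t'
    using patchD(5)[OF p that, of s t t'] by simp
  ultimately show ?thesis
    by (rule patchI[OF patchD(1,2)[OF p] _ tuples_Suc_upd[OF patchD(4)[OF p]]])
      (assumption | rule cells)+
qed

lemma param_cell_band:
  assumes nc: "param_cell n d G I J" and "oint I" "oint J" "oint K"
    and "\<And>i. i < n \<Longrightarrow> dfunc (\<lambda>e. G (e 0) (e (Suc 0)) i)" "\<And>s t. G s t \<in> tuples n"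
  shows "cell M (Suc n) (Suc d) {x(n := u) |x u. x \<in> {G s t |s t. s \<in> I \<and> t \<in> J} \<and> u \<in> K}"
proof -
  obtain a b where ab: "a < b" "K = {a<..<b}" using assms(4) by (auto simp: oint_def)
  let ?C = "{G s t |s t. s \<in> I \<and> t \<in> J}"
  have "definable_cont M n ?C (\<lambda>_. c)" for c
    by (rule definable_cont_param_cell[OF nc]) (use assms pcont_const dfunc_const in auto)
  moreover have "cell M n d ?C" using nc by (simp add: param_cell_def)
  ultimately have "cell M (Suc n) (Suc d) {x(n := t) |x t. x \<in> ?C \<and>
      (\<forall>f\<in>set_option (Some (\<lambda>_. a)). f x < t) \<and> (\<forall>g\<in>set_option (Some (\<lambda>_. b)). t < g x)}"
    using ab by (intro cell.band) auto
  then show ?thesis by (simp add: ab conj_ac)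
qed

text \<open>The dummy parameter of a curve is frozen at 0, which need not lie in J since G ignores
  it, and its place is taken by the height in the band.\<close>

lemma patch_band:
  assumes p: "patch n 1 G I J" and K: "oint K"
  shows "patch (Suc n) 2 (\<lambda>s t. (G s 0)(n := t)) I K"
proof -
  let ?G = "\<lambda>s t. (G s 0)(n := t)"
  have G: "G s t = G s 0" for s t by (rule patchD(5)[OF p]) simp
  have cells: "param_cell (Suc n) 2 ?G I' K'" if sub: "I' \<subseteq> I" "K' \<subseteq> K" "oint I'" "oint K'" for I' K'
  proof -
    have nc: "param_cell n 1 G I' J" using p sub by (simp add: patch_def)
    then obtain p q where pq: "coord_fun n p" "coord_fun n q" and
      inv: "\<And>s t. s \<in> I' \<Longrightarrow> t \<in> J \<Longrightarrow> p (G s t) \<in> I' \<and> q (G s t) \<in> J \<and> G (p (G s t)) (q (G s t)) = G s t"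
      unfolding param_cell_def by blast
    obtain t0 where t0: "t0 \<in> J" using oint_nonempty[OF patchD(2)[OF p]] by blast
    have inv': "p (G s 0) \<in> I' \<and> G (p (G s 0)) 0 = G s 0" if "s \<in> I'" for s
      using inv[OF that t0] G by metis
    have "cell M (Suc n) (Suc 1) {x(n := u) |x u. x \<in> {G s t |s t. s \<in> I' \<and> t \<in> J} \<and> u \<in> K'}"
      by (rule param_cell_band[OF nc]) (use p sub in \<open>auto simp: patch_def\<close>)
    also have "{x(n := u) |x u. x \<in> {G s t |s t. s \<in> I' \<and> t \<in> J} \<and> u \<in> K'} = {?G s t |s t. s \<in> I' \<and> t \<in> K'}"
    proof -
      have "{G s t |s t. s \<in> I' \<and> t \<in> J} = {G s 0 |s. s \<in> I'}"
      proof (intro set_eqI iffI)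
        fix x assume "x \<in> {G s t |s t. s \<in> I' \<and> t \<in> J}"
        then obtain s t where "s \<in> I'" "x = G s t" by blast
        then show "x \<in> {G s 0 |s. s \<in> I'}" using G[of s t] by auto
      next
        fix x assume "x \<in> {G s 0 |s. s \<in> I'}"
        then obtain s where "s \<in> I'" "x = G s 0" by blast
        then show "x \<in> {G s t |s t. s \<in> I' \<and> t \<in> J}" using G[of s t0] t0
            by (intro CollectI exI[of _ s] exI[of _ t0]) simp
      qed
      then show ?thesis by auto
    qed
    finally have "cell M (Suc n) 2 {?G s t |s t. s \<in> I' \<and> t \<in> K'}" by (simp add: numeral_2_eq_2)
    moreover have "coord_fun (Suc n) (\<lambda>x. x n)" by (auto simp: coord_fun_def)
    ultimately show ?thesis unfolding param_cell_def
      by (intro conjI exI[of _ p] exI[of _ "\<lambda>x. x n"] ballI)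
        (simp_all add: coord_fun_Suc coord_fun_upd[OF pq(1)] pq inv')
  qed
  have df: "dfunc (\<lambda>e. ?G (e 0) (e (Suc 0)) i)" if i: "i < Suc n" for i
  proof (rule dfunc_upd[OF _ dfunc_var i])
    fix i assume "i < n"
    then show "dfunc (\<lambda>e. G (e 0) 0 i)"
      by (intro dfunc2[where f = "\<lambda>s t. G s t i", OF patchD(3)[OF p]] dfunc_var dfunc_const)
  qed
  show ?thesis by (rule patchI[OF patchD(1)[OF p] K df tuples_Suc_upd[OF patchD(4)[OF p]] _ cells]) simp_all
qed

lemma param_cell_point:
  assumes "cell M n 0 {y}" "oint I" "oint J" shows "param_cell n 0 (\<lambda>s t. y) I J"
proof -
  obtain a b where "a \<in> I" "b \<in> J" using assms oint_nonempty by metis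
  moreover have "{y |s t. s \<in> I \<and> t \<in> J} = {y}" using calculation by blast
  ultimately show ?thesis using assms(1) unfolding param_cell_def
    by (intro conjI exI[of _ "\<lambda>x. a"] exI[of _ "\<lambda>x. b"]) (auto simp: coord_fun_def)
qed

lemma cell_point: "y \<in> tuples n \<Longrightarrow> cell M n 0 {y}"
proof (induction n arbitrary: y)
  case 0 then show ?case using cell.point[of M] by (simp add: tuples_0)
next
  case (Suc n)
  let ?y = "restr n y"
  have I: "oint {0<..<1::'a}" by (simp add: ointI)
  have c: "cell M n 0 {?y}" by (rule Suc.IH) simp
  have C: "{?y |s t. s \<in> {0<..<1::'a} \<and> t \<in> {0<..<1::'a}} = {?y}" using oint_nonempty[OF I] by blast
  have "definable_cont M n {?y} (\<lambda>_. y n)"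
    using definable_cont_param_cell[OF param_cell_point[OF c I I], of "\<lambda>_. y n"]
    unfolding C by (simp add: pcont_const dfunc_const I)
  from cell.graph[OF c this] show ?case using tuples_Suc_split[OF Suc.prems] by simp
qed

text \<open>The vertical segment over a point. The interval from 0 to 1 is an arbitrary range for
  the dummy parameter.\<close>

lemma patch_point_band:
  assumes y: "y \<in> tuples n" and K: "oint K"
  shows "patch (Suc n) 1 (\<lambda>s t. y(n := s)) K {0<..<1}"
proof -
  let ?G = "\<lambda>s t :: 'a. y(n := s)"
  have "param_cell (Suc n) 1 ?G I' J'" if sub: "oint I'" "oint J'" for I' J'
  proof -
    obtain a b where ab: "a \<in> I'" "b \<in> J'" using sub oint_nonempty by metis
    have C: "{y |s t. s \<in> I' \<and> t \<in> J'} = {y}" using ab by blast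
    have "cell M (Suc n) (Suc 0) {x(n := u) |x u. x \<in> {y |s t. s \<in> I' \<and> t \<in> J'} \<and> u \<in> I'}"
      by (rule param_cell_band[OF param_cell_point[OF cell_point[OF y]]]) (use sub y dfunc_const in auto)
    also have "{x(n := u) |x u. x \<in> {y |s t. s \<in> I' \<and> t \<in> J'} \<and> u \<in> I'} = {?G s t |s t. s \<in> I' \<and> t \<in> J'}"
      unfolding C using ab by blast
    finally show ?thesis unfolding param_cell_def
      using ab by (intro conjI exI[of _ "\<lambda>x. x n"] exI[of _ "\<lambda>x. b"]) (auto simp: coord_fun_def)
  qed
  moreover have "dfunc (\<lambda>e. (y(n := e 0)) i)" if "i < Suc n" for i
    by (rule dfunc_upd[OF dfunc_const dfunc_var that])
  ultimately show ?thesis by (intro patchI K tuples_Suc_upd y) (simp_all add: ointI)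
qed

text \<open>Definable choice over a sub-box. A finite fibre has a least point; an infinite one
  contains an interval, hence an element of \<open>D\<close>. The pigeonhole principle makes one
  choice uniform: the least point for the empty list, the constant \<open>hd l\<close> otherwise.
  Generic continuity then makes the graph of this choice a cell.\<close>

lemma patch_section:
  assumes p: "patch n d G I J" and X: "definable M (Suc n) X"
    and ne: "\<And>s t. s \<in> I \<Longrightarrow> t \<in> J \<Longrightarrow> \<exists>u. (G s t)(n := u) \<in> X"
  obtains G' I' J' where "patch (Suc n) d G' I' J'" "\<And>s t. s \<in> I' \<Longrightarrow> t \<in> J' \<Longrightarrow> G' s t \<in> X"
proof -
  define R where "R s t u \<longleftrightarrow> (G s t)(n := u) \<in> X" for s t u
  have R: "dpred (\<lambda>e. R (e 0) (e (Suc 0)) (e (Suc (Suc 0))))" unfolding R_def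
    using p by (intro dpred_mem[OF X] dfunc_upd dfunc_var) (auto simp: patch_def tuples_Suc_upd)
  have IJ: "oint I" "oint J" using p by (auto simp: patch_def)
  define W where "W l s t \<longleftrightarrow> (if l = [] then \<exists>u. R s t u \<and> (\<forall>v. R s t v \<longrightarrow> u \<le> v) else R s t (hd l))" for l s t
  have "\<exists>l\<in>lists D. W l s t" if st: "s \<in> I" "t \<in> J" for s t
  proof (cases "finite {u. R s t u}")
    case True
    moreover have "{u. R s t u} \<noteq> {}" using ne[OF st] by (auto simp: R_def)
    ultimately have "R s t (Min {u. R s t u}) \<and> (\<forall>v. R s t v \<longrightarrow> Min {u. R s t u} \<le> v)"
      using Min_in by auto
    then show ?thesis by (intro bexI[of _ "[]"]) (auto simp: W_def)
  next
    case False
    have "dpred (\<lambda>e. R s t (e 0))" by (intro dpred3[OF R] dpred_intros)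
    from infinite_oint[OF this False] obtain K where K: "oint K" "\<And>u. u \<in> K \<Longrightarrow> R s t u" by blast
    then obtain a b where "a < b" "K = {a<..<b}" by (auto simp: oint_def)
    then obtain q where "q \<in> D" "q \<in> K" using dense by auto
    then show ?thesis using K(2) by (intro bexI[of _ "[q]"]) (auto simp: W_def)
  qed
  moreover have "dpred (\<lambda>e. W l (e 0) (e (Suc 0)))" for l
    unfolding W_def by (cases "l = []"; simp; intro dpred_intros dpred3[OF R])
  ultimately have "\<exists>l\<in>lists D. \<exists>I' J'. oint I' \<and> oint J' \<and> I' \<subseteq> I \<and> J' \<subseteq> J \<and>
      (\<forall>s\<in>I'. \<forall>t\<in>J'. W l s t)"
    by (rule pigeonhole2[OF IJ])
  then obtain l I1 J1 where b: "oint I1" "oint J1" "I1 \<subseteq> I" "J1 \<subseteq> J"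
    "\<forall>s\<in>I1. \<forall>t\<in>J1. W l s t" by blast
  \<comment> \<open>Stated for the point x rather than for its parameters, because
    \<open>patch_graph\<close> needs the height as a function of x.\<close>
  define least where "least x u \<longleftrightarrow> x(n := u) \<in> X \<and> (\<forall>v. x(n := v) \<in> X \<longrightarrow> u \<le> v)" for x u
  define F where "F x = (if l = [] then (if \<exists>u. least x u then THE u. least x u else 0) else hd l)" for x
  have least_unique: "u = v" if "least x u" "least x v" for x u v
    using that by (auto simp: least_def intro: antisym)
  have least_the: "(THE u. least x u) = u" if "least x u" for x u
    using that by (intro the_equality) (auto simp: least_def intro: antisym)
  have "dfunc (\<lambda>e. F (G (e 0) (e (Suc 0))))"
  proof (cases "l = []")
    case True
    let ?L = "\<lambda>s t u. R s t u \<and> (\<forall>v. R s t v \<longrightarrow> u \<le> v)"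
    have "dpred (\<lambda>e. ?L (e (Suc 0)) (e (Suc (Suc 0))) (e 0) \<or>
        (\<not> (\<exists>u. ?L (e (Suc 0)) (e (Suc (Suc 0))) u) \<and> e 0 = 0))"
      by (intro dpred_intros dpred3[OF R])
    moreover have "?L s t u \<longleftrightarrow> least (G s t) u" for s t u by (simp add: R_def least_def)
    ultimately have "dpred (\<lambda>e. least (G (e (Suc 0)) (e (Suc (Suc 0)))) (e 0) \<or>
        (\<not> (\<exists>u. least (G (e (Suc 0)) (e (Suc (Suc 0)))) u) \<and> e 0 = 0))" by simp
    then show ?thesis
      by (intro dfunc_graphI) (erule dpred_iff_rewrite, auto simp: F_def True least_the intro: least_unique)
  qed (simp add: F_def dfunc_const)
  moreover from pcont_on_subbox[OF this b(1,2)] obtain I' J' where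
    b': "oint I'" "oint J'" "I' \<subseteq> I1" "J' \<subseteq> J1" "\<forall>s\<in>I'. \<forall>t\<in>J'. pcont (\<lambda>s t. F (G s t)) s t"
    by blast
  moreover have "patch n d G I' J'"
    by (rule patch_subset[OF p]) (use b b' in auto)
  ultimately have "patch (Suc n) d (\<lambda>s t. (G s t)(n := F (G s t))) I' J'"
    by (intro patch_graph) auto
  moreover have "(G s t)(n := F (G s t)) \<in> X" if "s \<in> I'" "t \<in> J'" for s t
  proof -
    have "W l s t" using b(5) b'(3,4) that by blast
    then show ?thesis
      by (cases "l = []") (auto simp: W_def F_def R_def least_def[symmetric] least_the, auto simp: least_def)
  qed
  ultimately show ?thesis by (rule that)
qed

text \<open>A working substitute for dimension at most one: a definable map to R that is
  finite-to-one on X.\<close>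

definition thin :: "nat \<Rightarrow> (nat \<Rightarrow> 'a) set \<Rightarrow> bool" where
  "thin n X \<longleftrightarrow> (\<exists>h. dfunc (\<lambda>e. h (restr n e)) \<and> (\<forall>c. finite {x \<in> X. h x = c}))"

lemma definable_projection:
  assumes "definable M (Suc n) X" shows "definable M n {x \<in> tuples n. \<exists>t. x(n := t) \<in> X}"
proof -
  have "dpred (\<lambda>e. \<exists>t. (restr n e)(n := t) \<in> X)"
    by (intro dpred_ex dpred_mem[OF assms(1)] dfunc_upd) (auto simp: dfunc_var tuples_Suc_upd)
  then show ?thesis by (rule definable_eqI) auto
qed

text \<open>For a definable subset of R, to be infinite means to contain an interval.\<close>

lemma definable_infinite_fibre:
  assumes "definable M (Suc n) X" shows "definable M n {x \<in> tuples n. infinite {t. x(n := t) \<in> X}}"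
proof -
  let ?Q = "\<lambda>x. \<exists>a b. a < b \<and> (\<forall>t. a < t \<and> t < b \<longrightarrow> x(n := t) \<in> X)"
  have "dpred (\<lambda>e. ?Q (restr n e))"
    by (intro dpred_intros dpred_mem[OF assms(1)] dfunc_upd) (auto simp: dfunc_var tuples_Suc_upd)
  moreover have "infinite {t. x(n := t) \<in> X} \<longleftrightarrow> ?Q x" if "x \<in> tuples n" for x
  proof
    assume inf: "infinite {t. x(n := t) \<in> X}"
    have "dpred (\<lambda>e. x(n := e 0) \<in> X)"
      by (intro dpred_mem[OF assms(1)] dfunc_upd) (auto simp: dfunc_var dfunc_const tuples_Suc_upd that)
    from infinite_oint[OF this inf] obtain K where K: "oint K" "\<And>t. t \<in> K \<Longrightarrow> x(n := t) \<in> X" by blast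
    then obtain a b where "a < b" "K = {a<..<b}" by (auto simp: oint_def)
    then show "?Q x" using K(2) by (intro exI[of _ a] exI[of _ b]) auto
  next
    assume "?Q x"
    then obtain a b where ab: "a < b" "\<forall>t. a < t \<and> t < b \<longrightarrow> x(n := t) \<in> X" by blast
    then have "{a<..<b} \<subseteq> {t. x(n := t) \<in> X}" by auto
    then show "infinite {t. x(n := t) \<in> X}" using infinite_Ioo[OF ab(1)] finite_subset by blast
  qed
  ultimately show ?thesis by (intro definable_eqI[of "\<lambda>e. ?Q (restr n e)"]) auto
qed

lemma definable_subset_tuples: "definable M n X \<Longrightarrow> X \<subseteq> tuples n"
  by (auto simp: definable_def)

text \<open>Induction on n, using the projection Y and the set A of base points with infinite fibre.
  An infinite X contains a curve lying over a curve in Y or, if Y is finite, a segment over one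
  point. If X is not thin, either Y is not thin and a surface in Y lifts to X, or A is infinite and
  a curve in A spans a band inside X.\<close>

lemma patch_exists:
  assumes "definable M n X"
  shows "(infinite X \<longrightarrow> (\<exists>G I J. patch n 1 G I J \<and> (\<forall>s\<in>I. \<forall>t\<in>J. G s t \<in> X))) \<and>
    (\<not> thin n X \<longrightarrow> (\<exists>G I J. patch n 2 G I J \<and> (\<forall>s\<in>I. \<forall>t\<in>J. G s t \<in> X)))"
  using assms
proof (induction n arbitrary: X)
  case 0
  have "X \<subseteq> tuples 0" using definable_subset_tuples[OF 0] .
  then have "finite X" using finite_subset by (fastforce simp: tuples_0)
  moreover have "thin 0 X" unfolding thin_def using \<open>finite X\<close>
    by (intro exI[of _ "\<lambda>_. 0"]) (auto simp: dfunc_const)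
  ultimately show ?case by blast
next
  case (Suc n)
  note X = Suc.prems
  define Y where "Y = {x \<in> tuples n. \<exists>t. x(n := t) \<in> X}"
  define A where "A = {x \<in> tuples n. infinite {t. x(n := t) \<in> X}}"
  have Y: "definable M n Y" unfolding Y_def by (rule definable_projection[OF X])
  have A: "definable M n A" unfolding A_def by (rule definable_infinite_fibre[OF X])
  have XY: "\<exists>y\<in>Y. x = y(n := x n) \<and> y = restr n x" if "x \<in> X" for x
  proof -
    have "x \<in> tuples (Suc n)" using definable_subset_tuples[OF X] that by blast
    from tuples_Suc_split[OF this] show ?thesis
      using that by (intro bexI[of _ "restr n x"]) (auto simp: Y_def intro: exI[of _ "x n"])
  qed
  have lift: "\<exists>G I J. patch (Suc n) d G I J \<and> (\<forall>s\<in>I. \<forall>t\<in>J. G s t \<in> X)"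
    if "patch n d G I J" "\<forall>s\<in>I. \<forall>t\<in>J. G s t \<in> Y" for d G I J
    using patch_section[OF that(1) X] that(2) unfolding Y_def by (smt (verit) mem_Collect_eq)
  show ?case
  proof (intro conjI impI)
    assume inf: "infinite X"
    show "\<exists>G I J. patch (Suc n) 1 G I J \<and> (\<forall>s\<in>I. \<forall>t\<in>J. G s t \<in> X)"
    proof (cases "finite Y")
      case False then show ?thesis using Suc.IH[OF Y] lift by blast
    next
      case True
      have "X \<subseteq> (\<Union>y\<in>Y. (\<lambda>t. y(n := t)) ` {t. y(n := t) \<in> X})"
      proof
        fix x assume x: "x \<in> X"
        then obtain y where "y \<in> Y" "x = y(n := x n)" using XY by blast
        then show "x \<in> (\<Union>y\<in>Y. (\<lambda>t. y(n := t)) ` {t. y(n := t) \<in> X})" using x by force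
      qed
      then obtain y where y: "y \<in> Y" "infinite {t. y(n := t) \<in> X}"
        using inf True by (meson finite_UN_I finite_imageI finite_subset)
      then have yt: "y \<in> tuples n" by (simp add: Y_def)
      have "dpred (\<lambda>e. y(n := e 0) \<in> X)"
        by (intro dpred_mem[OF X] dfunc_upd) (auto simp: dfunc_var dfunc_const tuples_Suc_upd yt)
      from infinite_oint[OF this y(2)] obtain K where K: "oint K" "\<And>t. t \<in> K \<Longrightarrow> y(n := t) \<in> X" by blast
      show ?thesis using patch_point_band[OF yt K(1)] K(2) by blast
    qed
  next
    assume nt: "\<not> thin (Suc n) X"
    show "\<exists>G I J. patch (Suc n) 2 G I J \<and> (\<forall>s\<in>I. \<forall>t\<in>J. G s t \<in> X)"
    proof (cases "thin n Y")
      case False then show ?thesis using Suc.IH[OF Y] lift by blast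
    next
      case True
      then obtain h where h: "dfunc (\<lambda>e. h (restr n e))" "\<And>c. finite {y \<in> Y. h y = c}"
        unfolding thin_def by blast
      have "infinite A"
      proof
        assume fin: "finite A"
        \<comment> \<open>Over the finitely many points of A the last coordinate is finite-to-one;
          elsewhere the fibres are finite and h composed with the projection is.\<close>
        define h' where "h' x = (if restr n x \<in> A then x n else h (restr n x))" for x
        have "dfunc (\<lambda>e. h' (restr (Suc n) e))"
          unfolding h'_def restr_restr_Suc restr_apply[OF lessI]
          by (intro dfunc_if dpred_restr_mem[OF A] dfunc_var h(1))
        moreover have "finite {x \<in> X. h' x = c}" for c
        proof -
          let ?B = "{y \<in> Y. h y = c} - A"
          have "{x \<in> X. h' x = c} \<subseteq> (\<lambda>y. y(n := c)) ` A \<union> (\<Union>y\<in>?B. (\<lambda>t. y(n := t)) ` {t. y(n := t) \<in> X})"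
          proof
            fix x assume x: "x \<in> {x \<in> X. h' x = c}"
            then obtain y where y: "y \<in> Y" "x = y(n := x n)" "y = restr n x" using XY by blast
            show "x \<in> (\<lambda>y. y(n := c)) ` A \<union> (\<Union>y\<in>?B. (\<lambda>t. y(n := t)) ` {t. y(n := t) \<in> X})"
            proof (cases "y \<in> A")
              case True
              then have "x n = c" using x y by (auto simp: h'_def)
              then have "x = y(n := c)" using y(2) by simp
              then show ?thesis using True by blast
            next
              case False
              then have "y \<in> ?B" using x y by (auto simp: h'_def)
              moreover have "x \<in> (\<lambda>t. y(n := t)) ` {t. y(n := t) \<in> X}"
                using x y(2) by (intro image_eqI[of _ _ "x n"]) auto
              ultimately show ?thesis by blast
            qed
          qed
          moreover have "finite {t. y(n := t) \<in> X}" if "y \<in> ?B" for y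
            using that by (auto simp: A_def Y_def)
          ultimately show ?thesis using fin h(2)[of c] by (elim finite_subset) auto
        qed
        ultimately have "thin (Suc n) X" unfolding thin_def by blast
        then show False using nt by contradiction
      qed
      then obtain G I J where p: "patch n 1 G I J" "\<forall>s\<in>I. \<forall>t\<in>J. G s t \<in> A" using Suc.IH[OF A] by blast
      have IJ: "oint I" "oint J" using p(1) by (auto simp: patch_def)
      obtain t0 where t0: "t0 \<in> J" using oint_nonempty[OF IJ(2)] by blast
      have G0: "G s 0 = G s t0" for s by (rule patchD(5)[OF p(1)]) simp
      have "dfunc (\<lambda>e. G (e 0) 0 i)" if "i < n" for i
        by (intro dfunc2[where f = "\<lambda>s t. G s t i", OF patchD(3)[OF p(1) that]] dfunc_var dfunc_const)
      then have "dpred (\<lambda>e. (G (e 0) 0)(n := e (Suc 0)) \<in> X)"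
        by (intro dpred_mem[OF X] dfunc_upd dfunc_var tuples_Suc_upd patchD(4)[OF p(1)])
      moreover have "infinite {u. (G s 0)(n := u) \<in> X}" if "s \<in> I" for s
      proof -
        have "G s t0 \<in> A" using p(2) that t0 by blast
        then show ?thesis unfolding G0 A_def by simp
      qed
      ultimately have "\<exists>I' K. oint I' \<and> oint K \<and> I' \<subseteq> I \<and>
          (\<forall>s\<in>I'. \<forall>u\<in>K. (G s 0)(n := u) \<in> X)"
        by (intro infinite_fibres_box IJ(1))
      then obtain I' K where K: "oint I'" "oint K" "I' \<subseteq> I"
        "\<forall>s\<in>I'. \<forall>u\<in>K. (G s 0)(n := u) \<in> X" by blast
      have "patch n 1 G I' J" using patch_subset[OF p(1) K(3) _ K(1) IJ(2)] by blast
      from patch_band[OF this K(2)] K(4) show ?thesis by blast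
    qed
  qed
qed

lemma thin_if_dim_le_1:
  assumes "definable M n X" "omin_dim M n X \<le> 1"
  shows "thin n X"
proof (rule ccontr)
  assume "\<not> thin n X"
  then obtain G I J where p: "patch n 2 G I J" "\<forall>s\<in>I. \<forall>t\<in>J. G s t \<in> X"
    using patch_exists[OF assms(1)] by blast
  then have "cell M n 2 {G s t |s t. s \<in> I \<and> t \<in> J}" by (simp add: patch_def param_cell_def)
  moreover have "{G s t |s t. s \<in> I \<and> t \<in> J} \<subseteq> X" using p(2) by blast
  ultimately have "ereal (real 2) \<le> omin_dim M n X"
    unfolding omin_dim_def by (intro Sup_upper) blast
  then show False using assms(2) 
    using order_trans[of "ereal (real 2)" "omin_dim M n X" 1] by (simp add: one_ereal_def)
qed

end

section \<open>Uniform finiteness\<close>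

lemma finite_gap:
  assumes "finite (S :: 'a::linordered_field set)"
  shows "\<exists>\<delta>>0. \<forall>y\<in>S. \<forall>y'\<in>S. y \<noteq> y' \<longrightarrow> 2 * \<delta> \<le> \<bar>y - y'\<bar>"
proof -
  \<comment> \<open>The inserted 1 takes care of sets with fewer than two points.\<close>
  define G where "G = insert 1 ((\<lambda>(y, y'). \<bar>y - y'\<bar>) ` {(y, y'). y \<in> S \<and> y' \<in> S \<and> y \<noteq> y'})"
  have "finite {(y, y'). y \<in> S \<and> y' \<in> S \<and> y \<noteq> y'}"
    by (rule finite_subset[of _ "S \<times> S"]) (use assms in auto)
  then have fin: "finite G" by (simp add: G_def)
  have "0 < Min G" using fin by (auto simp: G_def)
  moreover have "Min G \<le> \<bar>y - y'\<bar>" if "y \<in> S" "y' \<in> S" "y \<noteq> y'" for y y'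
    by (rule Min_le[OF fin]) (use that in \<open>auto simp: G_def\<close>)
  ultimately show ?thesis by (intro exI[of _ "Min G / 2"]) auto
qed

lemma finite_eps:
  assumes "\<And>k. k < (m::nat) \<Longrightarrow> \<exists>\<epsilon>>0. \<forall>x'. \<bar>x' - x\<bar> < \<epsilon> \<longrightarrow> P k x'"
  shows "\<exists>\<epsilon>>(0::'a::linordered_field). \<forall>k<m. \<forall>x'. \<bar>x' - x\<bar> < \<epsilon> \<longrightarrow> P k x'"
  using assms
proof (induction m)
  case 0 then show ?case by (intro exI[of _ 1]) simp
next
  case (Suc m)
  obtain e where e: "e > 0" "\<forall>k<m. \<forall>x'. \<bar>x' - x\<bar> < e \<longrightarrow> P k x'" using Suc by force
  obtain f where f: "f > 0" "\<forall>x'. \<bar>x' - x\<bar> < f \<longrightarrow> P m x'" using Suc.prems by blast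
  show ?case using e f by (intro exI[of _ "min e f"]) (auto simp: less_Suc_eq)
qed

text \<open>A first-order way of counting for fixed k: y belongs to the fibre over x and, if the
  fibre is finite, has at least k of its points below it.\<close>

primrec below :: "('a \<Rightarrow> 'b::linorder \<Rightarrow> bool) \<Rightarrow> nat \<Rightarrow> 'a \<Rightarrow> 'b \<Rightarrow> bool" where
  "below A 0 x y \<longleftrightarrow> A x y"
| "below A (Suc k) x y \<longleftrightarrow> A x y \<and> (\<exists>y'. y' < y \<and> below A k x y')"

lemma below_iff:
  assumes "finite {y. A x y}"
  shows "below A k x y \<longleftrightarrow> A x y \<and> k \<le> card {y'. A x y' \<and> y' < y}"
proof (induction k arbitrary: y)
  case (Suc k)
  have fin: "finite {y'. A x y' \<and> y' < y}" for y by (rule finite_subset[OF _ assms]) auto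
  show ?case
  proof
    assume "below A (Suc k) x y"
    then obtain y' where y': "A x y" "y' < y" "A x y'" "k \<le> card {z. A x z \<and> z < y'}"
      using Suc by auto
    have "card (insert y' {z. A x z \<and> z < y'}) \<le> card {z. A x z \<and> z < y}"
      by (rule card_mono[OF fin]) (use y' in auto)
    then show "A x y \<and> Suc k \<le> card {z. A x z \<and> z < y}" using y' fin by simp
  next
    assume a: "A x y \<and> Suc k \<le> card {z. A x z \<and> z < y}"
    let ?S = "{z. A x z \<and> z < y}"
    have "card ?S \<noteq> 0" using a by linarith
    then have ne: "?S \<noteq> {}" by (metis card.empty)
    have m: "Max ?S \<in> ?S" using Max_in[OF fin ne] .
    have "?S - {Max ?S} \<subseteq> {z. A x z \<and> z < Max ?S}"
    proof
      fix z assume z: "z \<in> ?S - {Max ?S}"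
      then have "z \<le> Max ?S" using Max_ge[OF fin] by blast
      then show "z \<in> {z. A x z \<and> z < Max ?S}" using z by auto
    qed
    then have "card (?S - {Max ?S}) \<le> card {z. A x z \<and> z < Max ?S}" by (rule card_mono[OF fin])
    then have "k \<le> card {z. A x z \<and> z < Max ?S}" using a[THEN conjunct2] m fin[of y] by simp
    then show "below A (Suc k) x y" using a m Suc by auto
  qed
qed simp

lemma card_below_less:
  assumes "finite {y. A x y}" "A x y" "y < y'"
  shows "card {z. A x z \<and> z < y} < card {z. A x z \<and> z < (y'::'b::linorder)}"
proof (rule psubset_card_mono)
  show "finite {z. A x z \<and> z < y'}" by (rule finite_subset[OF _ assms(1)]) auto
  show "{z. A x z \<and> z < y} \<subset> {z. A x z \<and> z < y'}" using assms(2,3) by auto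
qed

lemma card_below_inj:
  assumes "finite {y. A x y}" "A x y" "A x y'"
    "card {z. A x z \<and> z < y} = card {z. A x z \<and> z < (y'::'b::linorder)}"
  shows "y = y'"
  using card_below_less[of A x y y'] card_below_less[of A x y' y] assms
  by (cases y y' rule: linorder_cases) auto

lemma Suc_le_card_iff_below:
  assumes "finite {y. A x y}"
  shows "Suc k \<le> card {y. A x y} \<longleftrightarrow> (\<exists>y. below A k x (y::'b::linorder))"
proof
  assume a: "Suc k \<le> card {y. A x y}"
  then have "card {y. A x y} \<noteq> 0" by linarith
  then have ne: "{y. A x y} \<noteq> {}" by (metis card.empty)
  let ?m = "Max {y. A x y}"
  have m: "A x ?m" using Max_in[OF assms ne] by simp
  have "{y. A x y} - {?m} \<subseteq> {y. A x y \<and> y < ?m}"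
  proof
    fix z assume z: "z \<in> {y. A x y} - {?m}"
    then have "z \<le> ?m" using Max_ge[OF assms] by blast
    then show "z \<in> {y. A x y \<and> y < ?m}" using z by auto
  qed
  then have "card ({y. A x y} - {?m}) \<le> card {y. A x y \<and> y < ?m}"
    by (rule card_mono[rotated]) (rule finite_subset[OF _ assms], auto)
  then have "below A k x ?m" using a m assms by (simp add: below_iff[where A = A and x = x])
  then show "\<exists>y. below A k x y" ..
next
  assume "\<exists>y. below A k x y"
  then obtain y where y: "A x y" "k \<le> card {z. A x z \<and> z < y}" using below_iff[of A x] assms by blast
  have fin: "finite {z. A x z \<and> z < y}" by (rule finite_subset[OF _ assms]) auto
  have "card (insert y {z. A x z \<and> z < y}) \<le> card {y. A x y}"
    by (rule card_mono[OF assms]) (use y in auto)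
  then show "Suc k \<le> card {y. A x y}" using y fin by simp
qed

lemma card_below_image:
  assumes "finite {y. A x y}"
  shows "(\<lambda>y. card {z. A x z \<and> z < y}) ` {y. A x y} = {..<card {y. A x (y::'b::linorder)}}"
proof -
  let ?r = "\<lambda>y. card {z. A x z \<and> z < y}"
  have "?r ` {y. A x y} \<subseteq> {..<card {y. A x y}}"
  proof
    fix k assume "k \<in> ?r ` {y. A x y}"
    then obtain y where "A x y" "k = ?r y" by blast
    then have "below A k x y" using below_iff[of A x, OF assms] by blast
    then have "Suc k \<le> card {y. A x y}" using Suc_le_card_iff_below[of A x, OF assms] by blast
    then show "k \<in> {..<card {y. A x y}}" by simp
  qed
  moreover have "inj_on ?r {y. A x y}"
    using card_below_inj[of A x, OF assms] by (auto simp: inj_on_def)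
  then have "card (?r ` {y. A x y}) = card {..<card {y. A x y}}" by (simp add: card_image)
  ultimately show ?thesis by (intro card_subset_eq) auto
qed

context omin_field
begin

lemma dpred_below:
  assumes "dpred (\<lambda>e. A (e 0) (e (Suc 0)))"
  shows "dpred (\<lambda>e. below A k (e 0) (e (Suc 0)))"
proof (induction k)
  case (Suc k)
  then show ?case by (simp, intro dpred_intros dpred2[OF assms] dpred2[OF Suc])
qed (simp add: assms)

lemma dpred_le_card:
  assumes "dpred (\<lambda>e. A (e 0) (e (Suc 0)))" "\<And>x. finite {y. A x y}"
  shows "dpred (\<lambda>e. k \<le> card {y. A (e 0) y})"
proof (cases k)
  case (Suc k)
  have "dpred (\<lambda>e. \<exists>y. below A k (e 0) y)" by (intro dpred_intros dpred2[OF dpred_below[OF assms(1)]])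
  then show ?thesis unfolding Suc
    by (rule dpred_iff_rewrite) (rule Suc_le_card_iff_below[where A = A, OF assms(2), symmetric])
qed (simp add: dpred_const)

lemma dpred_card_eq:
  assumes "dpred (\<lambda>e. A (e 0) (e (Suc 0)))" "\<And>x. finite {y. A x y}"
  shows "dpred (\<lambda>e. card {y. A (e 0) y} = k)"
proof -
  have "dpred (\<lambda>e. k \<le> card {y. A (e 0) y} \<and> \<not> Suc k \<le> card {y. A (e 0) y})"
    by (intro dpred_intros dpred_le_card assms)
  then show ?thesis by (rule dpred_iff_rewrite) auto
qed

definition cont1 :: "('a \<Rightarrow> 'a) \<Rightarrow> 'a \<Rightarrow> bool" where
  "cont1 f x \<longleftrightarrow> (\<forall>\<epsilon>>0. \<exists>\<delta>>0. \<forall>x'. \<bar>x' - x\<bar> < \<delta> \<longrightarrow> \<bar>f x' - f x\<bar> < \<epsilon>)"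

text \<open>The two-variable result applied with a dummy second variable.\<close>

lemma cont1_on_subinterval:
  assumes "dfunc (\<lambda>e. f (e 0))" "oint I"
  shows "\<exists>I'. oint I' \<and> I' \<subseteq> I \<and> (\<forall>x\<in>I'. cont1 f x)"
proof -
  obtain I' J' where b: "oint I'" "oint J'" "I' \<subseteq> I" "\<forall>s\<in>I'. \<forall>t\<in>J'. pcont (\<lambda>s t. f s) s t"
    using pcont_on_subbox[of "\<lambda>s t. f s", OF assms(1,2,2)] by blast
  obtain t where t: "t \<in> J'" using b(2) oint_nonempty by blast
  have "cont1 f x" if "x \<in> I'" for x
    unfolding cont1_def
  proof (intro allI impI)
    fix \<epsilon> :: 'a assume \<epsilon>: "\<epsilon> > 0"
    have "pcont (\<lambda>s t. f s) x t" using b(4) that t by blast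
    moreover have "f x - \<epsilon> < f x \<and> f x < f x + \<epsilon>" using \<epsilon> by simp
    ultimately obtain a b c d where n: "a < x" "x < b" "c < t" "t < d"
      "\<forall>s' t'. a < s' \<and> s' < b \<and> c < t' \<and> t' < d \<longrightarrow> f x - \<epsilon> < f s' \<and> f s' < f x + \<epsilon>"
      unfolding pcont_def by blast
    show "\<exists>\<delta>>0. \<forall>x'. \<bar>x' - x\<bar> < \<delta> \<longrightarrow> \<bar>f x' - f x\<bar> < \<epsilon>"
    proof (intro exI[of _ "min (x - a) (b - x)"] conjI allI impI)
      show "0 < min (x - a) (b - x)" using n by simp
      fix x' assume "\<bar>x' - x\<bar> < min (x - a) (b - x)"
      then have "a < x'" "x' < b" by (auto simp: abs_less_iff algebra_simps)
      then have "f x - \<epsilon> < f x'" "f x' < f x + \<epsilon>" using n(3-5) by blast+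
      then show "\<bar>f x' - f x\<bar> < \<epsilon>" by (auto simp: abs_less_iff algebra_simps)
    qed
  qed
  then show ?thesis using b by blast
qed

text \<open>The relation \<open>gd\<close> is a definable condition under which matching points at distance less than
  \<open>\<delta>\<close> is a bijection between the fibre over \<open>x\<close> and those over nearby points.\<close>

lemma uniform_finiteness:
  assumes A: "dpred (\<lambda>e. A (e 0) (e (Suc 0)))" and fin: "\<And>x. finite {y. A x y}"
  shows "\<exists>N. \<forall>x. card {y. A x y} \<le> N"
proof -
  define c where "c x = card {y. A x y}" for x
  define gd where "gd x \<epsilon> \<delta> \<longleftrightarrow> 0 < \<epsilon> \<and> 0 < \<delta> \<and>
      (\<forall>y y'. A x y \<and> A x y' \<and> y \<noteq> y' \<longrightarrow> 2 * \<delta> \<le> \<bar>y - y'\<bar>) \<and>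
      (\<forall>x'. \<bar>x' - x\<bar> < \<epsilon> \<longrightarrow>
        (\<forall>y. A x y \<longrightarrow> (\<exists>z. A x' z \<and> \<bar>y - z\<bar> < \<delta>)) \<and>
        (\<forall>y z z'. A x y \<and> A x' z \<and> A x' z' \<and> \<bar>y - z\<bar> < \<delta> \<and> \<bar>y - z'\<bar> < \<delta> \<longrightarrow> z = z') \<and>
        (\<forall>z. A x' z \<longrightarrow> (\<exists>y. A x y \<and> \<bar>y - z\<bar> < \<delta>)))" for x \<epsilon> \<delta>
  define good where "good x \<longleftrightarrow> (\<exists>\<epsilon> \<delta>. gd x \<epsilon> \<delta>)" for x
  have dgood: "dpred (\<lambda>e. good (e 0))"
    unfolding good_def gd_def by (intro dpred_intros dpred2[OF A])
  have good_c: "\<exists>\<epsilon>>0. \<forall>x'. \<bar>x' - x\<bar> < \<epsilon> \<longrightarrow> c x' = c x" if gd: "good x" for x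
  proof -
    obtain \<epsilon> \<delta> where "gd x \<epsilon> \<delta>" using gd unfolding good_def by blast
    note g = this[unfolded gd_def]
    note ed = g[THEN conjunct1] g[THEN conjunct2, THEN conjunct1]
    note gap = g[THEN conjunct2, THEN conjunct2, THEN conjunct1]
    note near = g[THEN conjunct2, THEN conjunct2, THEN conjunct2]
    have "c x' = c x" if x': "\<bar>x' - x\<bar> < \<epsilon>" for x'
    proof -
      note nx = mp[OF spec[OF near] x']
      note ex = nx[THEN conjunct1] and unique = nx[THEN conjunct2, THEN conjunct1]
        and surj = nx[THEN conjunct2, THEN conjunct2]
      obtain f where f: "\<And>y. A x y \<Longrightarrow> A x' (f y) \<and> \<bar>y - f y\<bar> < \<delta>" using ex by metis
      have "inj_on f {y. A x y}"
      proof (rule inj_onI, rule ccontr)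
        fix y y' assume y: "y \<in> {y. A x y}" "y' \<in> {y. A x y}" "f y = f y'" "y \<noteq> y'"
        then have "\<bar>y - f y\<bar> < \<delta>" "\<bar>y' - f y\<bar> < \<delta>" using f by force+
        then have "\<bar>y - y'\<bar> < 2 * \<delta>" by linarith
        moreover have "2 * \<delta> \<le> \<bar>y - y'\<bar>" using gap[rule_format, of y y'] y by simp
        ultimately show False by simp
      qed
      moreover have "f ` {y. A x y} = {y. A x' y}"
      proof (intro set_eqI iffI)
        fix z assume "z \<in> {y. A x' y}"
        then have z: "A x' z" by simp
        then obtain y where y: "A x y" "\<bar>y - z\<bar> < \<delta>" using surj by blast
        then have "f y = z" using f[OF y(1)] unique y z by blast
        then show "z \<in> f ` {y. A x y}" using y(1) by blast
      qed (use f in auto)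
      ultimately show ?thesis unfolding c_def by (metis card_image)
    qed
    then show ?thesis using ed(1) by blast
  qed
  have good_dense: "\<exists>x\<in>I. good x" if I: "oint I" for I
  proof -
    \<comment> \<open>Lists over \<open>D\<close> play the role of natural numbers: only their
      length matters.\<close>
    define W where "W l x \<longleftrightarrow> c x = length l" for l :: "'a list" and x
    obtain q where q: "q \<in> D" using dense[of 0 1] by auto
    have "\<exists>l\<in>lists D. W l x" for x
      by (intro bexI[of _ "replicate (c x) q"]) (auto simp: W_def q set_replicate_conv_if split: if_splits)
    moreover have "dpred (\<lambda>e. W l (e 0))" for l
      unfolding W_def c_def by (rule dpred_card_eq[OF A fin])
    ultimately have "\<exists>l\<in>lists D. \<exists>I'. oint I' \<and> I' \<subseteq> I \<and> (\<forall>x\<in>I'. W l x)"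
      by (intro pigeonhole[OF I])
    then obtain m I1 where I1: "oint I1" "I1 \<subseteq> I" "\<forall>x\<in>I1. c x = m" unfolding W_def by blast
    define r where "r x y = card {z. A x z \<and> z < y}" for x y
    \<comment> \<open>The branch formed by the k-th points of the fibres, counted from 0; the
      default value 0 makes it total.\<close>
    define f where "f k x = (if \<exists>y. A x y \<and> r x y = k then THE y. A x y \<and> r x y = k else 0)" for k x
    have f_eq: "f (r x y) x = y" if "A x y" for x y
    proof -
      have "(THE z. A x z \<and> r x z = r x y) = y"
        using that card_below_inj[of A x, OF fin] by (intro the_equality) (auto simp: r_def)
      then show ?thesis using that by (auto simp: f_def)
    qed
    have df: "dfunc (\<lambda>e. f k (e 0))" for k
    proof -
      have br: "below A k x y \<and> \<not> below A (Suc k) x y \<longleftrightarrow> A x y \<and> r x y = k" for x y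
        using below_iff[of A x, OF fin] by (auto simp: r_def simp del: below.simps)
      have "dpred (\<lambda>e. (below A k (e (Suc 0)) (e 0) \<and> \<not> below A (Suc k) (e (Suc 0)) (e 0)) \<or>
          (\<not> (\<exists>y. below A k (e (Suc 0)) y \<and> \<not> below A (Suc k) (e (Suc 0)) y) \<and> e 0 = 0))"
        by (intro dpred_intros dpred2[OF dpred_below[OF A]])
      moreover have "(A x v \<and> r x v = k) \<or> (\<not> (\<exists>y. A x y \<and> r x y = k) \<and> v = 0) \<longleftrightarrow> v = f k x" for x v
      proof (cases "\<exists>y. A x y \<and> r x y = k")
        case True
        then obtain y where y: "A x y" "r x y = k" by blast
        then have "f k x = y" using f_eq by blast
        then show ?thesis using y f_eq[of x v] by auto
      next
        case False
        then have "f k x = 0" by (simp only: f_def if_False)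
        then show ?thesis using False by auto
      qed
      ultimately have "dpred (\<lambda>e. e 0 = f k (e (Suc 0)))" unfolding br by simp
      then show ?thesis by (rule dfunc_graphI)
    qed
    have "\<exists>I'. oint I' \<and> I' \<subseteq> I1 \<and> (\<forall>x\<in>I'. \<forall>k<j. cont1 (f k) x)" for j
    proof (induction j)
      case (Suc j)
      then obtain I' where I': "oint I'" "I' \<subseteq> I1" "\<forall>x\<in>I'. \<forall>k<j. cont1 (f k) x" by blast
      obtain I'' where "oint I''" "I'' \<subseteq> I'" "\<forall>x\<in>I''. cont1 (f j) x"
        using cont1_on_subinterval[OF df I'(1)] by blast
      then show ?case using I' by (intro exI[of _ I'']) (auto simp: less_Suc_eq)
    qed (use I1 in auto)
    then obtain I' where I': "oint I'" "I' \<subseteq> I1" "\<forall>x\<in>I'. \<forall>k<m. cont1 (f k) x" by blast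
    obtain x where x: "x \<in> I'" using oint_nonempty[OF I'(1)] by blast
    have rank: "\<exists>k<m. f k x' = y" if "x' \<in> I1" "A x' y" for x' y
    proof -
      have "r x' y < m"
        using card_below_image[of A x', OF fin] that I1(3) by (auto simp: r_def c_def)
      then show ?thesis using f_eq[OF that(2)] by blast
    qed
    have Af: "A x' (f k x') \<and> r x' (f k x') = k" if "x' \<in> I1" "k < m" for x' k
    proof -
      have "k \<in> r x' ` {y. A x' y}"
        using card_below_image[of A x', OF fin] that I1(3) by (auto simp: r_def c_def)
      then obtain y where "A x' y" "r x' y = k" by blast
      then show ?thesis using f_eq[of x' y] by auto
    qed
    obtain \<delta> where \<delta>: "\<delta> > 0" "\<forall>y\<in>{y. A x y}. \<forall>y'\<in>{y. A x y}. y \<noteq> y' \<longrightarrow> 2 * \<delta> \<le> \<bar>y - y'\<bar>"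
      using finite_gap[OF fin[of x]] by blast
    have "\<exists>\<epsilon>>0. \<forall>k<m. \<forall>x'. \<bar>x' - x\<bar> < \<epsilon> \<longrightarrow> \<bar>f k x' - f k x\<bar> < \<delta>"
      using I'(3) x \<delta>(1) unfolding cont1_def by (intro finite_eps) blast
    then obtain \<epsilon> where \<epsilon>: "\<epsilon> > 0" "\<And>k x'. k < m \<Longrightarrow> \<bar>x' - x\<bar> < \<epsilon> \<Longrightarrow> \<bar>f k x' - f k x\<bar> < \<delta>" by blast
    obtain a b where ab: "a < b" "I1 = {a<..<b}" using I1(1) by (auto simp: oint_def)
    have xI: "x \<in> I1" using x I'(2) by blast
    define \<epsilon>' where "\<epsilon>' = min \<epsilon> (min (x - a) (b - x))"
    have \<epsilon>': "\<epsilon>' > 0" using \<epsilon>(1) xI ab by (auto simp: \<epsilon>'_def)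
    have near: "x' \<in> I1" "\<bar>x' - x\<bar> < \<epsilon>" if "\<bar>x' - x\<bar> < \<epsilon>'" for x'
      using that ab by (auto simp: \<epsilon>'_def abs_less_iff algebra_simps)
    have "gd x \<epsilon>' \<delta>" unfolding gd_def
    proof (intro conjI allI impI \<epsilon>' \<delta>(1))
      fix y y' assume "A x y \<and> A x y' \<and> y \<noteq> y'"
      then show "2 * \<delta> \<le> \<bar>y - y'\<bar>" using \<delta>(2) by simp
    next
      fix x' y assume x': "\<bar>x' - x\<bar> < \<epsilon>'" and "A x y"
      then obtain k where k: "k < m" "f k x = y" using rank[OF xI] by blast
      then show "\<exists>z. A x' z \<and> \<bar>y - z\<bar> < \<delta>"
        using Af[OF near(1)[OF x'] k(1)] \<epsilon>(2)[OF k(1) near(2)[OF x']]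
        by (intro exI[of _ "f k x'"]) (auto simp: abs_minus_commute)
    next
      fix x' z assume x': "\<bar>x' - x\<bar> < \<epsilon>'" and "A x' z"
      then obtain k where k: "k < m" "f k x' = z" using rank[OF near(1)[OF x']] by blast
      then show "\<exists>y. A x y \<and> \<bar>y - z\<bar> < \<delta>"
        using Af[OF xI k(1)] \<epsilon>(2)[OF k(1) near(2)[OF x']]
        by (intro exI[of _ "f k x"]) (auto simp: abs_minus_commute)
    next
      fix x' y z z' assume x': "\<bar>x' - x\<bar> < \<epsilon>'"
        and a: "A x y \<and> A x' z \<and> A x' z' \<and> \<bar>y - z\<bar> < \<delta> \<and> \<bar>y - z'\<bar> < \<delta>"
      \<comment> \<open>If a point of branch k over x' is matched with y, then the branch passes
        through y over x, as different points over x are at least 2 \<delta> apart. Two points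
        matched with y therefore lie on the same branch.\<close>
      have fy: "f k x = y" if k: "k < m" "\<bar>y - f k x'\<bar> < \<delta>" for k
      proof (rule ccontr)
        assume "f k x \<noteq> y"
        then have "2 * \<delta> \<le> \<bar>f k x - y\<bar>" using \<delta>(2) a Af[OF xI k(1)] by simp
        then show False using k(2) \<epsilon>(2)[OF k(1) near(2)[OF x']] by linarith
      qed
      have az: "A x' z" "A x' z'" using a by simp_all
      obtain k where k: "k < m" "f k x' = z" using rank[OF near(1)[OF x'] az(1)] by blast
      obtain k' where k': "k' < m" "f k' x' = z'" using rank[OF near(1)[OF x'] az(2)] by blast
      have "f k x = y" "f k' x = y" using fy[OF k(1)] fy[OF k'(1)] k(2) k'(2) a by simp_all
      then have "f k x = f k' x" by simp
      then have "k = k'" using Af[OF xI k(1)] Af[OF xI k'(1)] by metis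
      then show "z = z'" using k(2) k'(2) by simp
    qed
    then have "good x" unfolding good_def by blast
    then show ?thesis using xI I1(2) by blast
  qed
  define Bad where "Bad = {x. \<not> good x}"
  have "finite {x. \<not> good x}"
  proof (rule ccontr)
    assume inf: "infinite {x. \<not> good x}"
    have "dpred (\<lambda>e. \<not> good (e 0))" by (rule dpred_not[OF dgood])
    from infinite_oint[OF this inf] obtain I where "oint I" "\<And>x. x \<in> I \<Longrightarrow> \<not> good x" by blast
    then show False using good_dense by blast
  qed
  then have finB: "finite Bad" by (simp add: Bad_def)
  \<comment> \<open>A connectedness argument at the infimum of the points where c differs from
    \<open>c a\<close>. Since \<open>c a\<close> is a fixed number, differing from it is a definable
    condition on x.\<close>
  have const: "c b = c a" if ab: "a < b" "\<And>x. a \<le> x \<Longrightarrow> x \<le> b \<Longrightarrow> good x" for a b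
  proof (rule ccontr)
    assume neq: "c b \<noteq> c a"
    let ?P = "\<lambda>x. a \<le> x \<and> x \<le> b \<and> \<not> c x = c a"
    have "dpred (\<lambda>e. ?P (e 0))"
      unfolding c_def by (intro dpred_intros dpred_card_eq[OF A fin])
    moreover have "?P b" using ab(1) neq by simp
    ultimately obtain m where m: "\<And>x. ?P x \<Longrightarrow> m \<le> x" "\<And>y. m < y \<Longrightarrow> \<exists>x. ?P x \<and> x < y"
      using inf_exists[of ?P b a] by blast
    have "m \<le> b" using m(1)[OF \<open>?P b\<close>] .
    moreover have "a \<le> m"
    proof (rule ccontr)
      assume "\<not> a \<le> m"
      then obtain x where "?P x" "x < a" using m(2)[of a] by auto
      then show False by simp
    qed
    ultimately obtain \<epsilon> where \<epsilon>: "\<epsilon> > 0" "\<And>x'. \<bar>x' - m\<bar> < \<epsilon> \<Longrightarrow> c x' = c m"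
      using good_c ab(2) by blast
    show False
    proof (cases "c m = c a")
      case True
      obtain x where x: "?P x" "x < m + \<epsilon>" using m(2)[of "m + \<epsilon>"] \<epsilon>(1) by auto
      then have "c x = c m" using m(1)[OF x(1)] by (intro \<epsilon>(2)) auto
      then show False using True x by simp
    next
      case False
      then have "a < m" using \<open>a \<le> m\<close> by (cases "a = m") auto
      then obtain x where x: "max a (m - \<epsilon>) < x" "x < m"
        using dense_order_class.dense[of "max a (m - \<epsilon>)" m] \<epsilon>(1) by auto
      then have "c x = c m" by (intro \<epsilon>(2)) auto
      then have "?P x" using False x \<open>m \<le> b\<close> by auto
      then show False using m(1)[of x] x by auto
    qed
  qed
  \<comment> \<open>Between two good points with the same bad points below them there is no bad
    point. Hence off \<open>Bad\<close> the function c takes at most one value for each subset of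
    \<open>Bad\<close>.\<close>
  define g where "g x = Bad \<inter> {..<x}" for x
  have cg: "c x = c x'" if "x \<notin> Bad" "x' \<notin> Bad" "g x = g x'" for x x'
    using that
  proof (induction x x' rule: linorder_wlog)
    case (le x x')
    show ?case
    proof (cases "x = x'")
      case False
      have "good z" if "x \<le> z" "z \<le> x'" for z
      proof (rule ccontr)
        assume "\<not> good z"
        then have z: "z \<in> Bad" by (simp add: Bad_def)
        then have "z \<noteq> x'" using le(3) by blast
        then have "z \<in> g x'" using z that by (simp add: g_def)
        then have "z \<in> g x" by (simp only: le(4))
        then show False using that by (simp add: g_def)
      qed
      moreover have "x < x'" using le(1) False by simp
      ultimately show ?thesis using const[of x x'] by simp
    qed simp
  qed (simp add: eq_commute)
  have "finite (c ` (- Bad))"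
  proof -
    define h where "h s = c (SOME x. x \<notin> Bad \<and> g x = s)" for s
    have "c x = h (g x)" if "x \<notin> Bad" for x
      unfolding h_def using someI[of "\<lambda>z. z \<notin> Bad \<and> g z = g x" x] that by (intro cg) auto
    then have "c ` (- Bad) \<subseteq> h ` Pow Bad" by (auto simp: g_def)
    then show ?thesis using finB finite_subset by blast
  qed
  then have "finite (c ` Bad \<union> c ` (- Bad))" using finB by simp
  then have "finite (range c)" by (simp add: image_Un[symmetric])
  then obtain N where "\<forall>k\<in>range c. k \<le> N" using finite_nat_set_iff_bounded_le by blast
  then show ?thesis unfolding c_def by blast
qed

text \<open>A finite-to-one h is made injective one coordinate at a time, by adding the rank of
  \<open>x j\<close> among the finitely many j-th coordinates that occur over the value
  \<open>h x\<close>. Uniform finiteness bounds these ranks, which keeps the new function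
  definable.\<close>

lemma thin_injection:
  assumes X: "definable M n X" and "thin n X"
  obtains h where "dfunc (\<lambda>e. h (restr n e))" "inj_on h X" "\<And>x. \<bar>h x\<bar> < 1"
proof -
  have Xt: "X \<subseteq> tuples n" by (rule definable_subset_tuples[OF X])
  have iter: "\<exists>h. dfunc (\<lambda>e. h (restr n e)) \<and> (\<forall>c. finite {x \<in> X. h x = c}) \<and>
      (\<forall>x\<in>X. \<forall>x'\<in>X. h x = h x' \<longrightarrow> (\<forall>i<j. x i = x' i))" if "j \<le> n" for j
    using that
  proof (induction j)
    case 0
    then show ?case using assms(2) by (auto simp: thin_def)
  next
    case (Suc j)
    then obtain h where h: "dfunc (\<lambda>e. h (restr n e))" "\<And>c. finite {x \<in> X. h x = c}"
      "\<And>x x'. x \<in> X \<Longrightarrow> x' \<in> X \<Longrightarrow> h x = h x' \<Longrightarrow> \<forall>i<j. x i = x' i" by auto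
    have j: "j < n" using Suc.prems by simp
    define A where "A c y \<longleftrightarrow> (\<exists>x\<in>tuples n. x \<in> X \<and> h x = c \<and> x j = y)" for c y
    have A: "dpred (\<lambda>e. A (e 0) (e (Suc 0)))" unfolding A_def
    proof (rule dpred_ex_tuple)
      show "dpred (\<lambda>e. restr n e \<in> X \<and> h (restr n e) = e (0 + n) \<and> restr n e j = e (Suc 0 + n))"
        unfolding restr_apply[OF j] by (intro dpred_conj dpred_restr_mem[OF X] dpred_eq h(1) dfunc_var)
    qed
    have fin: "finite {y. A c y}" for c
      by (rule finite_subset[OF _ finite_imageI[OF h(2)[of c], of "\<lambda>x. x j"]]) (auto simp: A_def)
    obtain N where N: "\<And>c. card {y. A c y} \<le> N" using uniform_finiteness[OF A fin] by blast
    define r where "r c y = card {z. A c z \<and> z < y}" for c y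
    \<comment> \<open>The rank r as a sum of N indicators, of which exactly those with k < r are 1;
      the uniform bound N makes the sum finite and thus definable.\<close>
    define s where "s c y = (\<Sum>k<N. if below A (Suc k) c y then 1 else 0 :: 'a)" for c y
    have s: "s c y = of_nat (r c y)" if "A c y" for c y
    proof -
      have "r c y \<in> {..<card {y. A c y}}"
        using card_below_image[of A c, OF fin] that by (auto simp: r_def)
      then have "r c y \<le> N" using N[of c] by simp
      then have "{k. k < N \<and> below A (Suc k) c y} = {..<r c y}"
        using below_iff[of A c, OF fin] that by (auto simp: r_def simp del: below.simps)
      moreover have "s c y = of_nat (card {k. k < N \<and> below A (Suc k) c y})"
        unfolding s_def by (simp add: sum.If_cases Int_def del: below.simps)
      ultimately show ?thesis by simp
    qed
    \<comment> \<open>Two values of \<open>squash\<close> differ by less than 2, so the even integer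
      added can be recovered, and with it both \<open>h x\<close> and the rank.\<close>
    define h' where "h' x = squash (h x) + 2 * s (h x) (x j)" for x
    have inj: "h x = h x' \<and> x j = x' j" if x: "x \<in> X" "x' \<in> X" "h' x = h' x'" for x x'
    proof -
      have Ax: "A (h x) (x j)" "A (h x') (x' j)" using x Xt by (auto simp: A_def)
      let ?r = "of_nat (r (h x) (x j)) :: 'a" and ?r' = "of_nat (r (h x') (x' j)) :: 'a"
      have eq: "squash (h x) + 2 * ?r = squash (h x') + 2 * ?r'"
        using x(3) by (simp add: h'_def s Ax)
      have "\<bar>?r - ?r'\<bar> < 1"
        using eq abs_squash_less[of "h x"] abs_squash_less[of "h x'"] by linarith
      then have "?r < ?r' + 1" "?r' < ?r + 1" by linarith+
      then have "of_nat (r (h x) (x j)) < (of_nat (Suc (r (h x') (x' j))) :: 'a)"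
        "of_nat (r (h x') (x' j)) < (of_nat (Suc (r (h x) (x j))) :: 'a)" by simp_all
      then have r: "r (h x) (x j) = r (h x') (x' j)" unfolding of_nat_less_iff by simp
      then have hx: "h x = h x'" using eq by (simp add: squash_inj)
      then show ?thesis using card_below_inj[of A "h x", OF fin] Ax r by (auto simp: r_def)
    qed
    have "dfunc (\<lambda>e. h' (restr n e))"
      unfolding h'_def s_def squash_def restr_apply[OF j]
      by (intro dpred_intros h(1) dfunc_sum dpred2[OF dpred_below[OF A]])
    moreover have "finite {x \<in> X. h' x = c}" for c
    proof (cases "\<exists>x\<in>X. h' x = c")
      case True
      then obtain x where x: "x \<in> X" "h' x = c" by blast
      have "{z \<in> X. h' z = c} \<subseteq> {z \<in> X. h z = h x}"
      proof
        fix z assume "z \<in> {z \<in> X. h' z = c}"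
        then have "z \<in> X" "h' z = h' x" using x by simp_all
        then show "z \<in> {z \<in> X. h z = h x}" using inj[OF _ x(1)] by blast
      qed
      then show ?thesis by (rule finite_subset) (rule h(2))
    next
      case False
      then have "{x \<in> X. h' x = c} = {}" by blast
      then show ?thesis by (simp only: finite.emptyI)
    qed
    moreover have "\<forall>i<Suc j. x i = x' i" if "x \<in> X" "x' \<in> X" "h' x = h' x'" for x x'
      using inj[OF that] h(3)[OF that(1,2)] by (auto simp: less_Suc_eq)
    ultimately show ?case by blast
  qed
  obtain h where h: "dfunc (\<lambda>e. h (restr n e))"
    "\<forall>x\<in>X. \<forall>x'\<in>X. h x = h x' \<longrightarrow> (\<forall>i<n. x i = x' i)"
    using iter[OF order_refl] by (elim exE conjE)
  have "inj_on (\<lambda>x. squash (h x)) X"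
  proof (rule inj_onI)
    fix x x' assume x: "x \<in> X" "x' \<in> X" "squash (h x) = squash (h x')"
    then have "\<forall>i<n. x i = x' i" using h(2) by (simp add: squash_inj)
    moreover have "x i = x' i" if "n \<le> i" for i
      using subsetD[OF Xt x(1)] subsetD[OF Xt x(2)] that by (simp add: tuples_iff)
    ultimately show "x = x'" by (meson ext not_le)
  qed
  moreover have "dfunc (\<lambda>e. squash (h (restr n e)))"
    unfolding squash_def by (intro dpred_intros h(1))
  ultimately show ?thesis using abs_squash_less by (intro that) auto
qed

end

section \<open>Limits of germs\<close>

definition mball :: "'b set \<Rightarrow> ('b \<Rightarrow> 'b \<Rightarrow> 'a::linordered_field) \<Rightarrow> 'b \<Rightarrow> 'a \<Rightarrow> 'b set" where
  "mball X d y r = {z \<in> X. d y z < r}"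

text \<open>Convergence of the germ of points just to the right of x. The base point x need not
  belong to X, and the limit y may be far from x on the line.\<close>

definition rlim :: "'a::linordered_field set \<Rightarrow> ('a \<Rightarrow> 'a \<Rightarrow> 'a) \<Rightarrow> 'a \<Rightarrow> 'a \<Rightarrow> bool" where
  "rlim X d x y \<longleftrightarrow> y \<in> X \<and> (\<forall>r>0. \<exists>b>x. \<forall>z. x < z \<and> z < b \<longrightarrow> z \<in> mball X d y r)"

definition llim :: "'a::linordered_field set \<Rightarrow> ('a \<Rightarrow> 'a \<Rightarrow> 'a) \<Rightarrow> 'a \<Rightarrow> 'a \<Rightarrow> bool" where
  "llim X d x y \<longleftrightarrow> y \<in> X \<and> (\<forall>r>0. \<exists>b<x. \<forall>z. b < z \<and> z < x \<longrightarrow> z \<in> mball X d y r)"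

locale line_space = omin_field M D
  for M :: "('f, 'r, 'a::linordered_field) fo_structure" and D +
  fixes X :: "'a set" and d :: "'a \<Rightarrow> 'a \<Rightarrow> 'a"
  assumes metric: "R_metric X d"
    and bounded: "x \<in> X \<Longrightarrow> \<bar>x\<bar> < 1"
    and dpred_X: "dpred (\<lambda>e. e 0 \<in> X)"
    and basis: "y \<in> X \<Longrightarrow> 0 < r \<Longrightarrow>
      \<exists>B s. dpred (\<lambda>e. e 0 \<in> B) \<and> 0 < s \<and> mball X d y s \<subseteq> B \<and> B \<subseteq> mball X d y r"
    and dpred_rlim: "dpred (\<lambda>e. rlim X d (e 0) (e (Suc 0)))"
    and dpred_llim: "dpred (\<lambda>e. llim X d (e 0) (e (Suc 0)))"
    and dpred_meets: "y \<in> X \<Longrightarrow> dpred (\<lambda>e. e 0 \<in> Z) \<Longrightarrow>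
      dpred (\<lambda>e. \<forall>r>0. \<exists>z. z \<in> mball X d y r \<and> z \<in> Z \<and> z < e 0)"
begin

abbreviation "B \<equiv> mball X d"
abbreviation "RL \<equiv> rlim X d"
abbreviation "LL \<equiv> llim X d"

section \<open>Balls and uniqueness of limits\<close>

lemma d_sym: "x \<in> X \<Longrightarrow> y \<in> X \<Longrightarrow> d x y = d y x"
  and d_zero: "x \<in> X \<Longrightarrow> y \<in> X \<Longrightarrow> d x y = 0 \<longleftrightarrow> x = y"
  and d_nonneg: "x \<in> X \<Longrightarrow> y \<in> X \<Longrightarrow> 0 \<le> d x y"
  and d_triangle: "x \<in> X \<Longrightarrow> y \<in> X \<Longrightarrow> z \<in> X \<Longrightarrow> d x z \<le> d x y + d y z"
  using metric unfolding R_metric_def by blast+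

lemma ball_mono: "r \<le> s \<Longrightarrow> B y r \<subseteq> B y s"
  by (auto simp: mball_def)

lemma RL_X: "RL x y \<Longrightarrow> y \<in> X" and LL_X: "LL x y \<Longrightarrow> y \<in> X"
  by (simp_all add: rlim_def llim_def)

lemma RL_near:
  assumes "RL x y" "0 < r" obtains b where "x < b" "\<And>z. x < z \<Longrightarrow> z < b \<Longrightarrow> z \<in> B y r"
proof -
  have "\<exists>b>x. \<forall>z. x < z \<and> z < b \<longrightarrow> z \<in> B y r" using assms unfolding rlim_def by blast
  then show ?thesis using that by blast
qed

lemma LL_near:
  assumes "LL x y" "0 < r" obtains b where "b < x" "\<And>z. b < z \<Longrightarrow> z < x \<Longrightarrow> z \<in> B y r"
proof -
  have "\<exists>b<x. \<forall>z. b < z \<and> z < x \<longrightarrow> z \<in> B y r" using assms unfolding llim_def by blast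
  then show ?thesis using that by blast
qed

lemma close_balls_eq:
  assumes "y \<in> X" "y' \<in> X" "\<And>r. 0 < r \<Longrightarrow> \<exists>z. z \<in> B y r \<and> z \<in> B y' r" shows "y = y'"
proof (rule ccontr)
  assume "y \<noteq> y'"
  then have "0 < d y y'" using d_nonneg[OF assms(1,2)] d_zero[OF assms(1,2)] by auto
  then obtain z where z: "z \<in> X" "d y z < d y y' / 2" "d y' z < d y y' / 2"
    using assms(3)[of "d y y' / 2"] by (auto simp: mball_def)
  then show False using d_triangle[OF assms(1) z(1) assms(2)] d_sym[OF z(1) assms(2)] by simp
qed

lemma RL_unique:
  assumes "RL x y" "RL x y'" shows "y = y'"
proof (rule close_balls_eq[OF RL_X[OF assms(1)] RL_X[OF assms(2)]])
  fix r :: 'a assume r: "0 < r"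
  obtain b where b: "x < b" "\<And>z. x < z \<Longrightarrow> z < b \<Longrightarrow> z \<in> B y r" using RL_near[OF assms(1) r] by blast
  obtain c where c: "x < c" "\<And>z. x < z \<Longrightarrow> z < c \<Longrightarrow> z \<in> B y' r" using RL_near[OF assms(2) r] by blast
  obtain z where "x < z" "z < min b c" using dense_order_class.dense[of x "min b c"] b c by auto
  then show "\<exists>z. z \<in> B y r \<and> z \<in> B y' r" using b c by auto
qed

lemma LL_unique:
  assumes "LL x y" "LL x y'" shows "y = y'"
proof (rule close_balls_eq[OF LL_X[OF assms(1)] LL_X[OF assms(2)]])
  fix r :: 'a assume r: "0 < r"
  obtain b where b: "b < x" "\<And>z. b < z \<Longrightarrow> z < x \<Longrightarrow> z \<in> B y r" using LL_near[OF assms(1) r] by blast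
  obtain c where c: "c < x" "\<And>z. c < z \<Longrightarrow> z < x \<Longrightarrow> z \<in> B y' r" using LL_near[OF assms(2) r] by blast
  obtain z where "max b c < z" "z < x" using dense_order_class.dense[of "max b c" x] b c by auto
  then show "\<exists>z. z \<in> B y r \<and> z \<in> B y' r" using b c by auto
qed

lemma RL_meets_oint:
  assumes "RL x y" "oint I" "x \<in> I" "0 < r" shows "\<exists>z\<in>I. z \<in> B y r"
proof -
  obtain b where b: "x < b" "\<And>z. x < z \<Longrightarrow> z < b \<Longrightarrow> z \<in> B y r" using RL_near[OF assms(1,4)] by blast
  obtain p q where I: "I = {p<..<q}" using assms(2) by (auto simp: oint_def)
  obtain z where "x < z" "z < min b q" using dense_order_class.dense[of x "min b q"] b assms(3) I by auto
  then show ?thesis using b(2)[of z] assms(3) I by (intro bexI[of _ z]) auto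
qed

lemma LL_meets_oint:
  assumes "LL x y" "oint I" "x \<in> I" "0 < r" shows "\<exists>z\<in>I. z \<in> B y r"
proof -
  obtain b where b: "b < x" "\<And>z. b < z \<Longrightarrow> z < x \<Longrightarrow> z \<in> B y r" using LL_near[OF assms(1,4)] by blast
  obtain p q where I: "I = {p<..<q}" using assms(2) by (auto simp: oint_def)
  obtain z where "max b p < z" "z < x" using dense_order_class.dense[of "max b p" x] b assms(3) I by auto
  then show ?thesis using b(2)[of z] assms(3) I by (intro bexI[of _ z]) auto
qed

text \<open>Otherwise \<open>y\<close> would have a definable neighbourhood base of fewer than \<open>|R|\<close> sets, each
  cofinite in a fixed interval, whose intersection is a point.\<close>

lemma finite_sources:
  assumes y: "y \<in> X" and P: "dpred (\<lambda>e. P (e 0))"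
    and near: "\<And>x I r. P x \<Longrightarrow> oint I \<Longrightarrow> x \<in> I \<Longrightarrow> 0 < r \<Longrightarrow> \<exists>z\<in>I. z \<in> B y r"
  shows "finite {x. P x}"
proof (rule ccontr)
  assume "infinite {x. P x}"
  from infinite_oint[OF P this] obtain I where I: "oint I" "\<And>x. x \<in> I \<Longrightarrow> P x" by blast
  \<comment> \<open>The head of the list is a radius from \<open>D\<close> that keeps x out of the
    ball around y. Positivity is part of the condition because l runs through all lists.\<close>
  define W where "W l x \<longleftrightarrow> x = y \<or> (0 < hd l \<and> x \<notin> B y (hd l))" for l :: "'a list" and x
  have "\<exists>l\<in>lists D. W l x" if "x \<in> I" for x
  proof -
    obtain q where q: "q \<in> D" "0 < q" "x \<in> X \<Longrightarrow> x \<noteq> y \<Longrightarrow> q < d y x"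
    proof (cases "x \<in> X \<and> x \<noteq> y")
      case True
      then have "0 < d y x" using d_nonneg[OF y, of x] d_zero[OF y, of x] by auto
      then show ?thesis using dense[of 0 "d y x"] that by blast
    next
      case False
      then show ?thesis using dense[of 0 1] that by auto
    qed
    then show ?thesis by (intro bexI[of _ "[q]"]) (auto simp: W_def mball_def)
  qed
  then obtain l where l: "infinite {x\<in>I. W l x}" using pigeonhole_infinite[OF I(1), of W] by blast
  have r: "0 < hd l"
  proof (rule ccontr)
    assume "\<not> 0 < hd l"
    then have "{x\<in>I. W l x} \<subseteq> {y}" by (auto simp: W_def)
    then show False using l finite_subset by blast
  qed
  \<comment> \<open>Lying outside the ball is weakened to lying outside the definable set C.
    O-minimality yields an interval that misses C and so the smaller ball \<open>B y s\<close>,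
    which by \<open>near\<close> it has to meet.\<close>
  obtain C s where C: "dpred (\<lambda>e. e 0 \<in> C)" "0 < s" "B y s \<subseteq> C" "C \<subseteq> B y (hd l)"
    using basis[OF y r] by blast
  have "{x\<in>I. W l x} \<subseteq> insert y {x\<in>I. x \<notin> C}" using C(4) by (auto simp: W_def)
  then have "infinite {x\<in>I. x \<notin> C}" using l finite_subset by (metis finite_insert)
  from oint_infinite_sub[OF dpred_not[OF C(1)] I(1) this] obtain I' where
    I': "oint I'" "I' \<subseteq> I" "\<And>x. x \<in> I' \<Longrightarrow> x \<notin> C" by blast
  obtain x where "x \<in> I'" using oint_nonempty[OF I'(1)] by blast
  then show False using near[OF I(2) I'(1) _ C(2), of x] I' C(3) by blast
qed

lemma finite_RL: "finite {x. RL x y}"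
proof (cases "y \<in> X")
  case True
  have "dpred (\<lambda>e. RL (e 0) y)" by (intro dpred2[OF dpred_rlim] dpred_intros)
  then show ?thesis by (rule finite_sources[OF True]) (rule RL_meets_oint)
next
  case False
  then have "{x. RL x y} = {}" using RL_X by blast
  then show ?thesis by (simp only: finite.emptyI)
qed

lemma finite_LL: "finite {x. LL x y}"
proof (cases "y \<in> X")
  case True
  have "dpred (\<lambda>e. LL (e 0) y)" by (intro dpred2[OF dpred_llim] dpred_intros)
  then show ?thesis by (rule finite_sources[OF True]) (rule LL_meets_oint)
next
  case False
  then have "{x. LL x y} = {}" using LL_X by blast
  then show ?thesis by (simp only: finite.emptyI)
qed

text \<open>The point y with pieces of length \<epsilon> of all germs that converge to it. These
  sets are definable uniformly in \<epsilon> and y, and turn out to be cofinal with the balls around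
  y.\<close>

definition nbd :: "'a \<Rightarrow> 'a \<Rightarrow> 'a set" where
  "nbd \<epsilon> y = {z. z = y \<or> (\<exists>x. RL x y \<and> x < z \<and> z < x + \<epsilon>) \<or> (\<exists>x. LL x y \<and> x - \<epsilon> < z \<and> z < x)}"

lemma finite_uniform:
  assumes "finite S" "\<And>x. x \<in> S \<Longrightarrow> \<exists>\<epsilon>>0. Q \<epsilon> x" "\<And>x \<epsilon> \<epsilon>'. Q \<epsilon> x \<Longrightarrow> \<epsilon>' \<le> \<epsilon> \<Longrightarrow> Q \<epsilon>' x"
  shows "\<exists>\<epsilon>>(0::'a). \<forall>x\<in>S. Q \<epsilon> x"
  using assms(1,2)
proof (induction S)
  case empty then show ?case by (intro exI[of _ 1]) simp
next
  case (insert x S)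
  then obtain e f where "e > 0" "\<forall>x\<in>S. Q e x" "f > 0" "Q f x" by blast
  then show ?case using assms(3) by (intro exI[of _ "min e f"]) auto
qed

text \<open>Only finitely many germs converge to y, so a single \<epsilon> serves them all.\<close>

lemma nbd_subset_ball:
  assumes y: "y \<in> X" and r: "0 < r" shows "\<exists>\<epsilon>>0. nbd \<epsilon> y \<subseteq> B y r"
proof -
  have "\<exists>\<epsilon>>0. \<forall>x\<in>{x. RL x y}. \<forall>z. x < z \<and> z < x + \<epsilon> \<longrightarrow> z \<in> B y r"
  proof (rule finite_uniform[OF finite_RL])
    fix x assume "x \<in> {x. RL x y}"
    then obtain b where "x < b" "\<And>z. x < z \<Longrightarrow> z < b \<Longrightarrow> z \<in> B y r" using RL_near[OF _ r] by blast
    then show "\<exists>\<epsilon>>0. \<forall>z. x < z \<and> z < x + \<epsilon> \<longrightarrow> z \<in> B y r" by (intro exI[of _ "b - x"]) auto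
  qed (meson add_left_mono less_le_trans)
  then obtain e where e: "e > 0" "\<And>x z. RL x y \<Longrightarrow> x < z \<Longrightarrow> z < x + e \<Longrightarrow> z \<in> B y r" by blast
  have "\<exists>\<epsilon>>0. \<forall>x\<in>{x. LL x y}. \<forall>z. x - \<epsilon> < z \<and> z < x \<longrightarrow> z \<in> B y r"
  proof (rule finite_uniform[OF finite_LL])
    fix x assume "x \<in> {x. LL x y}"
    then obtain b where "b < x" "\<And>z. b < z \<Longrightarrow> z < x \<Longrightarrow> z \<in> B y r" using LL_near[OF _ r] by blast
    then show "\<exists>\<epsilon>>0. \<forall>z. x - \<epsilon> < z \<and> z < x \<longrightarrow> z \<in> B y r" by (intro exI[of _ "x - b"]) auto
  qed (meson diff_left_mono le_less_trans)
  then obtain f where f: "f > 0" "\<And>x z. LL x y \<Longrightarrow> x - f < z \<Longrightarrow> z < x \<Longrightarrow> z \<in> B y r" by blast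
  have "z \<in> B y r" if "z \<in> nbd (min e f) y" for z
  proof -
    have "y \<in> B y r" using y r d_zero[OF y y] by (simp add: mball_def)
    then show ?thesis using that unfolding nbd_def
      using e(2)[of _ z] f(2)[of _ z] by (auto simp: min_def split: if_splits)
  qed
  then show ?thesis using e(1) f(1) by (intro exI[of _ "min e f"]) auto
qed

lemma dpred_nbd:
  assumes "dfunc s" "dfunc t" "dfunc u" shows "dpred (\<lambda>e. s e \<in> nbd (t e) (u e))"
proof -
  have "dpred (\<lambda>e. e 0 \<in> nbd (e (Suc 0)) (e (Suc (Suc 0))))"
    unfolding nbd_def mem_Collect_eq
    by (intro dpred_intros dpred2[OF dpred_rlim] dpred2[OF dpred_llim])
  from dpred3[of "\<lambda>a b c. a \<in> nbd b c", OF this assms] show ?thesis .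
qed

text \<open>If \<open>y\<close> were in the closure of the complement \<open>Z\<close> of \<open>nbd \<epsilon> y\<close>, then at the infimum \<open>x0\<close> of the
  \<open>x\<close> such that \<open>Z\<close> has points below \<open>x\<close> arbitrarily close to \<open>y\<close> one of the two germs of \<open>x0\<close>
  would lie in \<open>Z\<close> and converge to \<open>y\<close>.\<close>

lemma ball_subset_nbd:
  assumes y: "y \<in> X" and \<epsilon>: "0 < \<epsilon>" shows "\<exists>r>0. B y r \<subseteq> nbd \<epsilon> y"
proof (rule ccontr)
  assume neg: "\<not> ?thesis"
  define Z where "Z = X - nbd \<epsilon> y"
  have Z: "dpred (\<lambda>e. e 0 \<in> Z)"
    unfolding Z_def Diff_iff by (intro dpred_intros dpred_X dpred_nbd)
  have meet: "\<exists>z. z \<in> B y r \<and> z \<in> Z" if "0 < r" for r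
  proof -
    have "\<not> B y r \<subseteq> nbd \<epsilon> y" using neg that by blast
    then show ?thesis by (auto simp: Z_def mball_def)
  qed
  have yZ: "y \<notin> Z" by (simp add: Z_def nbd_def)
  let ?H = "\<lambda>x. \<forall>r>0. \<exists>z. z \<in> B y r \<and> z \<in> Z \<and> z < x"
  have "?H 1"
  proof (intro allI impI)
    fix r :: 'a assume "0 < r"
    then obtain z where z: "z \<in> B y r" "z \<in> Z" using meet by blast
    then have "z < 1" using bounded[of z] by (auto simp: mball_def abs_less_iff)
    then show "\<exists>z. z \<in> B y r \<and> z \<in> Z \<and> z < 1" using z by blast
  qed
  moreover have "-1 \<le> x" if Hx: "?H x" for x
  proof -
    obtain z where z: "z \<in> B y 1" "z < x" using Hx zero_less_one by blast
    then have "-1 < z" using bounded[of z] by (auto simp: mball_def abs_less_iff)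
    then show ?thesis using z by simp
  qed
  ultimately obtain x0 where x0: "\<And>x. ?H x \<Longrightarrow> x0 \<le> x" "\<And>x. x0 < x \<Longrightarrow> \<exists>x'. ?H x' \<and> x' < x"
    using inf_exists[OF dpred_meets[OF y Z], of 1 "-1"] by blast
  \<comment> \<open>A radius that rules out \<open>x0\<close> itself; it exists because
    \<open>x0\<close> differs from y if it lies in Z.\<close>
  obtain r0 where r0: "0 < r0" "x0 \<in> Z \<Longrightarrow> x0 \<notin> B y r0"
  proof (cases "x0 \<in> Z")
    case True
    then have "x0 \<in> X" "x0 \<noteq> y" using yZ by (auto simp: Z_def)
    then have "0 < d y x0" using d_nonneg[OF y, of x0] d_zero[OF y, of x0] by auto
    then show ?thesis by (intro that[of "d y x0"]) (auto simp: mball_def)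
  next
    case False then show ?thesis by (intro that[of 1]) auto
  qed
  \<comment> \<open>As the condition fails at a' < \<open>x0\<close>, points of Z close enough to y
    are not left of a'; as it holds somewhere below b, some of them are left of b.\<close>
  have two: "\<exists>z. z \<in> B y r \<and> z \<in> Z \<and> a < z \<and> z < b \<and> z \<noteq> x0" if ab: "a < x0" "x0 < b" "0 < r" for a b r
  proof -
    obtain a' where a': "a < a'" "a' < x0" using dense_order_class.dense[OF ab(1)] by blast
    then have "\<not> ?H a'" using x0(1)[of a'] by auto
    then obtain s where s: "0 < s" "\<And>z. z \<in> B y s \<Longrightarrow> z \<in> Z \<Longrightarrow> a' \<le> z" by (auto simp: not_less)
    obtain x' where x': "?H x'" "x' < b" using x0(2)[OF ab(2)] by blast
    define m where "m = min r (min s r0)"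
    have "0 < m" using ab s r0 by (simp add: m_def)
    then obtain z where z: "z \<in> B y m" "z \<in> Z" "z < x'" using x'(1) by blast
    then have "z \<in> B y r" "z \<in> B y s" "z \<in> B y r0" by (auto simp: mball_def m_def)
    moreover have "a < z" using a'(1) s(2)[OF \<open>z \<in> B y s\<close> z(2)] by simp
    moreover have "z < b" using z(3) x'(2) by simp
    ultimately show ?thesis using z(2) r0(2) by (intro exI[of _ z]) auto
  qed
  have "(\<forall>b>x0. \<forall>r>0. \<exists>z. z \<in> B y r \<and> z \<in> Z \<and> x0 < z \<and> z < b) \<or>
      (\<forall>a<x0. \<forall>r>0. \<exists>z. z \<in> B y r \<and> z \<in> Z \<and> a < z \<and> z < x0)"
  proof (rule ccontr)
    assume "\<not> ?thesis"
    then obtain b r a s where b: "x0 < b" "0 < r" "\<And>z. z \<in> B y r \<Longrightarrow> z \<in> Z \<Longrightarrow> x0 < z \<Longrightarrow> z < b \<Longrightarrow> False"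
      and a: "a < x0" "0 < s" "\<And>z. z \<in> B y s \<Longrightarrow> z \<in> Z \<Longrightarrow> a < z \<Longrightarrow> z < x0 \<Longrightarrow> False" by blast
    obtain z where z: "z \<in> B y (min r s)" "z \<in> Z" "a < z" "z < b" "z \<noteq> x0"
      using two[OF a(1) b(1), of "min r s"] a b by auto
    then have "z \<in> B y r" "z \<in> B y s" by (auto simp: mball_def)
    then show False using a(3)[of z] b(3)[of z] z by (cases "z < x0") auto
  qed
  then show False
  proof
    assume right: "\<forall>b>x0. \<forall>r>0. \<exists>z. z \<in> B y r \<and> z \<in> Z \<and> x0 < z \<and> z < b"
    have germ: "\<exists>b>x0. \<forall>z. x0 < z \<and> z < b \<longrightarrow> z \<in> B y r \<and> z \<in> Z" if "0 < r" for r
    proof -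
      obtain C s where C: "dpred (\<lambda>e. e 0 \<in> C)" "0 < s" "B y s \<subseteq> C" "C \<subseteq> B y r"
        using basis[OF y \<open>0 < r\<close>] by blast
      \<comment> \<open>The germ lies either inside or outside the definable set where C and Z meet.
        The assumption \<open>right\<close> excludes the second case, so all of it lies in Z and in
        the ball.\<close>
      obtain b where b: "x0 < b" "(\<forall>z. x0 < z \<and> z < b \<longrightarrow> z \<in> C \<and> z \<in> Z) \<or> (\<forall>z. x0 < z \<and> z < b \<longrightarrow> \<not> (z \<in> C \<and> z \<in> Z))"
        using right_germ[OF dpred_conj[OF C(1) Z], of x0] by blast
      obtain z where "z \<in> B y s" "z \<in> Z" "x0 < z" "z < b" using right b(1) C(2) by blast
      then have "\<forall>z. x0 < z \<and> z < b \<longrightarrow> z \<in> C \<and> z \<in> Z" using b(2) C(3) by blast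
      then show ?thesis using b(1) C(4) by blast
    qed
    then have "RL x0 y" unfolding rlim_def using y by blast
    moreover obtain b where b: "x0 < b" "\<forall>z. x0 < z \<and> z < b \<longrightarrow> z \<in> Z" using germ[of 1] by auto
    obtain z where "x0 < z" "z < min b (x0 + \<epsilon>)" using dense_order_class.dense[of x0 "min b (x0 + \<epsilon>)"] b \<epsilon> by auto
    ultimately show False using b(2) by (auto simp: Z_def nbd_def)
  next
    assume left: "\<forall>a<x0. \<forall>r>0. \<exists>z. z \<in> B y r \<and> z \<in> Z \<and> a < z \<and> z < x0"
    have germ: "\<exists>b<x0. \<forall>z. b < z \<and> z < x0 \<longrightarrow> z \<in> B y r \<and> z \<in> Z" if "0 < r" for r
    proof -
      obtain C s where C: "dpred (\<lambda>e. e 0 \<in> C)" "0 < s" "B y s \<subseteq> C" "C \<subseteq> B y r"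
        using basis[OF y \<open>0 < r\<close>] by blast
      obtain b where b: "b < x0" "(\<forall>z. b < z \<and> z < x0 \<longrightarrow> z \<in> C \<and> z \<in> Z) \<or> (\<forall>z. b < z \<and> z < x0 \<longrightarrow> \<not> (z \<in> C \<and> z \<in> Z))"
        using left_germ[OF dpred_conj[OF C(1) Z], of x0] by blast
      obtain z where "z \<in> B y s" "z \<in> Z" "b < z" "z < x0" using left b(1) C(2) by blast
      then have "\<forall>z. b < z \<and> z < x0 \<longrightarrow> z \<in> C \<and> z \<in> Z" using b(2) C(3) by blast
      then show ?thesis using b(1) C(4) by blast
    qed
    then have "LL x0 y" unfolding llim_def using y by blast
    moreover obtain b where b: "b < x0" "\<forall>z. b < z \<and> z < x0 \<longrightarrow> z \<in> Z" using germ[of 1] by auto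
    obtain z where "max b (x0 - \<epsilon>) < z" "z < x0" using dense_order_class.dense[of "max b (x0 - \<epsilon>)" x0] b \<epsilon> by auto
    ultimately show False using b(2) by (auto simp: Z_def nbd_def)
  qed
qed

text \<open>An infinite P contains an interval, and one \<open>W l\<close> holds infinitely often
  there, in particular at two points. Below, l lists two ends and a radius from \<open>D\<close>
  which no two points can share.\<close>

lemma not_small_family:
  assumes "dpred (\<lambda>e. P (e 0))" "\<And>x. P x \<Longrightarrow> \<exists>l\<in>lists D. W l x"
    and "\<And>l x x'. W l x \<Longrightarrow> W l x' \<Longrightarrow> x < x' \<Longrightarrow> False"
  shows "finite {x. P x}"
proof (rule ccontr)
  assume "infinite {x. P x}"
  from infinite_oint[OF assms(1) this] obtain I where I: "oint I" "\<And>x. x \<in> I \<Longrightarrow> P x" by blast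
  have "\<exists>l\<in>lists D. W l x" if "x \<in> I" for x using assms(2)[OF I(2)[OF that]] .
  from pigeonhole_infinite[OF I(1), of W, OF this] obtain l where "infinite {x\<in>I. W l x}" by blast
  from infinite_two[OF this] show False using assms(3) by blast
qed

text \<open>The way from y' to z through w and y has three steps shorter than r, which explains the
  factor 3 in the conditions below.\<close>

lemma ball_shift:
  assumes "y \<in> X" "y' \<in> X" "w \<in> B y r" "w \<in> B y' r" "z \<in> B y r" shows "z \<in> B y' (3 * r)"
proof -
  have w: "w \<in> X" "z \<in> X" using assms by (auto simp: mball_def)
  have "d y' z \<le> d y' w + (d w y + d y z)"
    using d_triangle[OF assms(2) w(1,2)] d_triangle[OF w(1) assms(1) w(2)] by linarith
  then show ?thesis using assms w d_sym[OF w(1) assms(1)] by (simp add: mball_def)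
qed

text \<open>Suppose x < x' share the ends and the radius r. Points just right of x' are within r of
  both limits y and y'. Points between x and x' are within r of y, hence within 3 r of y', although
  everything left of x' down to the common lower end should avoid that ball.\<close>

lemma finite_right_only: "finite {x. \<exists>y. RL x y \<and> \<not> LL x y}"
proof (rule not_small_family)
  show "dpred (\<lambda>e. \<exists>y. RL (e 0) y \<and> \<not> LL (e 0) y)"
    by (intro dpred_intros dpred2[OF dpred_rlim] dpred2[OF dpred_llim])
  define W where "W l x \<longleftrightarrow> l ! 0 < x \<and> x < l ! 1 \<and> (\<exists>y\<in>X. (\<forall>z. x < z \<and> z < l ! 1 \<longrightarrow> z \<in> B y (l ! 2)) \<and>
      (\<forall>z. l ! 0 < z \<and> z < x \<longrightarrow> z \<notin> B y (3 * l ! 2)))" for l x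
  show "\<exists>l\<in>lists D. W l x" if "\<exists>y. RL x y \<and> \<not> LL x y" for x
  proof -
    obtain y where y: "RL x y" "\<not> LL x y" using \<open>\<exists>y. _\<close> by blast
    have yX: "y \<in> X" by (rule RL_X[OF y(1)])
    obtain s where s: "0 < s" "\<And>b. b < x \<Longrightarrow> \<exists>z. b < z \<and> z < x \<and> z \<notin> B y s"
      using y(2) yX unfolding llim_def by blast
    obtain C t where C: "dpred (\<lambda>e. e 0 \<in> C)" "0 < t" "B y t \<subseteq> C" "C \<subseteq> B y s"
      using basis[OF yX s(1)] by blast
    obtain b where b: "b < x" "(\<forall>z. b < z \<and> z < x \<longrightarrow> z \<in> C) \<or> (\<forall>z. b < z \<and> z < x \<longrightarrow> z \<notin> C)"
      using left_germ[OF C(1), of x] by blast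
    then have far: "z \<notin> B y t" if "b < z" "z < x" for z using s(2)[OF b(1)] C(3,4) that by blast
    \<comment> \<open>The left germ stays out of \<open>B y t\<close>, so this choice keeps it out
      of the ball of radius 3 r.\<close>
    obtain r where r: "r \<in> D" "0 < r" "r < t / 3" using dense[of 0 "t / 3"] C(2) by auto
    obtain c where c: "x < c" "\<And>z. x < z \<Longrightarrow> z < c \<Longrightarrow> z \<in> B y r" using RL_near[OF y(1) r(2)] by blast
    obtain p where p: "p \<in> D" "b < p" "p < x" using dense[OF b(1)] by blast
    obtain q where q: "q \<in> D" "x < q" "q < c" using dense[OF c(1)] by blast
    have "B y (3 * r) \<subseteq> B y t" using r by (intro ball_mono) simp
    then show ?thesis using p q r c far yX
      by (intro bexI[of _ "[p, q, r]"]) (auto simp: W_def numeral_2_eq_2 intro!: bexI[of _ y])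
  qed
  show False if W: "W l x" "W l x'" "x < x'" for l x x'
  proof -
    obtain y where y: "y \<in> X" "\<forall>z. x < z \<and> z < l ! 1 \<longrightarrow> z \<in> B y (l ! 2)" using W(1) unfolding W_def by blast
    obtain y' where y': "y' \<in> X" "\<forall>z. x' < z \<and> z < l ! 1 \<longrightarrow> z \<in> B y' (l ! 2)"
      "\<forall>z. l ! 0 < z \<and> z < x' \<longrightarrow> z \<notin> B y' (3 * l ! 2)" using W(2) unfolding W_def by blast
    have l: "l ! 0 < x" "x' < l ! 1" using W by (auto simp: W_def)
    obtain z where z: "x < z" "z < x'" using dense_order_class.dense[OF W(3)] by blast
    obtain w where w: "x' < w" "w < l ! 1" using dense_order_class.dense[OF l(2)] by blast
    have "z \<in> B y' (3 * l ! 2)"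
      using ball_shift[OF y(1) y'(1), of w "l ! 2" z] y(2) y'(2) z w l W(3) by auto
    then show False using y'(3) z l by auto
  qed
qed

text \<open>The mirror image: the point close to both limits is now taken left of x, and the
  contradiction arises at y.\<close>

lemma finite_left_only: "finite {x. \<exists>y. LL x y \<and> \<not> RL x y}"
proof (rule not_small_family)
  show "dpred (\<lambda>e. \<exists>y. LL (e 0) y \<and> \<not> RL (e 0) y)"
    by (intro dpred_intros dpred2[OF dpred_rlim] dpred2[OF dpred_llim])
  define W where "W l x \<longleftrightarrow> l ! 0 < x \<and> x < l ! 1 \<and> (\<exists>y\<in>X. (\<forall>z. l ! 0 < z \<and> z < x \<longrightarrow> z \<in> B y (l ! 2)) \<and>
      (\<forall>z. x < z \<and> z < l ! 1 \<longrightarrow> z \<notin> B y (3 * l ! 2)))" for l x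
  show "\<exists>l\<in>lists D. W l x" if "\<exists>y. LL x y \<and> \<not> RL x y" for x
  proof -
    obtain y where y: "LL x y" "\<not> RL x y" using \<open>\<exists>y. _\<close> by blast
    have yX: "y \<in> X" by (rule LL_X[OF y(1)])
    obtain s where s: "0 < s" "\<And>b. x < b \<Longrightarrow> \<exists>z. x < z \<and> z < b \<and> z \<notin> B y s"
      using y(2) yX unfolding rlim_def by blast
    obtain C t where C: "dpred (\<lambda>e. e 0 \<in> C)" "0 < t" "B y t \<subseteq> C" "C \<subseteq> B y s"
      using basis[OF yX s(1)] by blast
    obtain b where b: "x < b" "(\<forall>z. x < z \<and> z < b \<longrightarrow> z \<in> C) \<or> (\<forall>z. x < z \<and> z < b \<longrightarrow> z \<notin> C)"
      using right_germ[OF C(1), of x] by blast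
    then have far: "z \<notin> B y t" if "x < z" "z < b" for z using s(2)[OF b(1)] C(3,4) that by blast
    obtain r where r: "r \<in> D" "0 < r" "r < t / 3" using dense[of 0 "t / 3"] C(2) by auto
    obtain c where c: "c < x" "\<And>z. c < z \<Longrightarrow> z < x \<Longrightarrow> z \<in> B y r" using LL_near[OF y(1) r(2)] by blast
    obtain p where p: "p \<in> D" "c < p" "p < x" using dense[OF c(1)] by blast
    obtain q where q: "q \<in> D" "x < q" "q < b" using dense[OF b(1)] by blast
    have "B y (3 * r) \<subseteq> B y t" using r by (intro ball_mono) simp
    then show ?thesis using p q r c far yX
      by (intro bexI[of _ "[p, q, r]"]) (auto simp: W_def numeral_2_eq_2 intro!: bexI[of _ y])
  qed
  show False if W: "W l x" "W l x'" "x < x'" for l x x'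
  proof -
    obtain y where y: "y \<in> X" "\<forall>z. l ! 0 < z \<and> z < x \<longrightarrow> z \<in> B y (l ! 2)"
      "\<forall>z. x < z \<and> z < l ! 1 \<longrightarrow> z \<notin> B y (3 * l ! 2)" using W(1) unfolding W_def by blast
    obtain y' where y': "y' \<in> X" "\<forall>z. l ! 0 < z \<and> z < x' \<longrightarrow> z \<in> B y' (l ! 2)"
      using W(2) unfolding W_def by blast
    have l: "l ! 0 < x" "x' < l ! 1" using W by (auto simp: W_def)
    obtain z where z: "x < z" "z < x'" using dense_order_class.dense[OF W(3)] by blast
    obtain w where w: "l ! 0 < w" "w < x" using dense_order_class.dense[OF l(1)] by blast
    have "z \<in> B y (3 * l ! 2)"
      using ball_shift[OF y'(1) y(1), of w "l ! 2" z] y(2) y'(2) z w l W(3) by auto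
    then show False using y(3) z l by auto
  qed
qed

text \<open>Here all points between the two ends other than x are within r of y, while x is at least
  3 r away. For a second point x' with the same data, x is one of the ordinary points near y', and a
  common point right of x' brings it within 3 r of y.\<close>

lemma finite_displaced: "finite {x. \<exists>y. RL x y \<and> LL x y \<and> x \<noteq> y \<and> x \<in> X}"
proof (rule not_small_family)
  show "dpred (\<lambda>e. \<exists>y. RL (e 0) y \<and> LL (e 0) y \<and> e 0 \<noteq> y \<and> e 0 \<in> X)"
    by (intro dpred_intros dpred2[OF dpred_rlim] dpred2[OF dpred_llim] dpred1[OF dpred_X])
  define W where "W l x \<longleftrightarrow> l ! 0 < x \<and> x < l ! 1 \<and> (\<exists>y\<in>X. x \<notin> B y (3 * l ! 2) \<and>
      (\<forall>z. l ! 0 < z \<and> z < l ! 1 \<and> z \<noteq> x \<longrightarrow> z \<in> B y (l ! 2)))" for l x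
  show "\<exists>l\<in>lists D. W l x" if "\<exists>y. RL x y \<and> LL x y \<and> x \<noteq> y \<and> x \<in> X" for x
  proof -
    obtain y where y: "RL x y" "LL x y" "x \<noteq> y" "x \<in> X" using \<open>\<exists>y. _\<close> by blast
    have yX: "y \<in> X" by (rule RL_X[OF y(1)])
    have "0 < d y x" using d_nonneg[OF yX y(4)] d_zero[OF yX y(4)] y(3) by auto
    then obtain r where r: "r \<in> D" "0 < r" "r < d y x / 3" using dense[of 0 "d y x / 3"] by auto
    obtain c where c: "c < x" "\<And>z. c < z \<Longrightarrow> z < x \<Longrightarrow> z \<in> B y r" using LL_near[OF y(2) r(2)] by blast
    obtain b where b: "x < b" "\<And>z. x < z \<Longrightarrow> z < b \<Longrightarrow> z \<in> B y r" using RL_near[OF y(1) r(2)] by blast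
    obtain p where p: "p \<in> D" "c < p" "p < x" using dense[OF c(1)] by blast
    obtain q where q: "q \<in> D" "x < q" "q < b" using dense[OF b(1)] by blast
    have near: "z \<in> B y r" if "p < z" "z < q" "z \<noteq> x" for z
      using c(2)[of z] b(2)[of z] that p q by (cases "z < x") auto
    have "x \<notin> B y (3 * r)" using r(3) by (simp add: mball_def)
    then show ?thesis using p q r near yX
      by (intro bexI[of _ "[p, q, r]"]) (auto simp: W_def numeral_2_eq_2 intro!: bexI[of _ y])
  qed
  show False if W: "W l x" "W l x'" "x < x'" for l x x'
  proof -
    obtain y where y: "y \<in> X" "x \<notin> B y (3 * l ! 2)"
      "\<forall>z. l ! 0 < z \<and> z < l ! 1 \<and> z \<noteq> x \<longrightarrow> z \<in> B y (l ! 2)" using W(1) unfolding W_def by blast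
    obtain y' where y': "y' \<in> X" "\<forall>z. l ! 0 < z \<and> z < l ! 1 \<and> z \<noteq> x' \<longrightarrow> z \<in> B y' (l ! 2)"
      using W(2) unfolding W_def by blast
    have l: "l ! 0 < x" "x' < l ! 1" using W by (auto simp: W_def)
    obtain w where w: "x' < w" "w < l ! 1" using dense_order_class.dense[OF l(2)] by blast
    have "x \<in> B y (3 * l ! 2)"
      using ball_shift[OF y'(1) y(1), of w "l ! 2" x] y(3) y'(2) w l W(3) by auto
    then show False using y(2) by simp
  qed
qed

text \<open>An interval of such points would be disjoint from X, yet a convergent germ based in it
  consists of points of X.\<close>

lemma finite_outside: "finite {x. (\<exists>y. RL x y) \<and> x \<notin> X}"
proof (rule ccontr)
  assume inf: "infinite {x. (\<exists>y. RL x y) \<and> x \<notin> X}"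
  have "dpred (\<lambda>e. (\<exists>y. RL (e 0) y) \<and> e 0 \<notin> X)"
    by (intro dpred_intros dpred2[OF dpred_rlim] dpred1[OF dpred_X])
  from infinite_oint[OF this inf] obtain I where I: "oint I" "\<And>x. x \<in> I \<Longrightarrow> (\<exists>y. RL x y) \<and> x \<notin> X" by blast
  obtain x where x: "x \<in> I" using oint_nonempty[OF I(1)] by blast
  then obtain y where "RL x y" using I(2) by blast
  then obtain z where "z \<in> I" "z \<in> B y 1" using RL_meets_oint[OF _ I(1) x zero_less_one] by blast
  then show False using I(2) by (auto simp: mball_def)
qed

text \<open>Four sets suffice: different limits of the two germs put x into the first set, and a
  convergent left germ at a point outside X is covered by the second or the fourth.\<close>

definition exceptional :: "'a set" where
  "exceptional = {x. \<exists>y. RL x y \<and> \<not> LL x y} \<union> {x. \<exists>y. LL x y \<and> \<not> RL x y} \<union>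
     {x. \<exists>y. RL x y \<and> LL x y \<and> x \<noteq> y \<and> x \<in> X} \<union> {x. (\<exists>y. RL x y) \<and> x \<notin> X}"

lemma finite_exceptional: "finite exceptional"
  unfolding exceptional_def
  using finite_right_only finite_left_only finite_displaced finite_outside by simp

lemma RL_cases: "RL x y \<Longrightarrow> x \<in> exceptional \<or> (y = x \<and> RL x x \<and> LL x x)"
  and LL_cases: "LL x y \<Longrightarrow> x \<in> exceptional \<or> (y = x \<and> RL x x \<and> LL x x)"
  unfolding exceptional_def by blast+

end

section \<open>The definable metric\<close>

text \<open>A pseudometric gluing copies of \<open>[0, \<infinity>)\<close>, one for each label, at their origins; points
  without a label sit on a copy of their own.\<close>

definition hedgehog :: "('b \<Rightarrow> 'c \<Rightarrow> bool) \<Rightarrow> ('b \<Rightarrow> 'a::linordered_field) \<Rightarrow> 'b \<Rightarrow> 'b \<Rightarrow> 'a" where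
  "hedgehog L w x y = (if \<exists>v. L x v \<and> L y v then \<bar>w x - w y\<bar> else w x + w y)"

lemma hedgehog_nonneg: "(\<And>x. 0 \<le> w x) \<Longrightarrow> 0 \<le> hedgehog L w x y"
  by (simp add: hedgehog_def)

lemma hedgehog_sym: "hedgehog L w x y = hedgehog L w y x"
  by (auto simp: hedgehog_def abs_minus_commute)

text \<open>Since labels are unique, sharing a label is transitive. So a path over y either stays on
  one copy of the half-line or passes through the common origin.\<close>

lemma hedgehog_triangle:
  assumes "\<And>x. 0 \<le> w x" "\<And>x v v'. L x v \<Longrightarrow> L x v' \<Longrightarrow> v = v'"
  shows "hedgehog L w x z \<le> hedgehog L w x y + hedgehog L w y z"
proof -
  have w: "0 \<le> w x" "0 \<le> w y" "0 \<le> w z" by (rule assms(1))+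
  let ?S = "\<lambda>x y. \<exists>v. L x v \<and> L y v"
  have t: "?S x y \<Longrightarrow> ?S y z \<Longrightarrow> ?S x z" "?S x y \<Longrightarrow> ?S x z \<Longrightarrow> ?S y z" "?S x z \<Longrightarrow> ?S y z \<Longrightarrow> ?S x y"
    using assms(2) by metis+
  have h: "hedgehog L w x y = (if ?S x y then \<bar>w x - w y\<bar> else w x + w y)" for x y
    by (simp add: hedgehog_def)
  consider "?S x y" "?S y z" "?S x z" | "?S x y" "\<not> ?S y z" "\<not> ?S x z" | "\<not> ?S x y" "?S y z" "\<not> ?S x z"
    | "\<not> ?S x y" "\<not> ?S y z" using t by blast
  then show ?thesis
  proof cases
    case 1 then have "hedgehog L w x y = \<bar>w x - w y\<bar>" "hedgehog L w y z = \<bar>w y - w z\<bar>" "hedgehog L w x z = \<bar>w x - w z\<bar>"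
      by (simp_all only: h if_True)
    then show ?thesis by linarith
  next
    case 2 then have "hedgehog L w x y = \<bar>w x - w y\<bar>" "hedgehog L w y z = w y + w z" "hedgehog L w x z = w x + w z"
      by (simp_all only: h if_True if_False)
    then show ?thesis by linarith
  next
    case 3 then have "hedgehog L w x y = w x + w y" "hedgehog L w y z = \<bar>w y - w z\<bar>" "hedgehog L w x z = w x + w z"
      by (simp_all only: h if_True if_False)
    then show ?thesis by linarith
  next
    case 4 then have "hedgehog L w x y = w x + w y" "hedgehog L w y z = w y + w z"
      by (simp_all only: h if_False)
    moreover have "hedgehog L w x z \<le> w x + w z" using w unfolding h by (simp add: abs_if)
    ultimately show ?thesis using w by linarith
  qed
qed

lemma finite_if_unique: "(\<And>y y'. P y \<Longrightarrow> P y' \<Longrightarrow> y = y') \<Longrightarrow> finite {y. P y}"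
proof (cases "\<exists>y. P y")
  case True
  assume unique: "\<And>y y'. P y \<Longrightarrow> P y' \<Longrightarrow> y = y'"
  obtain y0 where "P y0" using True by blast
  then have "{y. P y} \<subseteq> {y0}" using unique by blast
  then show ?thesis by (rule finite_subset) simp
qed simp

section \<open>Vertices and the distance to them\<close>

context line_space
begin

definition eucl :: "'a set" where
  "eucl = {x. RL x x \<and> LL x x}"

lemma dpred_eucl: "dfunc s \<Longrightarrow> dpred (\<lambda>e. s e \<in> eucl)"
  unfolding eucl_def mem_Collect_eq by (intro dpred_intros dpred2[OF dpred_rlim] dpred2[OF dpred_llim])

text \<open>An infinite boundary would contain an interval, and P is constant on some subinterval of
  it.\<close>

lemma finite_boundary:
  assumes "dpred (\<lambda>e. P (e 0))"
  shows "finite {x. \<not> (\<exists>\<epsilon>>0. \<forall>z. \<bar>z - x\<bar> < \<epsilon> \<longrightarrow> P z = P x)}"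
proof (rule ccontr)
  let ?Q = "\<lambda>x. \<not> (\<exists>\<epsilon>>0. \<forall>z. \<bar>z - x\<bar> < \<epsilon> \<longrightarrow> P z = P x)"
  \<comment> \<open>The same condition with equality of truth values split into implications, for
    which closure rules exist.\<close>
  let ?Q' = "\<lambda>x. \<not> (\<exists>\<epsilon>. 0 < \<epsilon> \<and> (\<forall>z. \<bar>z - x\<bar> < \<epsilon> \<longrightarrow> (P z \<longrightarrow> P x) \<and> (P x \<longrightarrow> P z)))"
  assume inf: "infinite {x. ?Q x}"
  have "dpred (\<lambda>e. ?Q' (e 0))" by (intro dpred_intros dpred1[OF assms])
  then have "dpred (\<lambda>e. ?Q (e 0))" by (rule dpred_iff_rewrite) (metis (full_types))
  from infinite_oint[OF this inf] obtain I where I: "oint I" "\<And>x. x \<in> I \<Longrightarrow> ?Q x" by blast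
  have no: False if J: "oint J" "J \<subseteq> I" "\<And>x y. x \<in> J \<Longrightarrow> y \<in> J \<Longrightarrow> P x = P y" for J
  proof -
    obtain a b where ab: "a < b" "J = {a<..<b}" using J(1) by (auto simp: oint_def)
    obtain x where x: "x \<in> J" using oint_nonempty[OF J(1)] by blast
    have "\<forall>z. \<bar>z - x\<bar> < min (x - a) (b - x) \<longrightarrow> P z = P x"
    proof (intro allI impI)
      fix z assume "\<bar>z - x\<bar> < min (x - a) (b - x)"
      then have "a < z" "z < b" by (simp_all add: abs_less_iff)
      then show "P z = P x" using J(3)[OF _ x, of z] ab by simp
    qed
    moreover have "0 < min (x - a) (b - x)" using x ab by simp
    ultimately show False using I(2)[of x] x J(2) by blast
  qed
  moreover have "infinite {x\<in>I. P x} \<or> infinite {x\<in>I. \<not> P x}"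
  proof (rule ccontr)
    assume "\<not> ?thesis"
    then have "finite ({x\<in>I. P x} \<union> {x\<in>I. \<not> P x})" by simp
    moreover have "{x\<in>I. P x} \<union> {x\<in>I. \<not> P x} = I" by blast
    ultimately show False using oint_infinite[OF I(1)] by simp
  qed
  ultimately show False
  proof (elim disjE)
    assume "infinite {x\<in>I. P x}"
    from oint_infinite_sub[OF assms I(1) this] obtain J where "oint J" "J \<subseteq> I" "\<And>x. x \<in> J \<Longrightarrow> P x" by blast
    then show False using no[of J] by blast
  next
    assume "infinite {x\<in>I. \<not> P x}"
    from oint_infinite_sub[OF dpred_not[OF assms] I(1) this] obtain J where
      "oint J" "J \<subseteq> I" "\<And>x. x \<in> J \<Longrightarrow> \<not> P x" by blast
    then show False using no[of J] by blast
  qed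
qed

text \<open>Limits of exceptional germs are included so that any other point can be the limit of its
  own germs only, and the boundary of \<open>eucl\<close> so that membership in \<open>eucl\<close>
  is locally constant elsewhere. The point 0 makes the set nonempty and bounds the distance to it by
  1 on X.\<close>

definition vertices :: "'a set" where
  "vertices = insert 0 (exceptional \<union> {y. \<exists>x\<in>exceptional. RL x y \<or> LL x y} \<union>
     {x. \<not> (\<exists>\<epsilon>>0. \<forall>z. \<bar>z - x\<bar> < \<epsilon> \<longrightarrow> (z \<in> eucl) = (x \<in> eucl))})"

lemma finite_vertices: "finite vertices"
proof -
  have "finite {y. RL x y}" for x by (rule finite_if_unique) (rule RL_unique)
  moreover have "finite {y. LL x y}" for x by (rule finite_if_unique) (rule LL_unique)
  ultimately have "finite (\<Union>x\<in>exceptional. {y. RL x y} \<union> {y. LL x y})"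
    using finite_exceptional by blast
  moreover have "{y. \<exists>x\<in>exceptional. RL x y \<or> LL x y} = (\<Union>x\<in>exceptional. {y. RL x y} \<union> {y. LL x y})"
    by blast
  moreover have "finite {x. \<not> (\<exists>\<epsilon>>0. \<forall>z. \<bar>z - x\<bar> < \<epsilon> \<longrightarrow> (z \<in> eucl) = (x \<in> eucl))}"
    by (rule finite_boundary) (intro dpred_eucl dfunc_var)
  ultimately show ?thesis unfolding vertices_def using finite_exceptional by simp
qed

text \<open>The factor 2 makes the intervals of radius \<open>gap\<close> around the vertices
  disjoint.\<close>

definition gap :: 'a where
  "gap = (SOME \<delta>. 0 < \<delta> \<and> (\<forall>y\<in>vertices. \<forall>y'\<in>vertices. y \<noteq> y' \<longrightarrow> 2 * \<delta> \<le> \<bar>y - y'\<bar>))"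

lemma gap: "0 < gap" "y \<in> vertices \<Longrightarrow> y' \<in> vertices \<Longrightarrow> y \<noteq> y' \<Longrightarrow> 2 * gap \<le> \<bar>y - y'\<bar>"
proof -
  have "0 < gap \<and> (\<forall>y\<in>vertices. \<forall>y'\<in>vertices. y \<noteq> y' \<longrightarrow> 2 * gap \<le> \<bar>y - y'\<bar>)"
    unfolding gap_def by (rule someI_ex) (use finite_gap[OF finite_vertices] in blast)
  then show "0 < gap" "y \<in> vertices \<Longrightarrow> y' \<in> vertices \<Longrightarrow> y \<noteq> y' \<Longrightarrow> 2 * gap \<le> \<bar>y - y'\<bar>" by blast+
qed

definition vdist :: "'a \<Rightarrow> 'a" where
  "vdist x = Min ((\<lambda>z. \<bar>x - z\<bar>) ` vertices)"

lemma vertices_nonempty: "vertices \<noteq> {}" "0 \<in> vertices"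
  by (auto simp: vertices_def)

lemma vdist_le: "z \<in> vertices \<Longrightarrow> vdist x \<le> \<bar>x - z\<bar>"
  unfolding vdist_def using finite_vertices by (intro Min_le) auto

lemma vdist_attained: obtains z where "z \<in> vertices" "vdist x = \<bar>x - z\<bar>"
proof -
  have "vdist x \<in> (\<lambda>z. \<bar>x - z\<bar>) ` vertices"
    unfolding vdist_def using finite_vertices vertices_nonempty by (intro Min_in) auto
  then show ?thesis using that by blast
qed

lemma vdist_nonneg: "0 \<le> vdist x"
  by (rule vdist_attained[of x]) simp

lemma vdist_zero: "vdist x = 0 \<longleftrightarrow> x \<in> vertices"
proof
  assume "vdist x = 0" then show "x \<in> vertices" by (metis vdist_attained abs_eq_0 right_minus_eq)
next
  assume "x \<in> vertices" then show "vdist x = 0" using vdist_le[of x x] vdist_nonneg[of x] by simp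
qed

lemma vdist_Lipschitz: "\<bar>vdist x - vdist y\<bar> \<le> \<bar>x - y\<bar>"
proof -
  have "vdist x \<le> vdist y + \<bar>x - y\<bar>" for x y
  proof -
    obtain z where "z \<in> vertices" "vdist y = \<bar>y - z\<bar>" by (rule vdist_attained)
    then show ?thesis using vdist_le[of z x] by linarith
  qed
  from this[of x y] this[of y x] show ?thesis by linarith
qed

lemma vdist_near: assumes "z \<in> vertices" "\<bar>x - z\<bar> < gap" shows "vdist x = \<bar>x - z\<bar>"
proof -
  obtain z' where z': "z' \<in> vertices" "vdist x = \<bar>x - z'\<bar>" by (rule vdist_attained)
  have "z' = z"
  proof (rule ccontr)
    assume "z' \<noteq> z"
    then have "2 * gap \<le> \<bar>z' - z\<bar>" using gap(2) z'(1) assms(1) by blast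
    then show False using vdist_le[OF assms(1), of x] z'(2) assms(2) by linarith
  qed
  then show ?thesis using z' by simp
qed

lemma vertex_near_unique:
  "z \<in> vertices \<Longrightarrow> z' \<in> vertices \<Longrightarrow> \<bar>x - z\<bar> < gap \<Longrightarrow> \<bar>x - z'\<bar> < gap \<Longrightarrow> z = z'"
  using gap(2)[of z z'] by linarith

lemma dfunc_vdist: "dfunc s \<Longrightarrow> dfunc (\<lambda>e. vdist (s e))"
proof (rule dfunc1[of vdist], rule dfunc_graphI)
  have "dpred (\<lambda>e. (\<exists>z\<in>vertices. e 0 = \<bar>e (Suc 0) - z\<bar>) \<and> (\<forall>z\<in>vertices. e 0 \<le> \<bar>e (Suc 0) - z\<bar>))"
    by (intro dpred_conj dpred_finite_Bex dpred_finite_Ball finite_vertices dpred_intros)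
  then show "dpred (\<lambda>e. e 0 = vdist (e (Suc 0)))"
  proof (rule dpred_iff_rewrite)
    fix e :: "nat \<Rightarrow> 'a"
    obtain z where "z \<in> vertices" "vdist (e (Suc 0)) = \<bar>e (Suc 0) - z\<bar>" by (rule vdist_attained)
    then show "(\<exists>z\<in>vertices. e 0 = \<bar>e (Suc 0) - z\<bar>) \<and> (\<forall>z\<in>vertices. e 0 \<le> \<bar>e (Suc 0) - z\<bar>) \<longleftrightarrow>
        e 0 = vdist (e (Suc 0))"
      using vdist_le[of _ "e (Suc 0)"] by (auto intro: antisym)
  qed
qed

text \<open>Either z is exceptional, and thus a vertex, or z equals v.\<close>

lemma RL_vertex: "RL z v \<Longrightarrow> v \<in> vertices \<Longrightarrow> z \<in> vertices"
  and LL_vertex: "LL z v \<Longrightarrow> v \<in> vertices \<Longrightarrow> z \<in> vertices"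
  using RL_cases LL_cases unfolding vertices_def by blast+

text \<open>The base point z cannot be exceptional, because limits of exceptional germs are
  vertices.\<close>

lemma RL_not_vertex: "RL z v \<Longrightarrow> v \<notin> vertices \<Longrightarrow> z = v \<and> v \<in> eucl"
  and LL_not_vertex: "LL z v \<Longrightarrow> v \<notin> vertices \<Longrightarrow> z = v \<and> v \<in> eucl"
  using RL_cases LL_cases unfolding vertices_def eucl_def by blast+

text \<open>The vertex v to which the end of an interval containing x is attached. It may differ
  from the Euclidean neighbour z of x: what matters is that the germ of z on the side of x converges
  to v.\<close>

definition label :: "'a \<Rightarrow> 'a \<Rightarrow> bool" where
  "label x v \<longleftrightarrow> v \<in> vertices \<and> v \<in> X \<and> x \<in> nbd gap v"

lemma label_cases:
  assumes "label x v"
  obtains "x = v" | z where "z \<in> vertices" "z < x" "x < z + gap" "RL z v"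
    | z where "z \<in> vertices" "z - gap < x" "x < z" "LL z v"
  using assms RL_vertex LL_vertex unfolding label_def nbd_def by blast

lemma label_near:
  assumes "label x v" obtains z where "z \<in> vertices" "\<bar>x - z\<bar> < gap" "x = v \<Longrightarrow> z = v"
  using assms
proof (cases rule: label_cases)
  case 1 then show ?thesis using assms gap(1) by (intro that[of v]) (auto simp: label_def)
next
  case (2 z)
  moreover have "\<bar>x - z\<bar> < gap" using 2 by (simp add: abs_less_iff)
  ultimately show ?thesis using assms vertex_near_unique[of v z x] gap(1)
    by (intro that[of z]) (auto simp: label_def)
next
  case (3 z)
  moreover have "\<bar>x - z\<bar> < gap" using 3 by (simp add: abs_less_iff algebra_simps)
  ultimately show ?thesis using assms vertex_near_unique[of v z x] gap(1)
    by (intro that[of z]) (auto simp: label_def)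
qed

lemma label_vertex: assumes "label x v" "x \<in> vertices" shows "x = v"
  using assms(1)
proof (cases rule: label_cases)
  case (2 z)
  then have "x = z" using vertex_near_unique[OF assms(2) 2(1), of x] gap(1) by (simp add: abs_less_iff)
  then show ?thesis using 2 by simp
next
  case (3 z)
  then have "x = z" using vertex_near_unique[OF assms(2) 3(1), of x] gap(1) by (simp add: abs_less_iff algebra_simps)
  then show ?thesis using 3 by simp
qed

text \<open>Near a vertex the labels depend only on that vertex and the side, so they are constant
  along an end of length \<open>gap\<close>.\<close>

lemma label_right:
  assumes "z \<in> vertices" "z < x" "x < z + gap"
  shows "label x v \<longleftrightarrow> v \<in> vertices \<and> RL z v"
proof
  have near: "\<bar>x - z\<bar> < gap" using assms by (simp add: abs_less_iff)
  assume L: "label x v"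
  then have v: "v \<in> vertices" by (simp add: label_def)
  from L show "v \<in> vertices \<and> RL z v"
  proof (cases rule: label_cases)
    case 1
    then have "v = z" using vertex_near_unique[OF v assms(1), of x] near gap(1) by simp
    then show ?thesis using 1 assms by simp
  next
    case (2 z')
    then have "z' = z" using vertex_near_unique[OF 2(1) assms(1), of x] near by (simp add: abs_less_iff)
    then show ?thesis using 2 v by simp
  next
    case (3 z')
    then have "z' = z"
      using vertex_near_unique[OF 3(1) assms(1), of x] near by (simp add: abs_less_iff algebra_simps)
    then show ?thesis using 3 assms by simp
  qed
next
  assume "v \<in> vertices \<and> RL z v"
  then show "label x v" using assms RL_X unfolding label_def nbd_def by blast
qed

lemma label_left:
  assumes "z \<in> vertices" "z - gap < x" "x < z"
  shows "label x v \<longleftrightarrow> v \<in> vertices \<and> LL z v"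
proof
  have near: "\<bar>x - z\<bar> < gap" using assms by (simp add: abs_less_iff algebra_simps)
  assume L: "label x v"
  then have v: "v \<in> vertices" by (simp add: label_def)
  from L show "v \<in> vertices \<and> LL z v"
  proof (cases rule: label_cases)
    case 1
    then have "v = z" using vertex_near_unique[OF v assms(1), of x] near gap(1) by simp
    then show ?thesis using 1 assms by simp
  next
    case (2 z')
    then have "z' = z" using vertex_near_unique[OF 2(1) assms(1), of x] near by (simp add: abs_less_iff)
    then show ?thesis using 2 assms by simp
  next
    case (3 z')
    then have "z' = z"
      using vertex_near_unique[OF 3(1) assms(1), of x] near by (simp add: abs_less_iff algebra_simps)
    then show ?thesis using 3 v by simp
  qed
next
  assume "v \<in> vertices \<and> LL z v"
  then show "label x v" using assms LL_X unfolding label_def nbd_def by blast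
qed

lemma label_unique: assumes "label x v" "label x v'" shows "v = v'"
  using assms(1)
proof (cases rule: label_cases)
  case 1
  then have "x \<in> vertices" using assms(1) by (simp add: label_def)
  then show ?thesis using label_vertex[OF assms(1)] label_vertex[OF assms(2)] by simp
next
  case (2 z)
  then show ?thesis using label_right[OF 2(1-3)] assms(2) RL_unique by blast
next
  case (3 z)
  then show ?thesis using label_left[OF 3(1-3)] assms(2) LL_unique by blast
qed

lemma label_vdist: "label x v \<Longrightarrow> vdist x < gap"
  using label_near vdist_near by metis

lemma label_self: "v \<in> vertices \<Longrightarrow> v \<in> X \<Longrightarrow> label v v"
  by (simp add: label_def nbd_def)

text \<open>The height on the hedgehog. A vertex of X sits at height \<open>gap\<close>; the height
  drops to 0 as the distance from the vertices reaches \<open>gap\<close>, where labels end.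
  Unlabelled points are at the origin, so the function does not jump there.\<close>

definition weight :: "'a \<Rightarrow> 'a" where
  "weight x = (if \<exists>v. label x v then gap - vdist x else 0)"

lemma weight_nonneg: "0 \<le> weight x"
  using label_vdist by (auto simp: weight_def less_imp_le)

text \<open>With equality as the label, a point outside \<open>eucl\<close> is at least
  \<open>spike x\<close> away from all other points. Using the distance to the vertices, and not a
  constant, lets an end made of isolated points still converge to a vertex.\<close>

definition spike :: "'a \<Rightarrow> 'a" where
  "spike x = (if x \<in> eucl then 0 else vdist x)"

definition bump :: "'a \<Rightarrow> 'a" where
  "bump x = (if x \<in> eucl then vdist x else 0)"

text \<open>The first summand describes the neighbourhoods of the vertices and the second one makes the
  remaining points outside \<open>eucl\<close> isolated. On \<open>eucl\<close> off the vertices, \<open>x\<close> is the quotient of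
  \<open>x * bump x\<close> and \<open>bump x\<close>, both of which vanish at the vertices.\<close>

definition dmet :: "'a \<Rightarrow> 'a \<Rightarrow> 'a" where
  "dmet x y = hedgehog label weight x y + hedgehog (=) spike x y +
     \<bar>bump x - bump y\<bar> + \<bar>x * bump x - y * bump y\<bar>"

section \<open>The new metric compared with the neighbourhoods made of germs\<close>

lemma spike_nonneg: "0 \<le> spike x" and bump_nonneg: "0 \<le> bump x"
  and spike_le: "spike x \<le> vdist x" and bump_le: "bump x \<le> vdist x"
  by (auto simp: spike_def bump_def vdist_nonneg)

lemma dmet_terms:
  "0 \<le> hedgehog label weight x y" "0 \<le> hedgehog (=) spike x y"
  by (simp_all add: hedgehog_nonneg weight_nonneg spike_nonneg)

lemma dfunc_dmet: "dfunc (\<lambda>e. dmet (e 0) (e (Suc 0)))"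
proof -
  have nb: "dpred (\<lambda>e. s e \<in> nbd gap (t e))" if "dfunc s" "dfunc t" for s t
    by (intro dpred_nbd that dfunc_const)
  have vx: "dpred (\<lambda>e. s e \<in> vertices)" if "dfunc s" for s
  proof -
    have "dpred (\<lambda>e. \<exists>z\<in>vertices. s e = z)"
      by (intro dpred_finite_Bex finite_vertices dpred_eq that dfunc_const)
    then show ?thesis by simp
  qed
  have lab: "dpred (\<lambda>e. label (s e) (t e))" if "dfunc s" "dfunc t" for s t
    unfolding label_def by (intro dpred_conj nb vx dpred1[OF dpred_X] that)
  have w: "dfunc (\<lambda>e. weight (s e))" if "dfunc s" for s
    unfolding weight_def by (intro dpred_intros lab dfunc_vdist dfunc_shift1 that)
  have sp: "dfunc (\<lambda>e. spike (s e))" "dfunc (\<lambda>e. bump (s e))" if "dfunc s" for s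
    unfolding spike_def bump_def by (intro dfunc_if dpred_eucl dfunc_vdist dfunc_const that)+
  show ?thesis unfolding dmet_def hedgehog_def by (intro dpred_intros lab w sp)
qed

lemma dmet_bounds:
  assumes "dmet x y < \<epsilon>"
  shows "hedgehog label weight x y < \<epsilon>" "hedgehog (=) spike x y < \<epsilon>"
    "\<bar>bump x - bump y\<bar> < \<epsilon>" "\<bar>x * bump x - y * bump y\<bar> < \<epsilon>"
  using assms dmet_terms[of x y] unfolding dmet_def by linarith+

text \<open>Such a point can be the limit only of its own germs. For \<eta> \<le> 0 the interval is
  empty, which the union with {y} accounts for.\<close>

lemma nbd_not_vertex:
  assumes "y \<notin> vertices" shows "nbd \<eta> y = (if y \<in> eucl then {z. \<bar>z - y\<bar> < \<eta>} \<union> {y} else {y})"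
proof (cases "y \<in> eucl")
  case True
  have lims: "RL y y" "LL y y" using True by (simp_all add: eucl_def)
  have "nbd \<eta> y = {z. z = y \<or> (y < z \<and> z < y + \<eta>) \<or> (y - \<eta> < z \<and> z < y)}"
    unfolding nbd_def using RL_not_vertex[OF _ assms] LL_not_vertex[OF _ assms] lims by blast
  also have "\<dots> = {z. \<bar>z - y\<bar> < \<eta>} \<union> {y}"
    by (auto simp: abs_less_iff algebra_simps)
  finally show ?thesis using True by simp
next
  case False
  then have "nbd \<eta> y = {y}"
    unfolding nbd_def using RL_not_vertex[OF _ assms] LL_not_vertex[OF _ assms] by blast
  then show ?thesis using False by simp
qed

lemma nbd_vertex_vdist:
  assumes "y \<in> vertices" "x \<in> nbd \<eta> y" "0 < \<eta>" "\<eta> \<le> gap" shows "vdist x < \<eta>"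
proof -
  have "\<exists>z\<in>vertices. \<bar>x - z\<bar> < \<eta>"
  proof -
    consider "x = y" | z where "RL z y" "z < x" "x < z + \<eta>" | z where "LL z y" "z - \<eta> < x" "x < z"
      using assms(2) unfolding nbd_def by blast
    then show ?thesis
    proof cases
      case 1 then show ?thesis using assms(1,3) by (intro bexI[of _ y]) auto
    next
      case (2 z) then show ?thesis using RL_vertex[OF _ assms(1)]
        by (intro bexI[of _ z]) (auto simp: abs_less_iff)
    next
      case (3 z) then show ?thesis using LL_vertex[OF _ assms(1)]
        by (intro bexI[of _ z]) (auto simp: abs_less_iff algebra_simps)
    qed
  qed
  then show ?thesis using vdist_le le_less_trans by blast
qed

text \<open>At a vertex each of the four summands is at most \<open>vdist x\<close>, the last one
  because |x| < 1. At any other point of \<open>eucl\<close> they are at most |x - y|, 0, |x - y|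
  and 2 |x - y|. Both cases lead to the fraction \<epsilon> / 4.\<close>

lemma dmet_small:
  assumes y: "y \<in> X" and \<epsilon>: "0 < \<epsilon>"
  shows "\<exists>\<eta>>0. \<forall>x\<in>X. x \<in> nbd \<eta> y \<longrightarrow> dmet y x < \<epsilon>"
proof (cases "y \<in> vertices")
  case True
  define \<eta> where "\<eta> = min gap (\<epsilon> / 4)"
  have \<eta>: "0 < \<eta>" "\<eta> \<le> gap" "4 * \<eta> \<le> \<epsilon>" using gap(1) \<epsilon> by (auto simp: \<eta>_def)
  have "dmet y x < \<epsilon>" if x: "x \<in> X" "x \<in> nbd \<eta> y" for x
  proof -
    have t: "vdist x < \<eta>" by (rule nbd_vertex_vdist[OF True x(2) \<eta>(1,2)])
    have t0: "vdist y = 0" using True by (simp add: vdist_zero)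
    have "x \<in> nbd gap y" using x(2) \<eta>(2) unfolding nbd_def by fastforce
    then have L: "label x y" "label y y" using True y by (auto simp: label_def nbd_def)
    then have "hedgehog label weight y x = vdist x"
      using t0 vdist_nonneg[of x] by (auto simp: hedgehog_def weight_def)
    moreover have "hedgehog (=) spike y x \<le> vdist x"
      using spike_le[of x] spike_le[of y] spike_nonneg[of x] spike_nonneg[of y] t0
      by (auto simp: hedgehog_def vdist_nonneg)
    moreover have b0: "bump y = 0" using bump_le[of y] bump_nonneg[of y] t0 by simp
    moreover have "\<bar>bump y - bump x\<bar> \<le> vdist x" using b0 bump_le[of x] bump_nonneg[of x] by simp
    moreover have "\<bar>y * bump y - x * bump x\<bar> \<le> vdist x"
    proof -
      have "\<bar>x\<bar> * bump x \<le> 1 * bump x"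
        using bounded[OF x(1)] bump_nonneg[of x] by (intro mult_right_mono) auto
      then show ?thesis using b0 bump_le[of x] bump_nonneg[of x] by (simp add: abs_mult)
    qed
    ultimately show ?thesis unfolding dmet_def using t \<eta>(3) by linarith
  qed
  then show ?thesis using \<eta>(1) by blast
next
  case nv: False
  show ?thesis
  proof (cases "y \<in> eucl")
    case False
    have "hedgehog label weight y y = 0"
      by (auto simp: hedgehog_def weight_def)
    then have "dmet y y = 0" by (simp add: dmet_def hedgehog_def[of "(=)"])
    then show ?thesis using nbd_not_vertex[OF nv] False \<epsilon> by (intro exI[of _ 1]) auto
  next
    case True
    obtain \<epsilon>1 where \<epsilon>1: "0 < \<epsilon>1" "\<And>z. \<bar>z - y\<bar> < \<epsilon>1 \<Longrightarrow> z \<in> eucl"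
      using nv True unfolding vertices_def by blast
    have ty: "0 < vdist y" using vdist_zero[of y] vdist_nonneg[of y] nv by auto
    \<comment> \<open>The bounds keep x inside \<open>eucl\<close>, on the same side of the nearest
      vertex as y, and within \<open>gap\<close> of that vertex if y is; the 1 is a dummy for the
      case without a label.\<close>
    define \<eta> where "\<eta> = min (min \<epsilon>1 (vdist y)) (min (\<epsilon> / 4) (if vdist y < gap then gap - vdist y else 1))"
    have \<eta>: "0 < \<eta>" "\<eta> \<le> \<epsilon>1" "\<eta> \<le> vdist y" "4 * \<eta> \<le> \<epsilon>" "vdist y < gap \<Longrightarrow> \<eta> \<le> gap - vdist y"
      using \<epsilon> \<epsilon>1 ty by (auto simp: \<eta>_def)
    have "dmet y x < \<epsilon>" if x: "x \<in> X" "\<bar>x - y\<bar> < \<eta>" for x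
    proof -
      have E: "x \<in> eucl" using \<epsilon>1(2) x(2) \<eta>(2) by simp
      have lip: "\<bar>vdist y - vdist x\<bar> \<le> \<bar>x - y\<bar>" using vdist_Lipschitz[of y x] by (simp add: abs_minus_commute)
      have b: "bump x = vdist x" "bump y = vdist y" using True E by (auto simp: bump_def)
      have "hedgehog (=) spike y x = 0" using True E by (auto simp: hedgehog_def spike_def)
      moreover have "\<bar>y * bump y - x * bump x\<bar> \<le> 2 * \<bar>x - y\<bar>"
      proof -
        \<comment> \<open>Both factors of this splitting are controlled:
          \<open>vdist y \<le> 1\<close> since 0 is a vertex, and |x| < 1.\<close>
        have "y * vdist y - x * vdist x = (y - x) * vdist y + x * (vdist y - vdist x)"
          by (simp add: algebra_simps)
        then have "\<bar>y * vdist y - x * vdist x\<bar> \<le> \<bar>y - x\<bar> * vdist y + \<bar>x\<bar> * \<bar>vdist y - vdist x\<bar>"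
          using abs_triangle_ineq[of "(y - x) * vdist y" "x * (vdist y - vdist x)"] ty by (simp add: abs_mult)
        moreover have "vdist y \<le> 1" using vdist_le[OF vertices_nonempty(2), of y] bounded[OF y] by simp
        then have "\<bar>y - x\<bar> * vdist y \<le> \<bar>y - x\<bar> * 1" by (intro mult_left_mono) auto
        moreover have "\<bar>x\<bar> * \<bar>vdist y - vdist x\<bar> \<le> 1 * \<bar>x - y\<bar>"
          using bounded[OF x(1)] lip by (intro mult_mono) auto
        ultimately show ?thesis unfolding b by (simp add: abs_minus_commute)
      qed
      moreover have "hedgehog label weight y x \<le> \<bar>x - y\<bar>"
      proof (cases "vdist y < gap")
        case near: True
        obtain z where z: "z \<in> vertices" "vdist y = \<bar>y - z\<bar>" by (rule vdist_attained)
        have zy: "z \<noteq> y" using z(1) nv by blast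
        have "label x v \<longleftrightarrow> label y v" for v
        proof (cases "z < y")
          case True
          then have "z < x" "x < z + gap" "z < y" "y < z + gap"
            using x(2) \<eta>(3,5) z(2) near by (auto simp: abs_less_iff)
          then show ?thesis using label_right[OF z(1)] by simp
        next
          case False
          then have "x < z" "z - gap < x" "y < z" "z - gap < y"
            using x(2) \<eta>(3,5) z(2) near zy by (auto simp: abs_less_iff)
          then show ?thesis using label_left[OF z(1)] by simp
        qed
        then have "hedgehog label weight y x = 0 \<or> hedgehog label weight y x = \<bar>vdist y - vdist x\<bar>"
          by (auto simp: hedgehog_def weight_def abs_minus_commute)
        then show ?thesis using lip by auto
      next
        case False
        then have nl: "\<not> label y v" for v using label_vdist by blast
        then have "hedgehog label weight y x = weight x" by (auto simp: hedgehog_def weight_def)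
        moreover have "weight x \<le> \<bar>x - y\<bar>" using False lip by (auto simp: weight_def)
        ultimately show ?thesis by simp
      qed
      moreover have "\<bar>bump y - bump x\<bar> \<le> \<bar>x - y\<bar>" using lip unfolding b .
      ultimately have "dmet y x \<le> \<bar>x - y\<bar> + 0 + \<bar>x - y\<bar> + 2 * \<bar>x - y\<bar>"
        unfolding dmet_def by (intro add_mono) simp_all
      also have "\<dots> = 4 * \<bar>x - y\<bar>" by simp
      also have "\<dots> < 4 * \<eta>" using x(2) by simp
      finally show ?thesis using \<eta>(4) by simp
    qed
    then show ?thesis using nbd_not_vertex[OF nv] True \<eta>(1) by (intro exI[of _ \<eta>]) auto
  qed
qed

text \<open>At a vertex y, distance below \<open>gap\<close>, the weight of y, forces a common
  label, and then the first summand equals \<open>vdist x\<close>. A non-vertex outside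
  \<open>eucl\<close> is separated by its spike, and on \<open>eucl\<close> the last two summands
  control x - y.\<close>

lemma dmet_separates:
  assumes y: "y \<in> X" and \<eta>: "0 < \<eta>"
  shows "\<exists>\<epsilon>>0. \<forall>x\<in>X. dmet y x < \<epsilon> \<longrightarrow> x \<in> nbd \<eta> y"
proof (cases "y \<in> vertices")
  case True
  have "x \<in> nbd \<eta> y" if x: "dmet y x < min \<eta> gap" for x
  proof -
    have t0: "vdist y = 0" using True by (simp add: vdist_zero)
    have L: "label y y" by (rule label_self[OF True y])
    then have wy: "weight y = gap" using t0 by (auto simp: weight_def)
    have small: "hedgehog label weight y x < min \<eta> gap" by (rule dmet_bounds(1)[OF x])
    have "\<exists>v. label y v \<and> label x v"
    proof (rule ccontr)
      assume "\<not> ?thesis"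
      then have "hedgehog label weight y x = gap + weight x"
        unfolding hedgehog_def wy by (simp only: if_False)
      then show False using small weight_nonneg[of x] by simp
    qed
    then have Lx: "label x y" using label_unique[OF L] by blast
    then have "hedgehog label weight y x = vdist x"
      using L t0 vdist_nonneg[of x] by (auto simp: hedgehog_def weight_def)
    then have t: "vdist x < \<eta>" using small by simp
    from Lx show ?thesis
    proof (cases rule: label_cases)
      case (2 z)
      then have "vdist x = x - z" using vdist_near[OF 2(1), of x] by (simp add: abs_if)
      then show ?thesis using 2 t unfolding nbd_def by (auto simp: algebra_simps)
    next
      case (3 z)
      then have "vdist x = z - x" using vdist_near[OF 3(1), of x] by (simp add: abs_if algebra_simps)
      then show ?thesis using 3 t unfolding nbd_def by (auto simp: algebra_simps)
    qed (simp add: nbd_def)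
  qed
  then show ?thesis using \<eta> gap(1) by (intro exI[of _ "min \<eta> gap"]) auto
next
  case nv: False
  have ty: "0 < vdist y" using vdist_zero[of y] vdist_nonneg[of y] nv by auto
  show ?thesis
  proof (cases "y \<in> eucl")
    case False
    have "x = y" if "dmet y x < vdist y" for x
    proof (rule ccontr)
      assume "x \<noteq> y"
      then have "hedgehog (=) spike y x = vdist y + spike x" using False by (simp add: hedgehog_def spike_def)
      then show False using dmet_bounds(2)[OF that] spike_nonneg[of x] by simp
    qed
    then show ?thesis using ty by (intro exI[of _ "vdist y"]) (auto simp: nbd_def)
  next
    case True
    define a where "a = vdist y"
    \<comment> \<open>The first bound keeps \<open>bump x\<close> above a / 2. The second makes
      twice \<epsilon> at most \<eta> times a / 2, and dividing by a / 2 leaves \<eta>.\<close>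
    define \<epsilon> where "\<epsilon> = min (a / 2) (\<eta> * a / 4)"
    have \<epsilon>: "0 < \<epsilon>" "\<epsilon> \<le> a / 2" "\<epsilon> \<le> \<eta> * a / 4" using \<eta> ty by (auto simp: \<epsilon>_def a_def)
    have "\<bar>x - y\<bar> < \<eta>" if x: "dmet y x < \<epsilon>" for x
    proof -
      have b: "bump y = a" using True by (simp add: bump_def a_def)
      have 1: "\<bar>a - bump x\<bar> < \<epsilon>" using dmet_bounds(3)[OF x] b by simp
      have 2: "\<bar>y * a - x * bump x\<bar> < \<epsilon>" using dmet_bounds(4)[OF x] b by simp
      have bx: "a / 2 < bump x" using 1 \<epsilon>(2) by (auto simp: abs_less_iff)
      have "(y - x) * bump x = y * (bump x - a) + (y * a - x * bump x)" by (simp add: algebra_simps)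
      then have "\<bar>(y - x) * bump x\<bar> \<le> \<bar>y\<bar> * \<bar>bump x - a\<bar> + \<bar>y * a - x * bump x\<bar>"
        using abs_triangle_ineq[of "y * (bump x - a)" "y * a - x * bump x"] by (simp add: abs_mult)
      moreover have "\<bar>y\<bar> * \<bar>bump x - a\<bar> \<le> 1 * \<bar>bump x - a\<bar>"
        using bounded[OF y] by (intro mult_right_mono) auto
      ultimately have "\<bar>y - x\<bar> * bump x < \<eta> * (a / 2)"
        using 1 2 \<epsilon>(3) bump_nonneg[of x] by (simp add: abs_mult abs_minus_commute)
      moreover have "\<bar>y - x\<bar> * (a / 2) \<le> \<bar>y - x\<bar> * bump x" using bx by (intro mult_left_mono) auto
      ultimately have "\<bar>y - x\<bar> * (a / 2) < \<eta> * (a / 2)" by simp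
      moreover have "0 < a / 2" using ty by (simp add: a_def)
      ultimately have "\<bar>y - x\<bar> < \<eta>" using mult_less_cancel_right_pos by blast
      then show ?thesis by (simp add: abs_minus_commute)
    qed
    then show ?thesis using nbd_not_vertex[OF nv] True \<epsilon>(1) by (intro exI[of _ \<epsilon>]) auto
  qed
qed

lemma dmet_refines: assumes "y \<in> X" "0 < r" shows "\<exists>s>0. mball X dmet y s \<subseteq> B y r"
proof -
  obtain \<eta> where "0 < \<eta>" "nbd \<eta> y \<subseteq> B y r" using nbd_subset_ball[OF assms] by blast
  moreover obtain \<epsilon> where "0 < \<epsilon>" "\<forall>x\<in>X. dmet y x < \<epsilon> \<longrightarrow> x \<in> nbd \<eta> y"
    using dmet_separates[OF assms(1) calculation(1)] by blast
  ultimately show ?thesis by (intro exI[of _ \<epsilon>]) (auto simp: mball_def)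
qed

lemma dmet_coarsens: assumes "y \<in> X" "0 < r" shows "\<exists>s>0. B y s \<subseteq> mball X dmet y r"
proof -
  obtain \<eta> where "0 < \<eta>" "\<forall>x\<in>X. x \<in> nbd \<eta> y \<longrightarrow> dmet y x < r" using dmet_small[OF assms] by blast
  moreover obtain s where "0 < s" "B y s \<subseteq> nbd \<eta> y" using ball_subset_nbd[OF assms(1) calculation(1)] by blast
  ultimately show ?thesis by (intro exI[of _ s]) (auto simp: mball_def)
qed

lemma dmet_metric: "R_metric X dmet"
  unfolding R_metric_def
proof (intro conjI ballI)
  fix x y assume xy: "x \<in> X" "y \<in> X"
  show "0 \<le> dmet x y" using dmet_terms[of x y] by (simp add: dmet_def)
  show "dmet x y = dmet y x"
    unfolding dmet_def hedgehog_sym[of _ _ x y] by (simp add: abs_minus_commute)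
  show "dmet x y = 0 \<longleftrightarrow> x = y"
  proof
    assume z: "dmet x y = 0"
    \<comment> \<open>Instead of inspecting the formula, the point y, at new distance 0 from x, is
      placed in every ball of the old metric around x.\<close>
    have "\<not> 0 < d x y"
    proof
      assume "0 < d x y"
      then obtain s where "0 < s" "mball X dmet x s \<subseteq> B x (d x y)" using dmet_refines[OF xy(1)] by blast
      then show False using z xy by (auto simp: mball_def)
    qed
    then show "x = y" using d_nonneg[OF xy] d_zero[OF xy] by simp
  next
    assume "x = y"
    moreover have "hedgehog label weight x x = 0" by (auto simp: hedgehog_def weight_def)
    ultimately show "dmet x y = 0" by (simp add: dmet_def hedgehog_def[of "(=)"])
  qed
next
  fix x y z
  have "hedgehog label weight x z \<le> hedgehog label weight x y + hedgehog label weight y z"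
    by (rule hedgehog_triangle[OF weight_nonneg label_unique])
  moreover have "hedgehog (=) spike x z \<le> hedgehog (=) spike x y + hedgehog (=) spike y z"
    by (rule hedgehog_triangle[OF spike_nonneg]) simp
  ultimately show "dmet x z \<le> dmet x y + dmet y z" unfolding dmet_def by linarith
qed

end

section \<open>Transfer to \<open>R\<^sup>n\<close>\<close>

lemma metric_generates_iff:
  assumes "R_metric (topspace T) d"
  shows "metric_generates d T \<longleftrightarrow>
    (\<forall>U. openin T U \<longleftrightarrow> U \<subseteq> topspace T \<and> (\<forall>x\<in>U. \<exists>r>0. mball (topspace T) d x r \<subseteq> U))"
proof -
  let ?X = "topspace T"
  have tri: "d x z \<le> d x y + d y z" if "x \<in> ?X" "y \<in> ?X" "z \<in> ?X" for x y z
    using assms that unfolding R_metric_def by blast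
  have zero: "d x x = 0" if "x \<in> ?X" for x using assms that unfolding R_metric_def by blast
  have "(arbitrary union_of (\<lambda>S. \<exists>x\<in>?X. \<exists>r>0. S = {y \<in> ?X. d x y < r})) U \<longleftrightarrow>
      U \<subseteq> ?X \<and> (\<forall>x\<in>U. \<exists>r>0. mball ?X d x r \<subseteq> U)" for U
    unfolding arbitrary_union_of_alt
  proof (intro iffI conjI ballI subsetI)
    fix x assume a: "\<forall>x\<in>U. \<exists>S. (\<exists>x\<in>?X. \<exists>r>0. S = {y \<in> ?X. d x y < r}) \<and> x \<in> S \<and> S \<subseteq> U" and x: "x \<in> U"
    then obtain y r where y: "y \<in> ?X" "0 < r" "x \<in> ?X" "d y x < r" "{z \<in> ?X. d y z < r} \<subseteq> U" by blast
    then show "x \<in> ?X" by blast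
    have "mball ?X d x (r - d y x) \<subseteq> U"
    proof
      fix z assume z: "z \<in> mball ?X d x (r - d y x)"
      then have "d y z < r" using tri[OF y(1,3), of z] by (auto simp: mball_def)
      then show "z \<in> U" using z y(5) by (auto simp: mball_def)
    qed
    then show "\<exists>r>0. mball ?X d x r \<subseteq> U" using y(4) by (intro exI[of _ "r - d y x"]) simp
  next
    fix x assume a: "U \<subseteq> ?X \<and> (\<forall>x\<in>U. \<exists>r>0. mball ?X d x r \<subseteq> U)" and x: "x \<in> U"
    then obtain r where r: "0 < r" "mball ?X d x r \<subseteq> U" by blast
    have "x \<in> ?X" using a x by blast
    then show "\<exists>S. (\<exists>x\<in>?X. \<exists>r>0. S = {y \<in> ?X. d x y < r}) \<and> x \<in> S \<and> S \<subseteq> U"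
      using r zero[of x] by (intro exI[of _ "mball ?X d x r"]) (auto simp: mball_def)
  qed
  then show ?thesis unfolding metric_generates_def by (simp add: fun_eq_iff)
qed

context omin_field
begin

text \<open>The metric is carried along h, so only definability is at stake. \<open>N u\<close> is
  the image of the basic open set with parameter u. By \<open>K1\<close> and \<open>K2\<close> the
  sets \<open>N u\<close> containing y are cofinal with the balls around y, so a quantifier over
  radii can be replaced by one over the definable parameter set \<open>\<Omega>\<close>.\<close>

lemma transfer_to_line:
  assumes X: "topspace T = X" "definable M n X"
    and h: "dfunc (\<lambda>e. h (restr n e))" "inj_on h X" "\<And>x. \<bar>h x\<bar> < 1"
    and d: "R_metric X d" "metric_generates d T"
    and Fam: "definable_family M n Fam" "openin T = arbitrary union_of (\<lambda>S. S \<in> Fam)"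
  shows "line_space M D (h ` X) (\<lambda>a b. d (inv_into X h a) (inv_into X h b))"
proof -
  define g where "g = inv_into X h"
  define X' where "X' = h ` X"
  define d' where "d' a b = d (g a) (g b)" for a b
  have gh: "g (h x) = x" if "x \<in> X" for x using h(2) that by (simp add: g_def)
  have Xt: "X \<subseteq> tuples n" by (rule definable_subset_tuples[OF X(2)])
  obtain k \<Omega> \<Phi> where \<Omega>: "definable M k \<Omega>" and \<Phi>: "definable M (k + n) \<Phi>"
    and Fam_eq: "Fam = {{x \<in> tuples n. cat k u x \<in> \<Phi>} |u. u \<in> \<Omega>}"
    using Fam(1) unfolding definable_family_def by blast
  have \<Omega>t: "\<Omega> \<subseteq> tuples k" by (rule definable_subset_tuples[OF \<Omega>])
  have open_iff: "openin T U \<longleftrightarrow> U \<subseteq> X \<and> (\<forall>x\<in>U. \<exists>r>0. mball X d x r \<subseteq> U)" for U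
    using metric_generates_iff[of T d] d X(1) by simp
  define N where "N u z \<longleftrightarrow> (\<exists>x\<in>tuples n. x \<in> X \<and> h x = z \<and> cat k u x \<in> \<Phi>)" for u z
  have dN: "dpred (\<lambda>e. N (restr k (\<lambda>i. t i e)) (s e))" if "\<And>i. dfunc (t i)" "dfunc s" for t s
  proof -
    have "dpred (\<lambda>e. restr n e \<in> X \<and> h (restr n e) = e (0 + n) \<and>
        cat k (restr k (\<lambda>i. e (Suc i + n))) (restr n e) \<in> \<Phi>)"
    proof (intro dpred_conj dpred_restr_mem X dpred_eq h(1) dfunc_var dpred_mem[OF \<Phi>])
      fix i assume "i < k + n"
      then show "dfunc (\<lambda>e. cat k (restr k (\<lambda>i. e (Suc i + n))) (restr n e) i)"
        by (cases "i < k") (simp_all add: cat_def dfunc_var less_diff_conv2)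
    next
      fix e :: "nat \<Rightarrow> 'a"
      show "cat k (restr k (\<lambda>i. e (Suc i + n))) (restr n e) \<in> tuples (k + n)"
        by (auto simp: tuples_iff cat_def restr_def)
    qed
    then have "dpred (\<lambda>e. N (restr k (\<lambda>i. e (Suc i))) (e 0))"
      unfolding N_def by (rule dpred_ex_tuple)
    from dpred_subst[OF this, of "\<lambda>i. case i of 0 \<Rightarrow> s | Suc j \<Rightarrow> t j"]
    show ?thesis using that by (simp split: nat.splits)
  qed
  have X'mem: "y \<in> X' \<Longrightarrow> g y \<in> X \<and> h (g y) = y" for y
    using gh by (auto simp: X'_def)
  have K1: "\<exists>s>0. mball X' d' y s \<subseteq> {z. N u z}" if u: "u \<in> \<Omega>" "N u y" for u y
  proof -
    let ?B = "{x \<in> tuples n. cat k u x \<in> \<Phi>}"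
    obtain x where x: "x \<in> X" "h x = y" "x \<in> ?B" using u(2) unfolding N_def by blast
    have "?B \<in> Fam" using u(1) unfolding Fam_eq by blast
    then have "openin T ?B" unfolding Fam(2) by (rule arbitrary_union_of_inc)
    then obtain s where s: "0 < s" "mball X d x s \<subseteq> ?B" using x(3) unfolding open_iff by blast
    have "N u z" if "z \<in> mball X' d' y s" for z
    proof -
      have "z \<in> X'" "d x (g z) < s" using that x gh[OF x(1)] by (auto simp: mball_def d'_def)
      then have "g z \<in> X" "h (g z) = z" "g z \<in> ?B" using X'mem s(2) by (auto simp: mball_def)
      then show ?thesis unfolding N_def by blast
    qed
    then show ?thesis using s(1) by blast
  qed
  have K2: "\<exists>u\<in>\<Omega>. N u y \<and> {z. N u z} \<subseteq> mball X' d' y r" if "y \<in> X'" "0 < r" for y r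
  proof -
    have gy: "g y \<in> X" "h (g y) = y" using X'mem[OF that(1)] by auto
    have zero: "d (g y) (g y) = 0" using d(1) gy unfolding R_metric_def by blast
    have "openin T (mball X d (g y) r)" unfolding open_iff
    proof (intro conjI ballI)
      fix x assume x: "x \<in> mball X d (g y) r"
      have "mball X d x (r - d (g y) x) \<subseteq> mball X d (g y) r"
      proof
        fix z assume z: "z \<in> mball X d x (r - d (g y) x)"
        then have "d (g y) z \<le> d (g y) x + d x z"
          using d(1) gy(1) x unfolding R_metric_def mball_def by blast
        then show "z \<in> mball X d (g y) r" using z by (auto simp: mball_def)
      qed
      then show "\<exists>s>0. mball X d x s \<subseteq> mball X d (g y) r"
        using x by (intro exI[of _ "r - d (g y) x"]) (auto simp: mball_def)
    qed (auto simp: mball_def)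
    then have "\<exists>S. S \<in> Fam \<and> g y \<in> S \<and> S \<subseteq> mball X d (g y) r"
      using that(2) gy zero unfolding Fam(2) arbitrary_union_of_alt by (auto simp: mball_def)
    then obtain u where u: "u \<in> \<Omega>" "g y \<in> {x \<in> tuples n. cat k u x \<in> \<Phi>}"
      "{x \<in> tuples n. cat k u x \<in> \<Phi>} \<subseteq> mball X d (g y) r" unfolding Fam_eq by blast
    have "N u y" using u(2) gy unfolding N_def by blast
    moreover have "z \<in> mball X' d' y r" if z: "N u z" for z
    proof -
      obtain x where x: "x \<in> X" "h x = z" "x \<in> {x \<in> tuples n. cat k u x \<in> \<Phi>}"
        using z unfolding N_def by blast
      then have "d (g y) x < r" using u(3) by (auto simp: mball_def)
      then show ?thesis using x gh[OF x(1)] by (auto simp: mball_def d'_def X'_def)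
    qed
    ultimately show ?thesis using u(1) by blast
  qed
  have dX': "dpred (\<lambda>e. e 0 \<in> X')"
  proof -
    have "dpred (\<lambda>e. restr n e \<in> X \<and> h (restr n e) = e (0 + n))"
      by (intro dpred_conj dpred_restr_mem X dpred_eq h(1) dfunc_var)
    then have "dpred (\<lambda>e. \<exists>x\<in>tuples n. x \<in> X \<and> h x = e 0)" by (rule dpred_ex_tuple)
    moreover have "(\<exists>x\<in>tuples n. x \<in> X \<and> h x = c) \<longleftrightarrow> c \<in> X'" for c
      unfolding X'_def using Xt by blast
    ultimately show ?thesis by simp
  qed
  \<comment> \<open>\<open>R\<close> and \<open>S\<close> abstract the position of b and the
    one-sided interval, which covers right and left germs at once.\<close>
  have lim_iff: "(\<forall>r>0. \<exists>b. R x b \<and> (\<forall>z. S x b z \<longrightarrow> z \<in> mball X' d' y r)) \<longleftrightarrow>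
      (\<forall>u\<in>tuples k. u \<in> \<Omega> \<and> N u y \<longrightarrow> (\<exists>b. R x b \<and> (\<forall>z. S x b z \<longrightarrow> N u z)))"
    if y: "y \<in> X'" for R :: "'a \<Rightarrow> 'a \<Rightarrow> bool" and S :: "'a \<Rightarrow> 'a \<Rightarrow> 'a \<Rightarrow> bool" and x y
  proof (intro iffI ballI allI impI)
    fix u assume a: "\<forall>r>0. \<exists>b. R x b \<and> (\<forall>z. S x b z \<longrightarrow> z \<in> mball X' d' y r)" and u: "u \<in> \<Omega> \<and> N u y"
    obtain s where s: "0 < s" "mball X' d' y s \<subseteq> {z. N u z}" using K1 u by blast
    then obtain b where "R x b" "\<forall>z. S x b z \<longrightarrow> z \<in> mball X' d' y s" using a by blast
    then show "\<exists>b. R x b \<and> (\<forall>z. S x b z \<longrightarrow> N u z)" using s(2) by blast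
  next
    fix r :: 'a
    assume a: "\<forall>u\<in>tuples k. u \<in> \<Omega> \<and> N u y \<longrightarrow> (\<exists>b. R x b \<and> (\<forall>z. S x b z \<longrightarrow> N u z))" and r: "0 < r"
    obtain u where u: "u \<in> \<Omega>" "N u y" "{z. N u z} \<subseteq> mball X' d' y r" using K2[OF y r] by blast
    then obtain b where "R x b" "\<forall>z. S x b z \<longrightarrow> N u z" using a \<Omega>t by blast
    then show "\<exists>b. R x b \<and> (\<forall>z. S x b z \<longrightarrow> z \<in> mball X' d' y r)" using u(3) by blast
  qed
  have "line_space M D X' d'"
  proof unfold_locales
    have mX: "(0 \<le> d x y \<and> (d x y = 0 \<longleftrightarrow> x = y) \<and> d x y = d y x)" if "x \<in> X" "y \<in> X" for x y
      using d(1) that unfolding R_metric_def by blast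
    have tX: "d x z \<le> d x y + d y z" if "x \<in> X" "y \<in> X" "z \<in> X" for x y z
      using d(1) that unfolding R_metric_def by blast
    show "R_metric X' d'"
      unfolding R_metric_def X'_def d'_def by (simp add: gh mX tX inj_on_eq_iff[OF h(2)])
  next
    fix x assume "x \<in> X'" then show "\<bar>x\<bar> < 1" using h(3) by (auto simp: X'_def)
  next
    show "dpred (\<lambda>e. e 0 \<in> X')" by (rule dX')
  next
    fix y r :: 'a assume y: "y \<in> X'" and r: "0 < r"
    obtain u where u: "u \<in> \<Omega>" "N u y" "{z. N u z} \<subseteq> mball X' d' y r" using K2[OF y r] by blast
    obtain s where s: "0 < s" "mball X' d' y s \<subseteq> {z. N u z}" using K1 u by blast
    have "dpred (\<lambda>e. N (restr k (\<lambda>i. u i)) (e 0))" by (intro dN dfunc_const dfunc_var)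
    moreover have "restr k u = u" using u(1) \<Omega>t by auto
    ultimately have "dpred (\<lambda>e. e 0 \<in> {z. N u z})" by simp
    then show "\<exists>B s. dpred (\<lambda>e. e 0 \<in> B) \<and> 0 < s \<and> mball X' d' y s \<subseteq> B \<and> B \<subseteq> mball X' d' y r"
      using s u(3) by blast
  next
    have "dpred (\<lambda>e. e (Suc 0) \<in> X' \<and> (\<forall>u\<in>tuples k. u \<in> \<Omega> \<and> N u (e (Suc 0)) \<longrightarrow>
        (\<exists>b. e 0 < b \<and> (\<forall>z. e 0 < z \<and> z < b \<longrightarrow> N u z))))"
      by (intro dpred_conj dpred1[OF dX'] dpred_all_tuple dpred_intros dN dpred_restr_mem \<Omega>)
    then show "dpred (\<lambda>e. rlim X' d' (e 0) (e (Suc 0)))"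
    proof (rule dpred_iff_rewrite)
      fix e :: "nat \<Rightarrow> 'a"
      show "(e (Suc 0) \<in> X' \<and> (\<forall>u\<in>tuples k. u \<in> \<Omega> \<and> N u (e (Suc 0)) \<longrightarrow>
        (\<exists>b. e 0 < b \<and> (\<forall>z. e 0 < z \<and> z < b \<longrightarrow> N u z)))) \<longleftrightarrow> rlim X' d' (e 0) (e (Suc 0))"
        unfolding rlim_def
        using lim_iff[of "e (Suc 0)" "\<lambda>x b. x < b" "e 0" "\<lambda>x b z. x < z \<and> z < b"] by blast
    qed
  next
    have "dpred (\<lambda>e. e (Suc 0) \<in> X' \<and> (\<forall>u\<in>tuples k. u \<in> \<Omega> \<and> N u (e (Suc 0)) \<longrightarrow>
        (\<exists>b. b < e 0 \<and> (\<forall>z. b < z \<and> z < e 0 \<longrightarrow> N u z))))"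
      by (intro dpred_conj dpred1[OF dX'] dpred_all_tuple dpred_intros dN dpred_restr_mem \<Omega>)
    then show "dpred (\<lambda>e. llim X' d' (e 0) (e (Suc 0)))"
    proof (rule dpred_iff_rewrite)
      fix e :: "nat \<Rightarrow> 'a"
      show "(e (Suc 0) \<in> X' \<and> (\<forall>u\<in>tuples k. u \<in> \<Omega> \<and> N u (e (Suc 0)) \<longrightarrow>
        (\<exists>b. b < e 0 \<and> (\<forall>z. b < z \<and> z < e 0 \<longrightarrow> N u z)))) \<longleftrightarrow> llim X' d' (e 0) (e (Suc 0))"
        unfolding llim_def
        using lim_iff[of "e (Suc 0)" "\<lambda>x b. b < x" "e 0" "\<lambda>x b z. b < z \<and> z < x"] by blast
    qed
  next
    fix y Z assume y: "y \<in> X'" and Z: "dpred (\<lambda>e. e 0 \<in> Z)"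
    have "dpred (\<lambda>e. \<forall>u\<in>tuples k. u \<in> \<Omega> \<and> N u y \<longrightarrow> (\<exists>z. N u z \<and> z \<in> Z \<and> z < e 0))"
      by (intro dpred_all_tuple dpred_intros dN dpred_restr_mem \<Omega> dpred1[OF Z])
    then show "dpred (\<lambda>e. \<forall>r>0. \<exists>z. z \<in> mball X' d' y r \<and> z \<in> Z \<and> z < e 0)"
    proof (rule dpred_iff_rewrite)
      fix e :: "nat \<Rightarrow> 'a"
      show "(\<forall>u\<in>tuples k. u \<in> \<Omega> \<and> N u y \<longrightarrow> (\<exists>z. N u z \<and> z \<in> Z \<and> z < e 0)) \<longleftrightarrow>
        (\<forall>r>0. \<exists>z. z \<in> mball X' d' y r \<and> z \<in> Z \<and> z < e 0)"
      proof (intro iffI ballI allI impI)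
        fix r :: 'a
        assume a: "\<forall>u\<in>tuples k. u \<in> \<Omega> \<and> N u y \<longrightarrow> (\<exists>z. N u z \<and> z \<in> Z \<and> z < e 0)" and r: "0 < r"
        obtain u where u: "u \<in> \<Omega>" "N u y" "{z. N u z} \<subseteq> mball X' d' y r" using K2[OF y r] by blast
        then obtain z where "N u z" "z \<in> Z" "z < e 0" using a \<Omega>t by blast
        then show "\<exists>z. z \<in> mball X' d' y r \<and> z \<in> Z \<and> z < e 0" using u(3) by blast
      next
        fix u
        assume a: "\<forall>r>0. \<exists>z. z \<in> mball X' d' y r \<and> z \<in> Z \<and> z < e 0" and u: "u \<in> \<Omega> \<and> N u y"
        obtain s where s: "0 < s" "mball X' d' y s \<subseteq> {z. N u z}" using K1 u by blast
        then obtain z where "z \<in> mball X' d' y s" "z \<in> Z" "z < e 0" using a by blast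
        then show "\<exists>z. N u z \<and> z \<in> Z \<and> z < e 0" using s(2) by blast
      qed
    qed
  qed
  then show ?thesis unfolding X'_def d'_def g_def .
qed

lemma definable_pullback:
  assumes X: "definable M n X" and h: "dfunc (\<lambda>e. h (restr n e))"
    and d: "dfunc (\<lambda>e. d (e 0) (e (Suc 0)))"
  shows "definable M (Suc (n + n)) {(cat n x y)(n + n := d (h x) (h y)) |x y. x \<in> X \<and> y \<in> X}"
    (is "definable M _ ?S")
proof (rule definable_eqI)
  let ?a = "\<lambda>e. restr n e" and ?b = "\<lambda>e. restr n (\<lambda>i. e (i + n))"
  have Xt: "X \<subseteq> tuples n" by (rule definable_subset_tuples[OF X])
  show "dpred (\<lambda>e. ?a e \<in> X \<and> ?b e \<in> X \<and> e (n + n) = d (h (?a e)) (h (?b e)))"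
    by (intro dpred_conj dpred_restr_mem[OF X] dpred_rename[OF dpred_restr_mem[OF X]] dpred_eq dfunc_var
        dfunc2[OF d] h dfunc_shift[OF h]) simp
  show "?S \<subseteq> tuples (Suc (n + n))"
    using Xt by (auto simp: tuples_iff cat_def subset_iff)
  fix e :: "nat \<Rightarrow> 'a" assume e: "e \<in> tuples (Suc (n + n))"
  show "e \<in> ?S \<longleftrightarrow> ?a e \<in> X \<and> ?b e \<in> X \<and> e (n + n) = d (h (?a e)) (h (?b e))"
  proof
    assume "e \<in> ?S"
    then obtain x y where xy: "x \<in> X" "y \<in> X" "e = (cat n x y)(n + n := d (h x) (h y))" by blast
    have "?a e = x"
    proof
      fix i show "?a e i = x i"
        using xy(3) subsetD[OF Xt xy(1)] by (cases "i < n") (auto simp: restr_def cat_def tuples_iff)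
    qed
    moreover have "?b e = y"
    proof
      fix i show "?b e i = y i"
        using xy(3) subsetD[OF Xt xy(2)] by (cases "i < n") (auto simp: restr_def cat_def tuples_iff)
    qed
    ultimately show "?a e \<in> X \<and> ?b e \<in> X \<and> e (n + n) = d (h (?a e)) (h (?b e))" using xy by simp
  next
    assume a: "?a e \<in> X \<and> ?b e \<in> X \<and> e (n + n) = d (h (?a e)) (h (?b e))"
    have "e = (cat n (?a e) (?b e))(n + n := d (h (?a e)) (h (?b e)))"
    proof
      fix i
      consider "i < n" | "n \<le> i" "i < n + n" | "i = n + n" | "Suc (n + n) \<le> i" by linarith
      then show "e i = ((cat n (?a e) (?b e))(n + n := d (h (?a e)) (h (?b e)))) i"
        using a e by cases (auto simp: cat_def restr_def tuples_iff)
    qed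
    then show "e \<in> ?S" using a by blast
  qed
qed

lemma definably_metrizable_if_metrizable:
  assumes "definable_top_space M n T" "omin_dim M n (topspace T) \<le> 1" "R_metrizable T"
  shows "definably_metrizable M n T"
proof -
  let ?X = "topspace T"
  have X: "definable M n ?X" using assms(1) by (simp add: definable_top_space_def)
  obtain Fam where Fam: "definable_family M n Fam" "openin T = arbitrary union_of (\<lambda>S. S \<in> Fam)"
    using assms(1) unfolding definable_top_space_def by blast
  obtain h where h: "dfunc (\<lambda>e. h (restr n e))" "inj_on h ?X" "\<And>x. \<bar>h x\<bar> < 1"
    using thin_injection[OF X thin_if_dim_le_1[OF X assms(2)]] by blast
  obtain d :: "(nat \<Rightarrow> 'a) \<Rightarrow> (nat \<Rightarrow> 'a) \<Rightarrow> 'a" where d: "R_metric ?X d" "metric_generates d T"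
    using assms(3) unfolding R_metrizable_def by blast
  define d' where "d' = (\<lambda>a b. d (inv_into ?X h a) (inv_into ?X h b))"
  interpret L: line_space M D "h ` ?X" d'
    unfolding d'_def by (rule transfer_to_line[OF refl X h d Fam])
  define \<rho> where "\<rho> x y = L.dmet (h x) (h y)" for x y
  have "R_metric ?X \<rho>"
  proof -
    note m = L.dmet_metric[unfolded R_metric_def]
    have "0 \<le> \<rho> x y \<and> (\<rho> x y = 0 \<longleftrightarrow> x = y) \<and> \<rho> x y = \<rho> y x" if "x \<in> ?X" "y \<in> ?X" for x y
      using conjunct1[OF m, rule_format, OF imageI[OF that(1)] imageI[OF that(2)]]
      unfolding \<rho>_def inj_on_eq_iff[OF h(2) that] .
    moreover have "\<rho> x z \<le> \<rho> x y + \<rho> y z" if "x \<in> ?X" "y \<in> ?X" "z \<in> ?X" for x y z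
      using conjunct2[OF m, rule_format, of "h x" "h y" "h z"] that unfolding \<rho>_def by simp
    ultimately show ?thesis unfolding R_metric_def by simp
  qed
  moreover have "definable M (Suc (n + n)) {(cat n x y)(n + n := \<rho> x y) |x y. x \<in> ?X \<and> y \<in> ?X}"
    unfolding \<rho>_def by (rule definable_pullback[OF X h(1) L.dfunc_dmet])
  moreover have "metric_generates \<rho> T"
  proof -
    have d_eq: "d' (h x) (h y) = d x y" if "x \<in> ?X" "y \<in> ?X" for x y
      using that h(2) by (simp add: d'_def)
    have 1: "\<exists>s>0. mball ?X \<rho> x s \<subseteq> mball ?X d x r" if x: "x \<in> ?X" and r: "0 < r" for x r
    proof -
      obtain s where "0 < s" "mball (h ` ?X) L.dmet (h x) s \<subseteq> mball (h ` ?X) d' (h x) r"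
        using L.dmet_refines[of "h x" r] x r by blast
      then show ?thesis using d_eq[OF x] by (intro exI[of _ s]) (auto simp: mball_def \<rho>_def subset_iff)
    qed
    have 2: "\<exists>s>0. mball ?X d x s \<subseteq> mball ?X \<rho> x r" if x: "x \<in> ?X" and r: "0 < r" for x r
    proof -
      obtain s where "0 < s" "mball (h ` ?X) d' (h x) s \<subseteq> mball (h ` ?X) L.dmet (h x) r"
        using L.dmet_coarsens[of "h x" r] x r by blast
      then show ?thesis using d_eq[OF x] by (intro exI[of _ s]) (auto simp: mball_def \<rho>_def subset_iff)
    qed
    have open_iff: "openin T U \<longleftrightarrow> U \<subseteq> ?X \<and> (\<forall>x\<in>U. \<exists>r>0. mball ?X d x r \<subseteq> U)" for U
      using metric_generates_iff[OF d(1)] d(2) by simp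
    have "(\<exists>r>0. mball ?X d x r \<subseteq> U) \<longleftrightarrow> (\<exists>r>0. mball ?X \<rho> x r \<subseteq> U)" if "x \<in> ?X" for x U
      using 1[OF that] 2[OF that] by (meson subset_trans)
    then show ?thesis
      unfolding metric_generates_iff[OF \<open>R_metric ?X \<rho>\<close>] open_iff by blast
  qed
  ultimately show ?thesis unfolding definably_metrizable_def definable_metric_def by blast
qed

end

lemma order_dense_between:
  assumes "order_dense (D :: 'a::linordered_field set)" "a < b"
  shows "\<exists>q\<in>D. a < q \<and> q < b"
proof -
  obtain x where x: "a < x" "x < b" using dense[OF assms(2)] by blast
  have "x \<in> ord_top closure_of D" using assms(1) by (simp add: order_dense_def)
  then have "\<exists>y. y \<in> D \<and> y \<in> {a<..<b}"
    using openin_ord_top_interval[of a b] x unfolding in_closure_of by (metis greaterThanLessThan_iff)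
  then show ?thesis by auto
qed

theorem theorem10p2:
  fixes M :: "('f, 'r, 'a::linordered_field) fo_structure"
    and n :: nat
    and T :: "(nat \<Rightarrow> 'a) topology"
  assumes "ominimal M"
    and "expands_ordered_field M"
    and "den_e TYPE('a) <o |UNIV :: 'a set|"
    and "definable_top_space M n T"
    and "omin_dim M n (topspace T) \<le> 1"
  shows "R_metrizable T \<longleftrightarrow> definably_metrizable M n T"
proof
  obtain D :: "'a set" where D: "order_dense D" "den_e TYPE('a) = |D|"
    using den_e_minimal(1) by blast
  interpret omin_field M D
    by unfold_locales (use assms(1-3) D order_dense_between[OF D(1)] in auto)
  show "definably_metrizable M n T" if "R_metrizable T"
    by (rule definably_metrizable_if_metrizable[OF assms(4,5) that])
next
  show "R_metrizable T" if "definably_metrizable M n T"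
    using that unfolding definably_metrizable_def definable_metric_def R_metrizable_def by blast
qed

end
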